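(* In the setting of random uniformly expanding maps described in the context, assume (LY), (Min) and (Dec). Let $\alpha\in(0,2)$, let $x_0\in[0,1]\setminus\mathcal{D}$ be non-recurrent and $\phi_{x_0}(x)=|x-x_0|^{-1/\alpha}$. Then for $\mathbb{P}$-a.e. $\omega\in\Omega$, $N_n^\omega$ converges in distribution to $N_{(\alpha)}$ under the probability measure $\nu^\omega$.
   Context: $m$ is Lebesgue measure; $\mathrm{Var}$ is total variation; $\mathrm{BV}$ is the space of functions of bounded variation on $[0,1]$ with $\|f\|_{\mathrm{BV}}=\mathrm{Var}(f)+\|f\|_{L^1(m)}$. Random uniformly expanding maps. $\mathcal{S}=\{T_1,\dots,T_q\}$ is a finite collection of maps $[0,1]\to[0,1]$. For each $T\in\mathcal{S}$ there is a finite partition $\mathcal{A}_T$ of $[0,1]$ into intervals such that for each $I\in\mathcal{A}_T$, $T|_I$ extends continuously to a strictly monotonic $C^2$ function on $\bar I$, and $\inf_{I\in\mathcal{A}_T}\inf_{x\in\bar I}|T'(x)|>1$. $\Omega=\{1,\dots,q\}^{\mathbb{Z}}$, $\sigma$ is the left shift, and $\mathbb{P}$ is the Bernoulli (product) measure of a probability vector $(p_1,\dots,p_q)$. Put $T_\omega:=T_{\omega_0}$, $T_\omega^n:=T_{\sigma^{n-1}\omega}\circ\cdots\circ T_\omega$, $T_\omega^0=\mathrm{id}$; $\mathcal{A}_\omega:=\mathcal{A}_{T_\omega}$, $\mathcal{A}_\omega^n:=\bigvee_{k=0}^{n-1}(T_\omega^k)^{-1}(\mathcal{A}_{\sigma^k\omega})$,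 and $\mathcal{D}:=\bigcup_{n\ge0}\bigcup_{\omega\in\Omega}\partial\mathcal{A}_\omega^n$ (the set of discontinuities of all the maps $T_\omega^n$). $P_\omega$ is the transfer operator of $T_\omega$ with respect to $m$: $\int(\varphi\circ T_\omega)\psi\,dm=\int\varphi\,P_\omega\psi\,dm$ for $\varphi\in L^\infty(m),\psi\in L^1(m)$; $P_\omega^n:=P_{\sigma^{n-1}\omega}\circ\cdots\circ P_\omega$. Conditions: (LY) there exist $r\ge1$, $M>0$, $D>0$, $\rho\in(0,1)$ such that for all $\omega\in\Omega$ and $f\in\mathrm{BV}$: $\|P_\omega f\|_{\mathrm{BV}}\le M\|f\|_{\mathrm{BV}}$ and $\mathrm{Var}(P_\omega^rf)\le\rho\,\mathrm{Var}(f)+D\|f\|_{L^1(m)}$. (Dec) there exist $C>0$, $\theta\in(0,1)$ such that for all $n\ge1$, $\omega\in\Omega$ and $f\in\mathrm{BV}$ with $\int f\,dm=0$: $\|P_\omega^nf\|_{\mathrm{BV}}\le C\theta^n\|f\|_{\mathrm{BV}}$. (Min) there exists $c>0$ such that $\inf_{x\in[0,1]}(P_\omega^n\mathbf{1})(x)\ge c$ for all $n\ge1$, $\omega\in\Omega$. Under these conditions $h_\omega:=\lim_{n}P^n_{\sigma^{-n}\omega}\mathbf{1}$ exists in $\mathrm{BV}$ and $P_\omega h_\omega=h_{\sigma\omega}$. The sample measures are $d\nu^\omega=h_\omega\,dm$, and the stationary measure on $[0,1]$ is $\nu(A)=\int_\Omega\nu^\omega(A)\,d\mathbb{P}(\omega)$.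 A point $x_0\in[0,1]$ is non-recurrent if for $\mathbb{P}$-a.e. $\omega$, $T_\omega^n(x_0)\ne x_0$ for all $n\ge1$. $(b_n)$ is a sequence of positive reals with $\lim_nn\,\nu(\phi_{x_0}>b_n)=1$. Point processes. For Borel $B\subset(0,\infty)\times(\mathbb{R}\setminus\{0\})$, $N_n^\omega(B):=\#\{j\ge1:(\frac jn,\frac{\phi_{x_0}\circ T_\omega^{j-1}}{b_n})\in B\}$, a random variable on $([0,1],\nu^\omega)$. $\Pi_\alpha(dx)=\alpha x^{-\alpha-1}dx$ on $(0,\infty)$ (zero on $(-\infty,0)$), and $N_{(\alpha)}(B)$ is the number of (time, size) pairs of jumps lying in $B$ of the $\alpha$-stable Lévy process with Lévy measure $\Pi_\alpha$; that is, $N_{(\alpha)}$ is the Poisson point process on $(0,\infty)\times(\mathbb{R}\setminus\{0\})$ with intensity $m\times\Pi_\alpha$ ($m$ here Lebesgue measure on $(0,\infty)$). "$N_n^\omega$ converges in distribution to $N_{(\alpha)}$" means: $N_n^\omega(B)\to N_{(\alpha)}(B)$ in distribution for all Borel $B\subset(0,\infty)\times(\mathbb{R}\setminus\{0\})$ with $(m\times\Pi_\alpha)(B)<\infty$ and $(m\times\Pi_\alpha)(\partial B)=0$.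
   Formalization: Convergence of N_n^ω is tested only on Borel B that are also bounded in time with sizes bounded away from 0; for all B of finite intensity and null boundary it fails, since atoms sit at times j/n and B may contain {1/2}×(0,1]. *)

theory Defs
  imports "HOL-Probability.Probability"
begin

section \<open>Piecewise expanding maps and random compositions\<close>

text \<open>
  \<open>g\<close> is the continuous extension of \<open>T\<close> from \<open>I\<close> to its closure, with derivatives \<open>g'\<close>, \<open>g''\<close>
  taken within the closed interval (hence one-sided at its endpoints).  One-point intervals are
  admitted; for them the derivative conditions are vacuous, so that the values of \<open>T\<close> at finitely
  many break points may be arbitrary.
\<close>

definition piecewise_expanding :: "(real \<Rightarrow> real) \<Rightarrow> real set set \<Rightarrow> bool" where
  "piecewise_expanding T A \<longleftrightarrow>
     T \<in> {0..1} \<rightarrow> {0..1} \<and>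
     finite A \<and> partition_on {0..1} A \<and> (\<forall>I\<in>A. is_interval I) \<and>
     (\<exists>l>1. \<forall>I\<in>A. \<exists>g g' g''.
        (\<forall>x\<in>I. g x = T x) \<and>
        (strict_mono_on (closure I) g \<or> monotone_on (closure I) (<) (>) g) \<and>
        (\<forall>x\<in>closure I.
           (g has_real_derivative g' x) (at x within closure I) \<and>
           (g' has_real_derivative g'' x) (at x within closure I)) \<and>
        continuous_on (closure I) g'' \<and>
        (\<forall>x\<in>closure I. l \<le> \<bar>g' x\<bar>))"

definition shift :: "int \<Rightarrow> (int \<Rightarrow> 'q) \<Rightarrow> int \<Rightarrow> 'q" where
  "shift k \<omega> = (\<lambda>i. \<omega> (i + k))"

definition bernoulli :: "'q pmf \<Rightarrow> (int \<Rightarrow> 'q) measure" where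
  "bernoulli p = Pi\<^sub>M UNIV (\<lambda>_. measure_pmf p)"

primrec rmap :: "('q \<Rightarrow> real \<Rightarrow> real) \<Rightarrow> nat \<Rightarrow> (int \<Rightarrow> 'q) \<Rightarrow> real \<Rightarrow> real" where
  "rmap T 0 \<omega> = id"
| "rmap T (Suc n) \<omega> = T (shift (int n) \<omega> 0) \<circ> rmap T n \<omega>"

definition dyn_partition ::
    "('q \<Rightarrow> real \<Rightarrow> real) \<Rightarrow> ('q \<Rightarrow> real set set) \<Rightarrow> nat \<Rightarrow> (int \<Rightarrow> 'q) \<Rightarrow> real set set" where
  "dyn_partition T A n \<omega> =
     {{0..1} \<inter> (\<Inter>k<n. rmap T k \<omega> -` I k) | I. \<forall>k<n. I k \<in> A (shift (int k) \<omega> 0)}"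

text \<open>
  The boundary is taken in the phase space \<open>[0,1]\<close>: the endpoints \<open>0\<close> and \<open>1\<close> are not boundary
  points merely because the interval ends there.
\<close>

definition disc_set :: "('q \<Rightarrow> real \<Rightarrow> real) \<Rightarrow> ('q \<Rightarrow> real set set) \<Rightarrow> real set" where
  "disc_set T A =
     (\<Union>n. \<Union>\<omega>. \<Union>J\<in>dyn_partition T A n \<omega>. top_of_set {0..1} frontier_of J)"

definition nonrecurrent :: "'q pmf \<Rightarrow> ('q \<Rightarrow> real \<Rightarrow> real) \<Rightarrow> real \<Rightarrow> bool" where
  "nonrecurrent p T x0 \<longleftrightarrow> (AE \<omega> in bernoulli p. \<forall>n\<ge>1. rmap T n \<omega> x0 \<noteq> x0)"


section \<open>Functions of bounded variation and transfer operators\<close>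

definition unit_leb :: "real measure" where
  "unit_leb = restrict_space lborel {0..1}"

definition total_variation :: "(real \<Rightarrow> real) \<Rightarrow> ennreal" where
  "total_variation f =
     (SUP (n, x) \<in> {(n, x). mono_on {..n::nat} x \<and> x ` {..n} \<subseteq> {0..1}}.
        \<Sum>i<n. ennreal \<bar>f (x (Suc i)) - f (x i)\<bar>)"

text \<open>
  Transfer operators act on classes of functions modulo Lebesgue-null sets, so the variation of
  \<open>f\<close> is that of its class: the infimum over all functions agreeing with \<open>f\<close> almost everywhere.
\<close>

definition Var :: "(real \<Rightarrow> real) \<Rightarrow> ennreal" where
  "Var f = (INF g \<in> {g. AE x in unit_leb. g x = f x}. total_variation g)"

definition L1_norm :: "(real \<Rightarrow> real) \<Rightarrow> ennreal" where
  "L1_norm f = (\<integral>\<^sup>+x. ennreal \<bar>f x\<bar> \<partial>unit_leb)"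

definition BV_norm :: "(real \<Rightarrow> real) \<Rightarrow> ennreal" where
  "BV_norm f = Var f + L1_norm f"

definition BV :: "(real \<Rightarrow> real) set" where
  "BV = {f. integrable unit_leb f \<and> Var f < \<infinity>}"

text \<open>
  For \<open>f\<close> integrable, \<open>transfer T f\<close> is a version of the transfer operator, which duality
  determines almost everywhere.
\<close>

definition transfer :: "(real \<Rightarrow> real) \<Rightarrow> (real \<Rightarrow> real) \<Rightarrow> real \<Rightarrow> real" where
  "transfer T f =
     (SOME g. integrable unit_leb g \<and>
        (\<forall>\<phi>. \<phi> \<in> borel_measurable unit_leb \<and> (\<exists>K. AE x in unit_leb. \<bar>\<phi> x\<bar> \<le> K) \<longrightarrow>
           (\<integral>x. \<phi> (T x) * f x \<partial>unit_leb) = (\<integral>x. \<phi> x * g x \<partial>unit_leb)))"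

primrec rtransfer ::
    "('q \<Rightarrow> real \<Rightarrow> real) \<Rightarrow> nat \<Rightarrow> (int \<Rightarrow> 'q) \<Rightarrow> (real \<Rightarrow> real) \<Rightarrow> real \<Rightarrow> real" where
  "rtransfer T 0 \<omega> f = f"
| "rtransfer T (Suc n) \<omega> f = transfer (T (shift (int n) \<omega> 0)) (rtransfer T n \<omega> f)"

definition cond_LY :: "('q \<Rightarrow> real \<Rightarrow> real) \<Rightarrow> bool" where
  "cond_LY T \<longleftrightarrow>
     (\<exists>r\<ge>1. \<exists>M>0. \<exists>D>0. \<exists>\<rho>. 0 < \<rho> \<and> \<rho> < 1 \<and>
        (\<forall>\<omega>. \<forall>f\<in>BV.
           BV_norm (rtransfer T 1 \<omega> f) \<le> ennreal M * BV_norm f \<and>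
           Var (rtransfer T r \<omega> f) \<le> ennreal \<rho> * Var f + ennreal D * L1_norm f))"

definition cond_Dec :: "('q \<Rightarrow> real \<Rightarrow> real) \<Rightarrow> bool" where
  "cond_Dec T \<longleftrightarrow>
     (\<exists>C>0. \<exists>\<theta>. 0 < \<theta> \<and> \<theta> < 1 \<and>
        (\<forall>n\<ge>1. \<forall>\<omega>. \<forall>f\<in>BV. (\<integral>x. f x \<partial>unit_leb) = 0 \<longrightarrow>
           BV_norm (rtransfer T n \<omega> f) \<le> ennreal (C * \<theta> ^ n) * BV_norm f))"

text \<open>The infimum of a class of functions is the essential infimum.\<close>

definition cond_Min :: "('q \<Rightarrow> real \<Rightarrow> real) \<Rightarrow> bool" where
  "cond_Min T \<longleftrightarrow>
     (\<exists>c>0. \<forall>n\<ge>1. \<forall>\<omega>. AE x in unit_leb. c \<le> rtransfer T n \<omega> (\<lambda>_. 1) x)"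

text \<open>A version of the limit in \<open>BV\<close>, which is unique almost everywhere.\<close>

definition sample_density :: "('q \<Rightarrow> real \<Rightarrow> real) \<Rightarrow> (int \<Rightarrow> 'q) \<Rightarrow> real \<Rightarrow> real" where
  "sample_density T \<omega> =
     (SOME h. h \<in> BV \<and>
        (\<lambda>n. BV_norm (\<lambda>x. rtransfer T n (shift (- int n) \<omega>) (\<lambda>_. 1) x - h x)) \<longlonglongrightarrow> 0)"

definition sample_measure :: "('q \<Rightarrow> real \<Rightarrow> real) \<Rightarrow> (int \<Rightarrow> 'q) \<Rightarrow> real measure" where
  "sample_measure T \<omega> = density unit_leb (\<lambda>x. ennreal (sample_density T \<omega> x))"

definition stationary :: "'q pmf \<Rightarrow> ('q \<Rightarrow> real \<Rightarrow> real) \<Rightarrow> real set \<Rightarrow> real" where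
  "stationary p T E = (\<integral>\<omega>. measure (sample_measure T \<omega>) E \<partial>bernoulli p)"


section \<open>Point processes\<close>

text \<open>
  The value at \<open>x0\<close> is \<open>0\<close> instead of infinity.  This affects neither level sets up to null sets
  nor the counting below, since neither value is an admissible size in \<open>\<real> - {0}\<close>.
\<close>

definition obs :: "real \<Rightarrow> real \<Rightarrow> real \<Rightarrow> real" where
  "obs \<alpha> x0 x = \<bar>x - x0\<bar> powr (- 1 / \<alpha>)"

definition time_size_space :: "(real \<times> real) set" where
  "time_size_space = {0<..} \<times> (UNIV - {0})"

definition stable_levy :: "real \<Rightarrow> real measure" where
  "stable_levy \<alpha> = density lborel (\<lambda>x. ennreal (if 0 < x then \<alpha> * x powr (- \<alpha> - 1) else 0))"

definition intensity :: "real \<Rightarrow> (real \<times> real) measure" where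
  "intensity \<alpha> = restrict_space (lborel \<Otimes>\<^sub>M stable_levy \<alpha>) time_size_space"

definition poisson_point_process ::
    "'w measure \<Rightarrow> ('w \<Rightarrow> 'a measure) \<Rightarrow> 'a measure \<Rightarrow> bool" where
  "poisson_point_process Q N \<mu> \<longleftrightarrow>
     prob_space Q \<and>
     (\<forall>w\<in>space Q. sets (N w) = sets \<mu>) \<and>
     (\<forall>w\<in>space Q. \<forall>B\<in>sets \<mu>. emeasure (N w) B \<in> insert \<infinity> (range of_nat)) \<and>
     (\<forall>B\<in>sets \<mu>. (\<lambda>w. emeasure (N w) B) \<in> borel_measurable Q) \<and>
     (\<forall>B\<in>sets \<mu>. emeasure \<mu> B < \<infinity> \<longrightarrow>
        (\<forall>k. measure Q {w\<in>space Q. emeasure (N w) B = of_nat k} =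
             measure \<mu> B ^ k / fact k * exp (- measure \<mu> B))) \<and>
     (\<forall>n B. (\<forall>i<n. B i \<in> sets \<mu>) \<and> disjoint_family_on B {..<n} \<longrightarrow>
        prob_space.indep_vars Q (\<lambda>_. borel) (\<lambda>i w. emeasure (N w) (B i)) {..<n::nat})"

definition count_process ::
    "('q \<Rightarrow> real \<Rightarrow> real) \<Rightarrow> (real \<Rightarrow> real) \<Rightarrow> (nat \<Rightarrow> real) \<Rightarrow> nat \<Rightarrow> (int \<Rightarrow> 'q) \<Rightarrow>
     (real \<times> real) set \<Rightarrow> real \<Rightarrow> nat" where
  "count_process T \<phi> b n \<omega> B x =
     card {j::nat. 1 \<le> j \<and> (real j / real n, \<phi> (rmap T (j - 1) \<omega> x) / b n) \<in> B}"

text \<open>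
  The test sets are the Borel continuity sets of finite intensity that are bounded in the usual
  sense for point processes on this space: bounded in time, and with sizes bounded away from \<open>0\<close>.
  Finite intensity alone does not suffice, because the atoms of the counting processes sit at
  the times \<open>j / n\<close>.  Let \<open>u k > 0\<close> be small and let \<open>B\<close> be the union over \<open>k\<close> of
  \<open>{1/2 - u k <..< 1/2 + u k} \<times> {(1/2)^(k+1) <.. (1/2)^k}\<close>.  If \<open>u k * 2 powr (k * \<alpha>)\<close> is
  summable, \<open>B\<close> has finite intensity and null boundary.  But \<open>B\<close> contains \<open>{1/2} \<times> {0<..1}\<close>,
  so for even \<open>n\<close> it contains an atom with probability tending to \<open>1\<close>, which fails for the
  Poisson limit.  Similarly the union over \<open>k \<ge> 1\<close> of
  \<open>{k - u k <..< k + u k} \<times> {1<..}\<close> almost surely contains infinitely many atoms for every \<open>n\<close>.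
\<close>

definition test_sets :: "real \<Rightarrow> (real \<times> real) set set" where
  "test_sets \<alpha> =
     {B \<in> sets borel. B \<subseteq> time_size_space \<and>
        (\<exists>K \<delta>. 0 < \<delta> \<and> B \<subseteq> {..K} \<times> {y. \<delta> \<le> \<bar>y\<bar>}) \<and>
        emeasure (intensity \<alpha>) B < \<infinity> \<and>
        emeasure (intensity \<alpha>) (top_of_set time_size_space frontier_of B) = 0}"

end

theory Submission
  imports Defs
begin

text \<open>
  The counts converge by the method of factorial moments, for fixed \<open>\<omega>\<close>.  The density at time \<open>j\<close>
  weighted by the number of \<open>k\<close>-element sets of earlier hits satisfies a recursion in \<open>k\<close> through
  the transfer operators.  Memory loss and the absence of short returns (no return of the
  neighbourhoods of \<open>x0\<close> within any fixed number of steps, by non-recurrence and continuity at \<open>x0\<close>)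
  make this density close, on the target at time \<open>j\<close>, to its mass times the sample density.  So the
  factorial moments tend to \<open>\<mu> ^ k / fact k\<close> as soon as the hitting probabilities along the orbit of
  \<open>\<omega>\<close> sum up to \<open>\<mu>\<close>, and Bonferroni's inequalities give the Poisson law.

  The hitting probabilities are summed by a strong law of large numbers: sample densities are
  uniform limits of functions of finitely many coordinates, hence have one-sided limits at \<open>x0\<close>
  uniformly in \<open>\<omega>\<close>, and the mass of a shrinking ball is its radius times a continuous function on the
  shift space.  This treats finite unions of grid cells, and dominated convergence shows that the
  cells meeting the boundary of a test set become negligible.
\<close>

section \<open>Functions of bounded variation\<close>

text \<open>One null set has to serve all test sets, of which there are uncountably many. It is
  fixed by two properties of \<open>\<omega>\<close>: non-recurrence along all its shifts, and the
  law of large numbers for the single function \<open>local_density x0\<close>. Off this null set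
  every test set is handled by a deterministic argument.

  The targets shrink with \<open>n\<close>, and so do the masses to be compared, whereas memory loss
  is available only in the BV norm. What saves the recursion is that a target is, up to the point
  \<open>x0\<close>, a signed sum of boundedly many balls: multiplication by its indicator costs a
  factor in BV that depends neither on the scale nor on the time. Since BV bounds dominate the
  supremum, the error of memory loss on a target is again proportional to the size of the target,
  which is \<open>O(1/n)\<close> and can be summed over \<open>O(n)\<close> times.

  Raising sizes to the power \<open>- \<alpha>\<close> turns the intensity into area and superlevel
  sets into balls whose radius is linear in that coordinate. Equal squares thus have equal mass, and
  the mean local density hidden in \<open>b n\<close> cancels against the average along the
  orbit.\<close>

lemma space_unit_leb [simp]: "space unit_leb = {0..1}"
  by (simp add: unit_leb_def space_restrict_space)

lemma sets_unit_leb: "sets unit_leb = sets (restrict_space borel {0..1})"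
  by (simp add: unit_leb_def sets_restrict_space)

lemma emeasure_unit_leb: "E \<in> sets unit_leb \<Longrightarrow> emeasure unit_leb E = emeasure lborel E"
  unfolding unit_leb_def
  by (subst emeasure_restrict_space) (auto simp: sets_restrict_space)

lemma prob_space_unit_leb: "prob_space unit_leb"
  by (rule prob_spaceI) (simp add: unit_leb_def emeasure_restrict_space)

interpretation unit: prob_space unit_leb
  by (rule prob_space_unit_leb)

lemma borel_measurable_unit_leb: "f \<in> borel_measurable borel \<Longrightarrow> f \<in> borel_measurable unit_leb"
  unfolding unit_leb_def by (intro measurable_restrict_space1) simp

lemma sets_unit_leb_I: "E \<in> sets borel \<Longrightarrow> E \<inter> {0..1} \<in> sets unit_leb"
  by (auto simp: sets_unit_leb sets_restrict_space)

text \<open>Applied at the point \<open>x0\<close>: there the value of the observable is a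
  convention, and the descriptions of targets by balls hold only off this point.\<close>

lemma AE_unit_leb_neq: "AE x in unit_leb. x \<noteq> z"
  unfolding unit_leb_def
  by (subst AE_restrict_space_iff) (auto intro!: eventually_mono[OF AE_lborel_singleton[of z]])

lemma integrable_indicator_mult:
  assumes "E \<in> sets borel" "integrable unit_leb f"
  shows "integrable unit_leb (\<lambda>x. indicator E x * f x :: real)"
proof (rule Bochner_Integration.integrable_bound[OF assms(2)])
  have "indicator E \<in> borel_measurable unit_leb"
    using assms(1) by (intro borel_measurable_unit_leb) auto
  then show "(\<lambda>x. indicator E x * f x) \<in> borel_measurable unit_leb"
    using assms(2) by (intro borel_measurable_times) auto
qed (auto simp: abs_mult intro!: mult_left_le_one_le)

text \<open>\<open>total_variation g \<le> ennreal V\<close> in real arithmetic. It concerns the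
  function \<open>g\<close> itself and not its class, so values on null sets count.\<close>

definition variation_le :: "(real \<Rightarrow> real) \<Rightarrow> real \<Rightarrow> bool" where
  "variation_le g V \<longleftrightarrow>
     (\<forall>n x. mono_on {..n::nat} x \<and> x ` {..n} \<subseteq> {0..1} \<longrightarrow> (\<Sum>i<n. \<bar>g (x (Suc i)) - g (x i)\<bar>) \<le> V)"

lemma variation_leD:
  "\<lbrakk>variation_le g V; mono_on {..n::nat} x; \<And>i. i \<le> n \<Longrightarrow> x i \<in> {0..1}\<rbrakk>
     \<Longrightarrow> (\<Sum>i<n. \<bar>g (x (Suc i)) - g (x i)\<bar>) \<le> V"
  unfolding variation_le_def by (auto simp: image_subset_iff)

lemma variation_le_nonneg:
  assumes "variation_le g V" shows "0 \<le> V"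
  using variation_leD[OF assms, of 0 "\<lambda>_. 0"] by (simp add: mono_on_def)

lemma total_variation_le_iff:
  assumes "0 \<le> V" shows "total_variation g \<le> ennreal V \<longleftrightarrow> variation_le g V"
proof -
  have "total_variation g \<le> ennreal V \<longleftrightarrow>
      (\<forall>n x. mono_on {..n::nat} x \<and> x ` {..n} \<subseteq> {0..1} \<longrightarrow>
        (\<Sum>i<n. ennreal \<bar>g (x (Suc i)) - g (x i)\<bar>) \<le> ennreal V)"
    unfolding total_variation_def SUP_le_iff by auto
  also have "\<dots> \<longleftrightarrow> variation_le g V"
    unfolding variation_le_def using assms by (simp add: sum_ennreal sum_nonneg)
  finally show ?thesis .
qed

lemma variation_le_dist:
  assumes "variation_le g V" "x \<in> {0..1}" "y \<in> {0..1}"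
  shows "\<bar>g x - g y\<bar> \<le> V"
proof -
  have *: "\<bar>g v - g u\<bar> \<le> V" if "u \<in> {0..1}" "v \<in> {0..1}" "u \<le> v" for u v
    using variation_leD[OF assms(1), of 1 "\<lambda>i. if i = 0 then u else v"] that
    by (auto simp: mono_on_def)
  show ?thesis
    using *[of x y] *[of y x] assms by (cases "x \<le> y") auto
qed

lemma variation_le_add:
  assumes "variation_le f V" "variation_le g W"
  shows "variation_le (\<lambda>x. f x + g x) (V + W)"
  unfolding variation_le_def
proof (intro allI impI)
  fix n :: nat and x assume x: "mono_on {..n} x \<and> x ` {..n} \<subseteq> {0..1::real}"
  have "(\<Sum>i<n. \<bar>f (x (Suc i)) + g (x (Suc i)) - (f (x i) + g (x i))\<bar>)
      \<le> (\<Sum>i<n. \<bar>f (x (Suc i)) - f (x i)\<bar> + \<bar>g (x (Suc i)) - g (x i)\<bar>)"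
    by (intro sum_mono) linarith
  also have "\<dots> \<le> V + W"
    using assms x unfolding variation_le_def by (simp add: sum.distrib add_mono)
  finally show "(\<Sum>i<n. \<bar>f (x (Suc i)) + g (x (Suc i)) - (f (x i) + g (x i))\<bar>) \<le> V + W" .
qed

lemma variation_le_cmult:
  assumes "variation_le f V" shows "variation_le (\<lambda>x. c * f x) (\<bar>c\<bar> * V)"
  unfolding variation_le_def
proof (intro allI impI)
  fix n :: nat and x assume x: "mono_on {..n} x \<and> x ` {..n} \<subseteq> {0..1::real}"
  have "(\<Sum>i<n. \<bar>c * f (x (Suc i)) - c * f (x i)\<bar>) = \<bar>c\<bar> * (\<Sum>i<n. \<bar>f (x (Suc i)) - f (x i)\<bar>)"
    by (simp add: sum_distrib_left abs_mult flip: right_diff_distrib)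
  also have "\<dots> \<le> \<bar>c\<bar> * V"
    using assms x unfolding variation_le_def by (intro mult_left_mono) auto
  finally show "(\<Sum>i<n. \<bar>c * f (x (Suc i)) - c * f (x i)\<bar>) \<le> \<bar>c\<bar> * V" .
qed

text \<open>A fixed chain involves only finitely many points, so pointwise convergence of the series
  is enough to pass the bound from the partial sums to the limit.\<close>

lemma variation_le_suminf:
  assumes e: "\<And>k. variation_le (e k) (V k)" and V: "summable V"
    and sm: "\<And>x. x \<in> {0..1} \<Longrightarrow> summable (\<lambda>k. e k x)"
  shows "variation_le (\<lambda>x. \<Sum>k. e k x) (\<Sum>k. V k)"
  unfolding variation_le_def
proof (intro allI impI)
  fix n :: nat and x assume x: "mono_on {..n} x \<and> x ` {..n} \<subseteq> {0..1::real}"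
  have tail: "(\<lambda>K. \<Sum>i<n. \<bar>(\<Sum>k<K. e k (x (Suc i))) - (\<Sum>k<K. e k (x i))\<bar>)
      \<longlonglongrightarrow> (\<Sum>i<n. \<bar>(\<Sum>k. e k (x (Suc i))) - (\<Sum>k. e k (x i))\<bar>)"
    using x by (intro tendsto_intros summable_LIMSEQ sm) (auto simp: image_subset_iff)
  moreover have "(\<Sum>i<n. \<bar>(\<Sum>k<K. e k (x (Suc i))) - (\<Sum>k<K. e k (x i))\<bar>) \<le> (\<Sum>k. V k)" for K
  proof -
    have "(\<Sum>i<n. \<bar>(\<Sum>k<K. e k (x (Suc i))) - (\<Sum>k<K. e k (x i))\<bar>)
        \<le> (\<Sum>i<n. \<Sum>k<K. \<bar>e k (x (Suc i)) - e k (x i)\<bar>)"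
      by (intro sum_mono) (simp flip: sum_subtractf)
    also have "\<dots> = (\<Sum>k<K. \<Sum>i<n. \<bar>e k (x (Suc i)) - e k (x i)\<bar>)"
      by (rule sum.swap)
    also have "\<dots> \<le> (\<Sum>k<K. V k)"
      using e x unfolding variation_le_def by (intro sum_mono) auto
    also have "\<dots> \<le> (\<Sum>k. V k)"
      by (intro sum_le_suminf V) (auto intro: variation_le_nonneg e)
    finally show ?thesis .
  qed
  ultimately show "(\<Sum>i<n. \<bar>(\<Sum>k. e k (x (Suc i))) - (\<Sum>k. e k (x i))\<bar>) \<le> (\<Sum>k. V k)"
    by (intro LIMSEQ_le_const2[OF tail]) auto
qed

text \<open>Along a monotone chain the indicator of a down-closed set drops at most once. The extra
  jump, of height at most \<open>B\<close>, is paid by \<open>B\<close> times the decrease of the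
  indicator, which telescopes.\<close>

lemma variation_le_restrict_down:
  assumes g: "variation_le g V" and B: "\<And>x. x \<in> {0..1} \<Longrightarrow> \<bar>g x\<bar> \<le> B"
    and S: "\<And>x y. x \<in> S \<Longrightarrow> y \<le> x \<Longrightarrow> y \<in> S"
  shows "variation_le (\<lambda>x. indicator S x * g x) (V + B)"
  unfolding variation_le_def
proof (intro allI impI)
  fix n :: nat and x assume x: "mono_on {..n} x \<and> x ` {..n} \<subseteq> {0..1::real}"
  have B0: "0 \<le> B" using B[of 0] by simp
  have step: "\<bar>indicator S (x (Suc i)) * g (x (Suc i)) - indicator S (x i) * g (x i)\<bar>
     \<le> \<bar>g (x (Suc i)) - g (x i)\<bar> + B * (indicator S (x i) - indicator S (x (Suc i)))" if "i < n" for i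
  proof -
    have "x i \<le> x (Suc i)" "x i \<in> {0..1}"
      using x that by (auto simp: mono_on_def image_subset_iff)
    then show ?thesis
      using S[of "x (Suc i)" "x i"] B[of "x i"] B0 by (auto simp: indicator_def)
  qed
  have "(\<Sum>i<n. \<bar>indicator S (x (Suc i)) * g (x (Suc i)) - indicator S (x i) * g (x i)\<bar>)
     \<le> (\<Sum>i<n. \<bar>g (x (Suc i)) - g (x i)\<bar> + B * (indicator S (x i) - indicator S (x (Suc i))))"
    by (intro sum_mono step) auto
  also have "\<dots> = (\<Sum>i<n. \<bar>g (x (Suc i)) - g (x i)\<bar>) + B * (\<Sum>i<n. indicator S (x i) - indicator S (x (Suc i)))"
    by (simp add: sum.distrib sum_distrib_left)
  also have "(\<Sum>i<n. indicator S (x i) - indicator S (x (Suc i))) = (indicator S (x 0) - indicator S (x n) :: real)"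
    by (rule sum_lessThan_telescope')
  also have "(\<Sum>i<n. \<bar>g (x (Suc i)) - g (x i)\<bar>) + B * (indicator S (x 0) - indicator S (x n)) \<le> V + B"
    using g x B0 unfolding variation_le_def by (intro add_mono) (auto simp: indicator_def)
  finally show "(\<Sum>i<n. \<bar>indicator S (x (Suc i)) * g (x (Suc i)) - indicator S (x i) * g (x i)\<bar>) \<le> V + B" .
qed

lemma Var_le:
  assumes "variation_le g V" "AE x in unit_leb. g x = f x" shows "Var f \<le> ennreal V"
  unfolding Var_def
  by (rule INF_lower2[of g])
     (use assms in \<open>auto simp: total_variation_le_iff[OF variation_le_nonneg[OF assms(1)]]\<close>)

lemma Var_less_imp:
  assumes "Var f < ennreal V"
  obtains g where "variation_le g V" "AE x in unit_leb. g x = f x"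
proof -
  obtain g where g: "AE x in unit_leb. g x = f x" "total_variation g < ennreal V"
    using assms unfolding Var_def INF_less_iff by auto
  from g(2) have "0 \<le> V" by (metis ennreal_neg linorder_not_le not_less_zero order_less_le)
  with g show ?thesis
    using that[of g] total_variation_le_iff[of V g] by auto
qed

lemma L1_norm_eq: "integrable unit_leb f \<Longrightarrow> L1_norm f = ennreal (\<integral>x. \<bar>f x\<bar> \<partial>unit_leb)"
  unfolding L1_norm_def by (intro nn_integral_eq_integral) auto

text \<open>A bound for the class of \<open>f\<close>. Integrability is carried along because
  \<open>BV_norm\<close> makes sense for arbitrary functions, and \<open>0 \<le> c\<close> because
  \<open>ennreal\<close> sends negative numbers to 0.\<close>

definition BV_le :: "(real \<Rightarrow> real) \<Rightarrow> real \<Rightarrow> bool" where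
  "BV_le f c \<longleftrightarrow> integrable unit_leb f \<and> 0 \<le> c \<and> BV_norm f \<le> ennreal c"

text \<open>The infimum over representatives in \<open>Var\<close> need not be attained. This rule
  and \<open>BV_leE\<close> replace it by a representative that is optimal up to a slack
  \<open>e\<close>, so that norm estimates can be made for one concrete function.\<close>

lemma BV_leI:
  assumes int: "integrable unit_leb f"
    and ex: "\<And>e. 0 < e \<Longrightarrow> \<exists>V g. variation_le g V \<and> (AE x in unit_leb. g x = f x) \<and>
               V + (\<integral>x. \<bar>f x\<bar> \<partial>unit_leb) \<le> c + e"
  shows "BV_le f c"
proof -
  define L where "L = (\<integral>x. \<bar>f x\<bar> \<partial>unit_leb)"
  have L0: "0 \<le> L" unfolding L_def by simp
  have c0: "0 \<le> c + e" if "0 < e" for e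
    using ex[OF that] L0 variation_le_nonneg unfolding L_def[symmetric] by force
  then have "0 \<le> c" by (metis add.commute add_0 field_le_epsilon)
  moreover have "BV_norm f \<le> ennreal c"
  proof (rule ennreal_le_epsilon)
    fix e :: real assume "0 < e"
    obtain V g where g: "variation_le g V" "AE x in unit_leb. g x = f x" "V + L \<le> c + e"
      using ex[OF \<open>0 < e\<close>] unfolding L_def by blast
    have "BV_norm f \<le> ennreal V + ennreal L"
      unfolding BV_norm_def L1_norm_eq[OF int] L_def[symmetric]
      using Var_le[OF g(1,2)] by (intro add_mono) auto
    also have "\<dots> = ennreal (V + L)"
      using L0 variation_le_nonneg[OF g(1)] by simp
    also have "\<dots> \<le> ennreal (c + e)" using g by (intro ennreal_leI) auto
    also have "\<dots> = ennreal c + ennreal e" using \<open>0 \<le> c\<close> \<open>0 < e\<close> by simp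
    finally show "BV_norm f \<le> ennreal c + ennreal e" .
  qed
  ultimately show ?thesis using int unfolding BV_le_def by auto
qed

lemma BV_leE:
  assumes "BV_le f c" "0 < e"
  obtains V g where "variation_le g V" "AE x in unit_leb. g x = f x"
    "V + (\<integral>x. \<bar>f x\<bar> \<partial>unit_leb) < c + e"
proof -
  define L where "L = (\<integral>x. \<bar>f x\<bar> \<partial>unit_leb)"
  have L0: "0 \<le> L" unfolding L_def by simp
  have "Var f + ennreal L \<le> ennreal c"
    using assms unfolding BV_le_def BV_norm_def L_def by (auto simp: L1_norm_eq)
  then obtain v where v: "Var f = ennreal v" "0 \<le> v"
    by (cases "Var f") (auto simp: top_unique)
  have "v + L \<le> c"
    using \<open>Var f + ennreal L \<le> ennreal c\<close> v L0 assms(1) unfolding BV_le_def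
    by (simp flip: ennreal_plus)
  have "Var f < ennreal (v + e / 2)"
    using v assms(2) by (simp add: ennreal_less_iff)
  then obtain g where "variation_le g (v + e / 2)" "AE x in unit_leb. g x = f x"
    by (rule Var_less_imp)
  moreover have "v + e / 2 + L < c + e" using \<open>v + L \<le> c\<close> \<open>0 < e\<close> by simp
  ultimately show ?thesis using that unfolding L_def by blast
qed

lemma BV_le_integrable: "BV_le f c \<Longrightarrow> integrable unit_leb f"
  by (simp add: BV_le_def)

lemma BV_le_nonneg: "BV_le f c \<Longrightarrow> 0 \<le> c"
  by (simp add: BV_le_def)

lemma BV_le_mono: "BV_le f c \<Longrightarrow> c \<le> d \<Longrightarrow> BV_le f d"
  unfolding BV_le_def using ennreal_leI order_trans by fastforce

lemma BV_iff: "f \<in> BV \<longleftrightarrow> (\<exists>c. BV_le f c)"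
proof
  assume f: "f \<in> BV"
  then have "BV_norm f < \<infinity>"
    unfolding BV_norm_def BV_def by (auto simp: L1_norm_eq)
  then obtain c where "0 \<le> c" "BV_norm f = ennreal c"
    by (cases "BV_norm f") auto
  then show "\<exists>c. BV_le f c" using f unfolding BV_le_def BV_def by auto
next
  assume "\<exists>c. BV_le f c"
  then obtain c where c: "integrable unit_leb f" "BV_norm f \<le> ennreal c"
    unfolding BV_le_def by auto
  then have "Var f \<le> ennreal c" unfolding BV_norm_def
    by (metis add.commute dual_order.trans le_iff_add)
  then show "f \<in> BV" using c unfolding BV_def
    by (auto intro: le_less_trans)
qed

lemma BV_le_imp_BV: "BV_le f c \<Longrightarrow> f \<in> BV"
  by (auto simp: BV_iff)

lemma BV_le_cong:
  assumes "BV_le f c" "integrable unit_leb g" "AE x in unit_leb. f x = g x"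
  shows "BV_le g c"
proof (rule BV_leI[OF assms(2)])
  fix e :: real assume "0 < e"
  have eq: "(\<integral>x. \<bar>f x\<bar> \<partial>unit_leb) = (\<integral>x. \<bar>g x\<bar> \<partial>unit_leb)"
    using assms BV_le_integrable[OF assms(1)] by (intro integral_cong_AE) auto
  obtain V k where "variation_le k V" "AE x in unit_leb. k x = f x"
    "V + (\<integral>x. \<bar>f x\<bar> \<partial>unit_leb) < c + e"
    using BV_leE[OF assms(1) \<open>0 < e\<close>] .
  then show "\<exists>V k. variation_le k V \<and> (AE x in unit_leb. k x = g x) \<and>
      V + (\<integral>x. \<bar>g x\<bar> \<partial>unit_leb) \<le> c + e"
    using assms(3) eq by (intro exI[of _ V] exI[of _ k]) auto
qed

lemma BV_le_add:
  assumes f: "BV_le f c" and g: "BV_le g d"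
  shows "BV_le (\<lambda>x. f x + g x) (c + d)"
proof (rule BV_leI)
  show "integrable unit_leb (\<lambda>x. f x + g x)"
    using f g BV_le_integrable by auto
  fix e :: real assume "0 < e"
  then have "0 < e / 2" by simp
  obtain V u where u: "variation_le u V" "AE x in unit_leb. u x = f x"
    "V + (\<integral>x. \<bar>f x\<bar> \<partial>unit_leb) < c + e / 2"
    using BV_leE[OF f \<open>0 < e / 2\<close>] .
  obtain W v where v: "variation_le v W" "AE x in unit_leb. v x = g x"
    "W + (\<integral>x. \<bar>g x\<bar> \<partial>unit_leb) < d + e / 2"
    using BV_leE[OF g \<open>0 < e / 2\<close>] .
  have "(\<integral>x. \<bar>f x + g x\<bar> \<partial>unit_leb) \<le> (\<integral>x. \<bar>f x\<bar> + \<bar>g x\<bar> \<partial>unit_leb)"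
    using f g by (intro integral_mono) (auto intro!: integrable_abs Bochner_Integration.integrable_add dest: BV_le_integrable)
  also have "\<dots> = (\<integral>x. \<bar>f x\<bar> \<partial>unit_leb) + (\<integral>x. \<bar>g x\<bar> \<partial>unit_leb)"
    using f g by (intro Bochner_Integration.integral_add) (auto dest: BV_le_integrable)
  finally show "\<exists>V k. variation_le k V \<and> (AE x in unit_leb. k x = f x + g x) \<and>
      V + (\<integral>x. \<bar>f x + g x\<bar> \<partial>unit_leb) \<le> c + d + e"
    using u v variation_le_add[OF u(1) v(1)]
    by (intro exI[of _ "V + W"] exI[of _ "\<lambda>x. u x + v x"]) auto
qed

lemma BV_le_cmult:
  assumes f: "BV_le f c" shows "BV_le (\<lambda>x. a * f x) (\<bar>a\<bar> * c)"
proof (rule BV_leI)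
  show "integrable unit_leb (\<lambda>x. a * f x)"
    using f BV_le_integrable by auto
  fix e :: real assume "0 < e"
  \<comment> \<open>The \<open>+ 1\<close> covers the case \<open>a = 0\<close>.\<close>
  define e' where "e' = e / (\<bar>a\<bar> + 1)"
  have e': "0 < e'" "\<bar>a\<bar> * e' \<le> e"
    using \<open>0 < e\<close> unfolding e'_def by (auto simp: field_simps)
  obtain V u where u: "variation_le u V" "AE x in unit_leb. u x = f x"
    "V + (\<integral>x. \<bar>f x\<bar> \<partial>unit_leb) < c + e'"
    using BV_leE[OF f e'(1)] .
  have "\<bar>a\<bar> * V + (\<integral>x. \<bar>a * f x\<bar> \<partial>unit_leb) = \<bar>a\<bar> * (V + (\<integral>x. \<bar>f x\<bar> \<partial>unit_leb))"
    by (simp add: abs_mult algebra_simps)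
  also have "\<dots> \<le> \<bar>a\<bar> * (c + e')" using u by (intro mult_left_mono) auto
  also have "\<dots> \<le> \<bar>a\<bar> * c + e" using e' by (simp add: algebra_simps)
  finally show "\<exists>V k. variation_le k V \<and> (AE x in unit_leb. k x = a * f x) \<and>
      V + (\<integral>x. \<bar>a * f x\<bar> \<partial>unit_leb) \<le> \<bar>a\<bar> * c + e"
    using u variation_le_cmult[OF u(1), of a]
    by (intro exI[of _ "\<bar>a\<bar> * V"] exI[of _ "\<lambda>x. a * u x"]) auto
qed

lemma BV_le_diff:
  assumes f: "BV_le f c" and g: "BV_le g d"
  shows "BV_le (\<lambda>x. f x - g x) (c + d)"
  using BV_le_add[OF f BV_le_cmult[OF g, of "- 1"]] by simp

lemma BV_le_const: "BV_le (\<lambda>_. a) \<bar>a\<bar>"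
proof (rule BV_leI)
  fix e :: real assume "0 < e"
  then show "\<exists>V g. variation_le g V \<and> (AE x in unit_leb. g x = a) \<and>
               V + (\<integral>x. \<bar>a\<bar> \<partial>unit_leb) \<le> \<bar>a\<bar> + e"
    using unit.prob_space
    by (intro exI[of _ 0] exI[of _ "\<lambda>_. a"]) (auto simp: variation_le_def)
qed auto

lemma BV_le_sum:
  assumes "finite I" "\<And>i. i \<in> I \<Longrightarrow> BV_le (f i) (c i)"
  shows "BV_le (\<lambda>x. \<Sum>i\<in>I. f i x) (\<Sum>i\<in>I. c i)"
  using assms
proof (induction I)
  case empty
  then show ?case using BV_le_const[of 0] by simp
next
  case (insert a F)
  then show ?case using BV_le_add[of "f a" "c a"] by simp
qed

text \<open>\<open>\<bar>g x\<bar> - V \<le> \<bar>g y\<bar>\<close> for every \<open>y\<close>;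
  integrating over \<open>y\<close> in a probability space gives the bound. It makes BV dominate the
  supremum with constant 1.\<close>

lemma variation_le_abs_le:
  assumes g: "variation_le g V" and eq: "AE x in unit_leb. g x = f x"
    and f: "integrable unit_leb f" and x: "x \<in> {0..1}"
  shows "\<bar>g x\<bar> \<le> V + (\<integral>y. \<bar>f y\<bar> \<partial>unit_leb)"
proof -
  have "\<bar>g x\<bar> - V = (\<integral>y. \<bar>g x\<bar> - V \<partial>unit_leb)"
    using unit.prob_space by simp
  also have "\<dots> \<le> (\<integral>y. \<bar>f y\<bar> \<partial>unit_leb)"
  proof (rule integral_mono_AE)
    show "AE y in unit_leb. \<bar>g x\<bar> - V \<le> \<bar>f y\<bar>"
      using eq AE_space
    proof eventually_elim
      case (elim y)
      then show ?case using variation_le_dist[OF g x, of y] by auto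
    qed
  qed (use f in auto)
  finally show ?thesis by simp
qed

lemma BV_le_AE_abs_le:
  assumes f: "BV_le f c" shows "AE x in unit_leb. \<bar>f x\<bar> \<le> c"
proof -
  \<comment> \<open>The representative, and with it the exceptional null set, depends on the slack;
    countably many slacks suffice.\<close>
  have "AE x in unit_leb. \<bar>f x\<bar> \<le> c + 1 / real (Suc n)" for n
  proof -
    have "(0::real) < 1 / real (Suc n)" by simp
    obtain V u where u: "variation_le u V" "AE x in unit_leb. u x = f x"
      "V + (\<integral>x. \<bar>f x\<bar> \<partial>unit_leb) < c + 1 / real (Suc n)"
      using BV_leE[OF f \<open>0 < 1 / real (Suc n)\<close>] .
    show ?thesis using u(2) AE_space
    proof eventually_elim
      case (elim x)
      then show ?case
        using variation_le_abs_le[OF u(1,2) BV_le_integrable[OF f], of x] u(3) by auto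
    qed
  qed
  then have "AE x in unit_leb. \<forall>n. \<bar>f x\<bar> \<le> c + 1 / real (Suc n)"
    by (simp add: AE_all_countable)
  then show ?thesis
  proof eventually_elim
    case (elim x)
    have "(\<lambda>n. c + 1 / real (Suc n)) \<longlonglongrightarrow> c + 0"
      by (intro tendsto_intros LIMSEQ_Suc lim_1_over_n)
    then show ?case using elim by (intro LIMSEQ_le_const[of _ c]) auto
  qed
qed

lemma BV_le_integral_abs_le:
  assumes "BV_le f c" shows "(\<integral>x. \<bar>f x\<bar> \<partial>unit_leb) \<le> c"
proof -
  have "(\<integral>x. \<bar>f x\<bar> \<partial>unit_leb) \<le> (\<integral>x. c \<partial>unit_leb)"
    using assms BV_le_AE_abs_le by (intro integral_mono_AE) (auto dest: BV_le_integrable)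
  then show ?thesis using unit.prob_space by simp
qed

text \<open>The factor 2 comes from the jump at the cut: it is bounded by the supremum, hence by
  \<open>V + L\<close>, which is added to the variation \<open>V\<close>, while the
  \<open>L1\<close> part stays below \<open>L\<close>.\<close>

lemma BV_le_down:
  assumes f: "BV_le f c" and S: "\<And>x y. x \<in> S \<Longrightarrow> y \<le> x \<Longrightarrow> y \<in> S" and S': "S \<in> sets borel"
  shows "BV_le (\<lambda>x. indicator S x * f x) (2 * c)"
proof (rule BV_leI)
  have f': "integrable unit_leb f" using f by (rule BV_le_integrable)
  show int: "integrable unit_leb (\<lambda>x. indicator S x * f x)"
    by (rule integrable_indicator_mult[OF S' f'])
  fix e :: real assume "0 < e"
  then have "0 < e / 2" by simp
  define L where "L = (\<integral>x. \<bar>f x\<bar> \<partial>unit_leb)"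
  obtain V u where u: "variation_le u V" "AE x in unit_leb. u x = f x"
    "V + L < c + e / 2"
    using BV_leE[OF f \<open>0 < e / 2\<close>] unfolding L_def .
  have B: "\<bar>u x\<bar> \<le> V + L" if "x \<in> {0..1}" for x
    using variation_le_abs_le[OF u(1,2) f' that] unfolding L_def .
  have "(\<integral>x. \<bar>indicator S x * f x\<bar> \<partial>unit_leb) \<le> L"
    unfolding L_def using int f' by (intro integral_mono) (auto simp: indicator_def)
  then show "\<exists>V g. variation_le g V \<and> (AE x in unit_leb. g x = indicator S x * f x) \<and>
               V + (\<integral>x. \<bar>indicator S x * f x\<bar> \<partial>unit_leb) \<le> 2 * c + e"
    using u variation_le_restrict_down[OF u(1) B S]
    by (intro exI[of _ "V + (V + L)"] exI[of _ "\<lambda>x. indicator S x * u x"]) auto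
qed

text \<open>A ball is a half-line with a smaller half-line removed, and each cut doubles the bound:
  \<open>2 * c + 2 * (2 * c)\<close>. The point is that the constant does not depend on the
  radius.\<close>

lemma BV_le_ball:
  assumes f: "BV_le f c" shows "BV_le (\<lambda>x. indicator {y. \<bar>y - z\<bar> < r} x * f x) (6 * c)"
proof -
  have 1: "BV_le (\<lambda>x. indicator {..<z + r} x * f x) (2 * c)"
    by (rule BV_le_down[OF f]) auto
  have 2: "BV_le (\<lambda>x. indicator {..z - r} x * (indicator {..<z + r} x * f x)) (2 * (2 * c))"
    by (rule BV_le_down[OF 1]) auto
  have "BV_le (\<lambda>x. indicator {..<z + r} x * f x - indicator {..z - r} x * (indicator {..<z + r} x * f x)) (2 * c + 2 * (2 * c))"
    by (rule BV_le_diff[OF 1 2])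
  moreover have "(\<lambda>x. indicator {..<z + r} x * f x - indicator {..z - r} x * (indicator {..<z + r} x * f x))
      = (\<lambda>x. indicator {y. \<bar>y - z\<bar> < r} x * f x)"
    by (auto simp: indicator_def fun_eq_iff)
  ultimately show ?thesis by simp
qed

text \<open>Completeness of BV with an explicit constant. The representatives of the terms are
  chosen with slacks of sum \<open>e\<close>. As their suprema are dominated by summable BV bounds,
  their series converges at every point of the unit interval and not only almost everywhere;
  \<open>variation_le_suminf\<close> requires this.\<close>

lemma BV_le_series:
  assumes d: "\<And>n. BV_le (d n) (c n)" and c: "summable c"
  shows "BV_le (\<lambda>x. \<Sum>n. d n x) (\<Sum>n. c n)"
    "AE x in unit_leb. summable (\<lambda>n. \<bar>d n x\<bar>)"
proof -
  have AE: "AE x in unit_leb. \<forall>n. \<bar>d n x\<bar> \<le> c n"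
    unfolding AE_all_countable using BV_le_AE_abs_le[OF d] by auto
  then show sm: "AE x in unit_leb. summable (\<lambda>n. \<bar>d n x\<bar>)"
  proof eventually_elim
    case (elim x)
    then show ?case by (intro summable_comparison_test'[OF c, of 0]) auto
  qed
  have di: "integrable unit_leb (d n)" for n using BV_le_integrable[OF d] .
  then have dm [measurable]: "d n \<in> borel_measurable unit_leb" for n by auto
  have c0: "0 \<le> c n" for n using BV_le_nonneg[OF d] .
  define s where "s = (\<lambda>n. \<integral>x. \<bar>d n x\<bar> \<partial>unit_leb)"
  have s: "s n \<le> c n" "0 \<le> s n" for n unfolding s_def using BV_le_integral_abs_le[OF d] by auto
  have ssum: "summable s"
    by (rule summable_comparison_test'[OF c, of 0]) (use s in auto)
  have int: "integrable unit_leb (\<lambda>x. \<Sum>n. d n x)"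
    using ssum sm di unfolding s_def by (intro integrable_suminf) auto
  have int2: "integrable unit_leb (\<lambda>x. \<Sum>n. \<bar>d n x\<bar>)"
    using ssum sm di unfolding s_def by (intro integrable_suminf) auto
  have "(\<integral>x. \<bar>\<Sum>n. d n x\<bar> \<partial>unit_leb) \<le> (\<integral>x. (\<Sum>n. \<bar>d n x\<bar>) \<partial>unit_leb)"
    by (rule integral_mono_AE) (use int int2 sm in \<open>auto elim!: eventually_mono intro: summable_rabs\<close>)
  also have "\<dots> = (\<Sum>n. s n)"
    unfolding s_def using ssum sm di unfolding s_def by (intro integral_suminf) auto
  finally have L: "(\<integral>x. \<bar>\<Sum>n. d n x\<bar> \<partial>unit_leb) \<le> (\<Sum>n. s n)" .
  show "BV_le (\<lambda>x. \<Sum>n. d n x) (\<Sum>n. c n)"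
  proof (rule BV_leI[OF int])
    fix e :: real assume "0 < e"
    define \<epsilon> where "\<epsilon> = (\<lambda>n. e * (1/2) ^ Suc n)"
    have \<epsilon>: "0 < \<epsilon> n" for n using \<open>0 < e\<close> by (simp add: \<epsilon>_def)
    have \<epsilon>s: "\<epsilon> sums e"
      unfolding \<epsilon>_def using sums_mult[OF power_half_series, of e] by simp
    have "\<forall>n. \<exists>V g. variation_le g V \<and> (AE x in unit_leb. g x = d n x) \<and> V + s n < c n + \<epsilon> n"
      using BV_leE[OF d \<epsilon>] unfolding s_def by metis
    then obtain V g where g: "\<And>n. variation_le (g n) (V n)" "\<And>n. AE x in unit_leb. g n x = d n x"
       "\<And>n. V n + s n < c n + \<epsilon> n"
      by metis
    have V0: "0 \<le> V n" for n using variation_le_nonneg[OF g(1)] .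
    have ce: "summable (\<lambda>n. c n + \<epsilon> n)" using c \<epsilon>s by (intro summable_add) (auto simp: sums_iff)
    have VV: "V n \<le> c n + \<epsilon> n" for n using g(3)[of n] s(2)[of n] by linarith
    have Vs: "summable V"
      by (rule summable_comparison_test'[OF ce, of 0]) (use VV V0 in auto)
    have "\<bar>g n x\<bar> \<le> c n + \<epsilon> n" if "x \<in> {0..1}" for n x
      using variation_le_abs_le[OF g(1,2) di that, of n] g(3)[of n] unfolding s_def by linarith
    then have gs: "summable (\<lambda>n. g n x)" if "x \<in> {0..1}" for x
      by (intro summable_comparison_test'[OF ce, of 0]) (use that in auto)
    have "variation_le (\<lambda>x. \<Sum>n. g n x) (\<Sum>n. V n)"
      by (rule variation_le_suminf[OF g(1) Vs gs])
    moreover have "AE x in unit_leb. (\<Sum>n. g n x) = (\<Sum>n. d n x)"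
    proof -
      have "AE x in unit_leb. \<forall>n. g n x = d n x" unfolding AE_all_countable using g(2) by auto
      then show ?thesis by eventually_elim auto
    qed
    moreover have "(\<Sum>n. V n) + (\<integral>x. \<bar>\<Sum>n. d n x\<bar> \<partial>unit_leb) \<le> (\<Sum>n. c n) + e"
    proof -
      have "(\<Sum>n. V n) + (\<Sum>n. s n) = (\<Sum>n. V n + s n)"
        by (rule suminf_add[OF Vs ssum])
      also have "\<dots> \<le> (\<Sum>n. c n + \<epsilon> n)"
        using g(3) by (intro suminf_le summable_add Vs ssum ce) (auto simp: less_imp_le)
      also have "\<dots> = (\<Sum>n. c n) + e"
        using c \<epsilon>s by (simp add: suminf_add[symmetric] sums_iff)
      finally show ?thesis using L by simp
    qed
    ultimately show "\<exists>V g. variation_le g V \<and> (AE x in unit_leb. g x = (\<Sum>n. d n x)) \<and>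
       V + (\<integral>x. \<bar>\<Sum>n. d n x\<bar> \<partial>unit_leb) \<le> (\<Sum>n. c n) + e" by blast
  qed
qed

section \<open>One-sided oscillation and averages over small balls\<close>

lemma variation_le_reflect:
  assumes g: "variation_le g V" shows "variation_le (\<lambda>x. g (1 - x)) V"
  unfolding variation_le_def
proof (intro allI impI)
  fix n :: nat and x assume x: "mono_on {..n} x \<and> x ` {..n} \<subseteq> {0..1::real}"
  \<comment> \<open>Reflection reverses the order, so the chain is also traversed backwards.\<close>
  define y where "y = (\<lambda>i. 1 - x (n - i))"
  have y: "mono_on {..n} y" "y i \<in> {0..1}" if "i \<le> n" for i
    using x unfolding y_def by (auto simp: mono_on_def image_subset_iff)
  have "(\<Sum>i<n. \<bar>g (1 - x (Suc i)) - g (1 - x i)\<bar>) = (\<Sum>i<n. \<bar>g (y (Suc (n - Suc i))) - g (y (n - Suc i))\<bar>)"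
    by (rule sum.cong) (auto simp: y_def Suc_diff_Suc)
  also have "\<dots> = (\<Sum>i<n. \<bar>g (y (Suc i)) - g (y i)\<bar>)"
    by (rule sum.nat_diff_reindex[of "\<lambda>i. \<bar>g (y (Suc i)) - g (y i)\<bar>"])
  also have "\<dots> \<le> V" using variation_leD[OF g y] by auto
  finally show "(\<Sum>i<n. \<bar>g (1 - x (Suc i)) - g (1 - x i)\<bar>) \<le> V" .
qed

text \<open>Cauchy criterion for the limit from the right. Take a chain in \<open>{z<..1}\<close>
  whose sum is within \<open>e\<close> of the supremum over all such chains. Two points
  \<open>u \<le> v\<close> placed between \<open>z\<close> and the start of this chain lengthen it,
  and hence can add at most \<open>e\<close> to the sum.\<close>

lemma variation_le_osc_right:
  assumes g: "variation_le g V" and e: "0 < e" and z: "0 \<le> z" "z < 1"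
  shows "\<exists>d>0. z + d \<le> 1 \<and> (\<forall>u\<in>{z<..<z+d}. \<forall>v\<in>{z<..<z+d}. \<bar>g u - g v\<bar> \<le> e)"
proof -
  define S where "S = {(\<Sum>i<n. \<bar>g (x (Suc i)) - g (x i)\<bar>) | n x. mono_on {..n::nat} x \<and> x ` {..n} \<subseteq> {z<..1}}"
  have bdd: "bdd_above S"
    unfolding S_def using z
    by (intro bdd_aboveI[of _ V]) (force intro!: variation_leD[OF g] simp: image_subset_iff intro: less_imp_le[OF le_less_trans[OF z(1)]])
  have ne: "S \<noteq> {}"
  proof -
    have "(\<Sum>i<0. \<bar>g 1 - g 1\<bar>) \<in> S"
      unfolding S_def using z by (intro CollectI exI[of _ 0] exI[of _ "\<lambda>_. 1"]) (auto simp: mono_on_def)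
    then show ?thesis by auto
  qed
  have "Sup S - e < Sup S" using e by simp
  then obtain s where "s \<in> S" "Sup S - e < s"
    using less_cSup_iff[OF ne bdd] by blast
  then obtain n x where x: "mono_on {..n::nat} x" "\<And>i. i \<le> n \<Longrightarrow> z < x i \<and> x i \<le> 1"
    and s: "Sup S - e < (\<Sum>i<n. \<bar>g (x (Suc i)) - g (x i)\<bar>)"
    unfolding S_def by (auto simp: image_subset_iff)
  have main: "\<bar>g v - g u\<bar> \<le> e" if uv: "z < u" "u \<le> v" "v < x 0" for u v
  proof -
    define y where "y = (\<lambda>i. if i = 0 then u else if i = 1 then v else x (i - 2))"
    have x0: "x 0 \<le> x i" if "i \<le> n" for i using x(1) that by (auto simp: mono_on_def)
    have "mono_on {..n+2} y"
    proof (rule mono_onI)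
      fix i j assume ij: "i \<in> {..n+2}" "j \<in> {..n+2}" "i \<le> j"
      show "y i \<le> y j"
      proof (cases "2 \<le> i")
        case True
        then have "x (i - 2) \<le> x (j - 2)"
          using ij by (intro mono_onD[OF x(1)]) auto
        then show ?thesis using True ij by (auto simp: y_def)
      next
        case False
        then have "i = 0 \<or> i = 1" by auto
        moreover have "j \<noteq> 0 \<Longrightarrow> j \<noteq> 1 \<Longrightarrow> x 0 \<le> x (j - 2)"
          using ij by (intro x0) auto
        ultimately show ?thesis using ij uv by (cases "j = 0"; cases "j = 1"; force simp: y_def)
      qed
    qed
    moreover have "y ` {..n+2} \<subseteq> {z<..1}"
      using uv x(2) x(2)[of 0] by (fastforce simp: y_def)
    ultimately have "(\<Sum>i<n+2. \<bar>g (y (Suc i)) - g (y i)\<bar>) \<in> S"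
      unfolding S_def by blast
    then have "(\<Sum>i<n+2. \<bar>g (y (Suc i)) - g (y i)\<bar>) \<le> Sup S"
      by (rule cSup_upper[OF _ bdd])
    also have "(\<Sum>i<n+2. \<bar>g (y (Suc i)) - g (y i)\<bar>) = \<bar>g v - g u\<bar> + (\<bar>g (x 0) - g v\<bar> + (\<Sum>i<n. \<bar>g (x (Suc i)) - g (x i)\<bar>))"
      by (simp add: sum.lessThan_Suc_shift y_def del: sum.lessThan_Suc)
    finally show ?thesis using s by linarith
  qed
  show ?thesis
  proof (intro exI[of _ "x 0 - z"] conjI ballI)
    fix u v assume "u \<in> {z<..<z + (x 0 - z)}" "v \<in> {z<..<z + (x 0 - z)}"
    then show "\<bar>g u - g v\<bar> \<le> e"
      using main[of u v] main[of v u] by (cases "u \<le> v") auto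
  qed (use x(2)[of 0] in auto)
qed

lemma variation_le_osc_left:
  assumes g: "variation_le g V" and e: "0 < e" and z: "0 < z" "z \<le> 1"
  shows "\<exists>d>0. 0 \<le> z - d \<and> (\<forall>u\<in>{z-d<..<z}. \<forall>v\<in>{z-d<..<z}. \<bar>g u - g v\<bar> \<le> e)"
proof -
  obtain d where d: "d > 0" "1 - z + d \<le> 1"
    "\<And>u v. u \<in> {1-z<..<1-z+d} \<Longrightarrow> v \<in> {1-z<..<1-z+d} \<Longrightarrow> \<bar>g (1 - u) - g (1 - v)\<bar> \<le> e"
    using variation_le_osc_right[OF variation_le_reflect[OF g] e, of "1 - z"] z by auto
  show ?thesis
  proof (intro exI[of _ d] conjI ballI)
    fix u v assume "u \<in> {z-d<..<z}" "v \<in> {z-d<..<z}"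
    then show "\<bar>g u - g v\<bar> \<le> e" using d(3)[of "1 - u" "1 - v"] by auto
  qed (use d in auto)
qed

lemma integral_near_const:
  assumes f: "integrable unit_leb f" and ab: "0 \<le> a" "a \<le> b" "b \<le> 1"
    and le: "AE x in unit_leb. x \<in> {a<..<b} \<longrightarrow> \<bar>f x - L\<bar> \<le> e"
  shows "\<bar>(\<integral>x. indicator {a<..<b} x * f x \<partial>unit_leb) - L * (b - a)\<bar> \<le> e * (b - a)"
proof -
  have sb: "{a<..<b} \<in> sets unit_leb"
    using sets_unit_leb_I[of "{a<..<b}"] ab
    by (simp add: Int_absorb2 greaterThanLessThan_subseteq_atLeastAtMost_iff)
  have meas: "measure unit_leb {a<..<b} = b - a"
    using ab by (simp add: measure_def emeasure_unit_leb[OF sb])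
  have int: "integrable unit_leb (\<lambda>x. indicator {a<..<b} x * f x)"
    using integrable_mult_indicator[OF sb f] by simp
  have intL: "integrable unit_leb (\<lambda>x. indicator {a<..<b} x * L)" for L :: real
    using integrable_mult_indicator[OF sb, of "\<lambda>_. L"] by simp
  have c: "(\<integral>x. indicator {a<..<b} x * L \<partial>unit_leb) = L * (b - a)" for L :: real
  proof -
    have "{a<..<b} \<inter> {0..1} = {a<..<b}" using ab by auto
    with meas have "unit.prob ({a<..<b} \<inter> {0..1}) = b - a" by metis
    then show ?thesis by simp
  qed
  have "(\<integral>x. indicator {a<..<b} x * f x \<partial>unit_leb) - L * (b - a)
      = (\<integral>x. indicator {a<..<b} x * f x - indicator {a<..<b} x * L \<partial>unit_leb)"
    unfolding Bochner_Integration.integral_diff[OF int intL] c ..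
  also have "\<bar>\<dots>\<bar> \<le> (\<integral>x. \<bar>indicator {a<..<b} x * f x - indicator {a<..<b} x * L\<bar> \<partial>unit_leb)"
    by (rule integral_abs_bound)
  also have "\<dots> \<le> (\<integral>x. indicator {a<..<b} x * e \<partial>unit_leb)"
    using le int intL
    by (intro integral_mono_AE integrable_abs Bochner_Integration.integrable_diff)
       (auto elim!: eventually_mono simp: indicator_def)
  finally show ?thesis unfolding c .
qed

text \<open>\<open>L\<close> is the value of a representative shortly after \<open>z\<close> plus
  its value shortly before \<open>z\<close>, which stand in for the one-sided limits; a side outside
  the unit interval contributes 0. So far \<open>L\<close> depends on \<open>e\<close>; the
  canonical value is \<open>local_density\<close>.\<close>

lemma BV_ball_average:
  assumes f: "BV_le f c" and z: "z \<in> {0..1}" and e: "0 < e"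
  shows "\<exists>L. \<exists>d>0. \<forall>r. 0 < r \<and> r < d \<longrightarrow>
     \<bar>(\<integral>x. indicator {y. \<bar>y - z\<bar> < r} x * f x \<partial>unit_leb) - L * r\<bar> \<le> e * r"
proof -
  have fi: "integrable unit_leb f" by (rule BV_le_integrable[OF f])
  have "(0::real) < 1" by simp
  obtain V g where g: "variation_le g V" "AE x in unit_leb. g x = f x"
    using BV_leE[OF f \<open>0 < 1\<close>] .
  have e2: "0 < e / 2" using e by simp
  obtain L d where R: "0 < d" "\<And>r. \<lbrakk>0 < r; r < d\<rbrakk> \<Longrightarrow>
     \<bar>(\<integral>x. indicator {z<..<z+r} x * f x \<partial>unit_leb) - L * r\<bar> \<le> e / 2 * r"
  proof (cases "z < 1")
    case True
    obtain d where d: "0 < d" "z + d \<le> 1"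
      "\<And>u v. \<lbrakk>u \<in> {z<..<z+d}; v \<in> {z<..<z+d}\<rbrakk> \<Longrightarrow> \<bar>g u - g v\<bar> \<le> e / 2"
      using variation_le_osc_right[OF g(1) e2, of z] z True by auto
    have "\<bar>(\<integral>x. indicator {z<..<z+r} x * f x \<partial>unit_leb) - g (z + d / 2) * (z + r - z)\<bar> \<le> e / 2 * (z + r - z)"
      if r: "0 < r" "r < d" for r
    proof (rule integral_near_const[OF fi])
      show "AE x in unit_leb. x \<in> {z<..<z+r} \<longrightarrow> \<bar>f x - g (z + d / 2)\<bar> \<le> e / 2"
        using g(2) by eventually_elim (use d r in \<open>auto intro!: d(3) simp: eq_commute[of "g _"]\<close>)
    qed (use z d r in auto)
    then show ?thesis using that[of d "g (z + d / 2)"] d(1) by simp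
  next
    case False
    have "(\<integral>x. indicator {z<..<z+r} x * f x \<partial>unit_leb) = 0" for r
      using False by (intro integral_eq_zero_AE AE_I2) (auto simp: indicator_def)
    then show ?thesis using that[of 1 0] e by auto
  qed
  obtain L' d' where L: "0 < d'" "\<And>r. \<lbrakk>0 < r; r < d'\<rbrakk> \<Longrightarrow>
     \<bar>(\<integral>x. indicator {z-r<..<z} x * f x \<partial>unit_leb) - L' * r\<bar> \<le> e / 2 * r"
  proof (cases "0 < z")
    case True
    obtain d where d: "0 < d" "0 \<le> z - d"
      "\<And>u v. \<lbrakk>u \<in> {z-d<..<z}; v \<in> {z-d<..<z}\<rbrakk> \<Longrightarrow> \<bar>g u - g v\<bar> \<le> e / 2"
      using variation_le_osc_left[OF g(1) e2, of z] z True by auto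
    have "\<bar>(\<integral>x. indicator {z-r<..<z} x * f x \<partial>unit_leb) - g (z - d / 2) * (z - (z - r))\<bar> \<le> e / 2 * (z - (z - r))"
      if r: "0 < r" "r < d" for r
    proof (rule integral_near_const[OF fi])
      show "AE x in unit_leb. x \<in> {z-r<..<z} \<longrightarrow> \<bar>f x - g (z - d / 2)\<bar> \<le> e / 2"
        using g(2) by eventually_elim (use d r in \<open>auto intro!: d(3) simp: eq_commute[of "g _"]\<close>)
    qed (use z d r in auto)
    then show ?thesis using that[of d "g (z - d / 2)"] d(1) by simp
  next
    case False
    have "(\<integral>x. indicator {z-r<..<z} x * f x \<partial>unit_leb) = 0" for r
      using False by (intro integral_eq_zero_AE AE_I2) (auto simp: indicator_def)
    then show ?thesis using that[of 1 0] e by auto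
  qed
  have ind: "integrable unit_leb (\<lambda>x. indicator {a<..<b} x * f x)" for a b :: real
    by (rule integrable_indicator_mult[OF _ fi]) simp
  have split: "(\<integral>x. indicator {y. \<bar>y - z\<bar> < r} x * f x \<partial>unit_leb) =
     (\<integral>x. indicator {z<..<z+r} x * f x \<partial>unit_leb) + (\<integral>x. indicator {z-r<..<z} x * f x \<partial>unit_leb)" if "0 < r" for r
  proof -
    have mb: "integrable unit_leb (\<lambda>x. indicator {y. \<bar>y - z\<bar> < r} x * f x)"
      by (rule integrable_indicator_mult[OF _ fi]) simp
    have "(\<integral>x. indicator {y. \<bar>y - z\<bar> < r} x * f x \<partial>unit_leb) =
      (\<integral>x. indicator {z<..<z+r} x * f x + indicator {z-r<..<z} x * f x \<partial>unit_leb)"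
    proof (rule integral_cong_AE)
      show "AE x in unit_leb. indicator {y. \<bar>y - z\<bar> < r} x * f x =
          indicator {z<..<z+r} x * f x + indicator {z-r<..<z} x * f x"
        using AE_unit_leb_neq[of z] by eventually_elim (auto simp: indicator_def)
    qed (use mb ind in \<open>auto intro!: borel_measurable_add dest: borel_measurable_integrable\<close>)
    then show ?thesis using ind by simp
  qed
  show ?thesis
  proof (rule exI[of _ "L + L'"], rule exI[of _ "min d d'"], intro conjI allI impI)
    fix r assume "0 < r \<and> r < min d d'"
    then show "\<bar>(\<integral>x. indicator {y. \<bar>y - z\<bar> < r} x * f x \<partial>unit_leb) - (L + L') * r\<bar> \<le> e * r"
      using R(2)[of r] L(2)[of r] split[of r] unfolding abs_le_iff distrib_right
      by (auto simp: field_simps)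
  qed (use R L in auto)
qed

section \<open>Transfer operators\<close>

lemma unit_leb_AE_iff:
  "E \<in> sets unit_leb \<Longrightarrow> (AE x in unit_leb. x \<notin> E) \<longleftrightarrow> emeasure lborel E = 0"
  using AE_iff_null_sets[of E unit_leb] by (simp add: null_sets_def emeasure_unit_leb)

text \<open>The mean value theorem is applied to the extension of the branch to the closed interval,
  whose slope is at least \<open>l > 1\<close> in absolute value. The second statement makes the
  inverse branch Lipschitz with constant 1.\<close>

lemma piecewise_expanding_restrict:
  assumes "piecewise_expanding T A" "I \<in> A"
  shows "continuous_on I T" "\<And>x y. x \<in> I \<Longrightarrow> y \<in> I \<Longrightarrow> \<bar>x - y\<bar> \<le> \<bar>T x - T y\<bar>"
proof -
  obtain l g g' where l: "1 < l" and g: "\<And>x. x \<in> I \<Longrightarrow> g x = T x"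
    and d: "\<And>x. x \<in> closure I \<Longrightarrow> (g has_real_derivative g' x) (at x within closure I)"
    and b: "\<And>x. x \<in> closure I \<Longrightarrow> l \<le> \<bar>g' x\<bar>"
  proof -
    obtain l where l: "1 < l" and *: "\<forall>I\<in>A. \<exists>g g' g''.
        (\<forall>x\<in>I. g x = T x) \<and> (strict_mono_on (closure I) g \<or> monotone_on (closure I) (<) (>) g) \<and>
        (\<forall>x\<in>closure I. (g has_real_derivative g' x) (at x within closure I) \<and>
           (g' has_real_derivative g'' x) (at x within closure I)) \<and>
        continuous_on (closure I) g'' \<and> (\<forall>x\<in>closure I. l \<le> \<bar>g' x\<bar>)"
      using assms(1) unfolding piecewise_expanding_def by blast
    obtain g g' g'' where "\<forall>x\<in>I. g x = T x"
        "\<forall>x\<in>closure I. (g has_real_derivative g' x) (at x within closure I) \<and>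
           (g' has_real_derivative g'' x) (at x within closure I)" "\<forall>x\<in>closure I. l \<le> \<bar>g' x\<bar>"
      using bspec[OF * assms(2)] by blast
    then show ?thesis using l by (intro that[of l g g']) auto
  qed
  have "continuous_on (closure I) g"
    using d by (auto simp: continuous_on_eq_continuous_within intro: DERIV_continuous)
  then have "continuous_on I g"
    using closure_subset continuous_on_subset by blast
  then show "continuous_on I T"
    using g by (subst continuous_on_cong[of I I T g]) auto
  have int: "is_interval I" using assms unfolding piecewise_expanding_def by blast
  have *: "\<bar>x - y\<bar> \<le> \<bar>T x - T y\<bar>" if "x \<in> I" "y \<in> I" "x < y" for x y
  proof -
    have sub: "{x..y} \<subseteq> I"
      using mem_is_interval_1_I[OF int that(1,2)] by auto
    then have sub': "{x..y} \<subseteq> closure I" using closure_subset by blast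
    have "\<exists>z\<in>{x<..<y}. g y - g x = (*) (g' z) (y - x)"
    proof (rule mvt_simple[OF \<open>x < y\<close>])
      fix z assume "x \<le> z" "z \<le> y"
      then have "z \<in> closure I" using sub' by auto
      from DERIV_subset[OF d[OF this] sub']
      show "(g has_derivative (*) (g' z)) (at z within {x..y})"
        unfolding has_field_derivative_def .
    qed
    then obtain z where z: "z \<in> {x<..<y}" "g y - g x = g' z * (y - x)" by auto
    have "z \<in> closure I" using z sub' by auto
    then have "1 * \<bar>y - x\<bar> \<le> \<bar>g' z\<bar> * \<bar>y - x\<bar>"
      using b[of z] l by (intro mult_right_mono) auto
    also have "\<dots> = \<bar>T y - T x\<bar>"
      unfolding abs_mult[symmetric] z(2)[symmetric] using g that by simp
    finally show ?thesis by (simp add: abs_minus_commute)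
  qed
  show "\<bar>x - y\<bar> \<le> \<bar>T x - T y\<bar>" if "x \<in> I" "y \<in> I" for x y
    using *[of x y] *[of y x] that by (cases x y rule: linorder_cases) (auto simp: abs_minus_commute)
qed

lemma piecewise_expanding_measurable:
  assumes T: "piecewise_expanding T A" shows "T \<in> unit_leb \<rightarrow>\<^sub>M unit_leb"
proof -
  have A: "finite A" "\<Union>A = {0..1}" "\<And>I. I \<in> A \<Longrightarrow> is_interval I" "T \<in> {0..1} \<rightarrow> {0..1}"
    using T unfolding piecewise_expanding_def partition_on_def by auto
  have "T \<in> borel_measurable unit_leb"
  proof (rule measurable_piecewise_restrict[of A])
    fix I assume I: "I \<in> A"
    then have sub: "I \<subseteq> {0..1}" using A by auto
    have bor: "I \<in> sets borel" using A I real_interval_borel_measurable by auto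
    then show "I \<inter> space unit_leb \<in> sets unit_leb" using sets_unit_leb_I[OF bor] by simp
    have "T \<in> borel_measurable (restrict_space borel I)"
      using piecewise_expanding_restrict(1)[OF T I] by (rule borel_measurable_continuous_on_restrict)
    moreover have "sets (restrict_space unit_leb I) = sets (restrict_space borel I)"
      using sub unfolding unit_leb_def sets_restrict_restrict_space
      by (simp add: Int_absorb1 sets_restrict_space)
    ultimately show "T \<in> borel_measurable (restrict_space unit_leb I)"
      by (simp cong: measurable_cong_sets)
  qed (use A in \<open>auto simp: countable_finite\<close>)
  then show ?thesis
    using A unfolding unit_leb_def
    by (intro measurable_restrict_space2) (auto simp: space_restrict_space)
qed

text \<open>On each branch the preimage of a null set is contained in its image under the inverse
  branch. The latter is Lipschitz, hence maps null sets to null sets, and there are finitely many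
  branches. This nonsingularity underlies the existence of transfer operators.\<close>

lemma piecewise_expanding_null:
  assumes T: "piecewise_expanding T A" and P: "AE x in unit_leb. P x"
  shows "AE x in unit_leb. P (T x)"
proof -
  have A: "finite A" "\<Union>A = {0..1}" "T \<in> {0..1} \<rightarrow> {0..1}"
    using T unfolding piecewise_expanding_def partition_on_def by auto
  obtain E where E: "{x \<in> space unit_leb. \<not> P x} \<subseteq> E" "emeasure unit_leb E = 0" "E \<in> sets unit_leb"
    using P by (rule AE_E)
  have "E \<in> sets borel" using E(3) by (auto simp: sets_unit_leb sets_restrict_space)
  then have "negligible E"
    using E emeasure_unit_leb[OF E(3)] by (simp add: negligible_iff_null_sets null_sets_def)
  have "negligible (I \<inter> T -` E)" if I: "I \<in> A" for I
  proof -
    let ?R = "inv_into I T"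
    have inj: "inj_on T I"
      using piecewise_expanding_restrict(2)[OF T I] by (intro inj_onI) force
    have "negligible (?R ` (E \<inter> T ` I))"
    proof (rule negligible_locally_Lipschitz_image)
      show "negligible (E \<inter> T ` I)" using \<open>negligible E\<close> by (rule negligible_subset) auto
      fix x assume "x \<in> E \<inter> T ` I"
      then have "norm (?R y - ?R x) \<le> 1 * norm (y - x)" if "y \<in> E \<inter> T ` I" for y
        using that inj piecewise_expanding_restrict(2)[OF T I, of "?R y" "?R x"]
        by (auto simp: inv_into_into f_inv_into_f)
      then show "\<exists>U B. open U \<and> x \<in> U \<and> (\<forall>y\<in>(E \<inter> T ` I) \<inter> U. norm (?R y - ?R x) \<le> B * norm (y - x))"
        by (intro exI[of _ UNIV] exI[of _ 1]) auto
    qed auto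
    moreover have "I \<inter> T -` E \<subseteq> ?R ` (E \<inter> T ` I)"
      using inj by (force simp: image_iff)
    ultimately show ?thesis by (rule negligible_subset)
  qed
  then have "negligible (\<Union>I\<in>A. I \<inter> T -` E)" using A by (intro negligible_Union) auto
  then have neg: "negligible ({0..1} \<inter> T -` E)" using A by (simp flip: Int_UN_distrib2)
  have m: "{0..1} \<inter> T -` E \<in> sets unit_leb"
    using measurable_sets[OF piecewise_expanding_measurable[OF T] E(3)] by (simp add: Int_commute)
  then have "{0..1} \<inter> T -` E \<in> sets lborel"
    by (auto simp: sets_unit_leb sets_restrict_space)
  then have "emeasure lborel ({0..1} \<inter> T -` E) = 0"
    using neg by (auto simp: negligible_iff_null_sets null_sets_def)
  then have "AE x in unit_leb. x \<notin> {0..1} \<inter> T -` E" using unit_leb_AE_iff[OF m] by simp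
  then show ?thesis
    using AE_space
  proof eventually_elim
    case (elim x)
    then have "T x \<notin> E" "T x \<in> {0..1}" using A(3) by auto
    then show ?case using E(1) by auto
  qed
qed

section \<open>Bounded test functions and existence of transfer operators\<close>

definition ess_bounded :: "(real \<Rightarrow> real) \<Rightarrow> bool" where
  "ess_bounded \<phi> \<longleftrightarrow> \<phi> \<in> borel_measurable unit_leb \<and> (\<exists>K. AE x in unit_leb. \<bar>\<phi> x\<bar> \<le> K)"

lemma ess_boundedI:
  "\<phi> \<in> borel_measurable unit_leb \<Longrightarrow> (\<And>x. x \<in> {0..1} \<Longrightarrow> \<bar>\<phi> x\<bar> \<le> K) \<Longrightarrow> ess_bounded \<phi>"
  unfolding ess_bounded_def by (auto intro!: exI[of _ K])

lemma ess_bounded_const: "ess_bounded (\<lambda>_. c)"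
  by (rule ess_boundedI[of _ "\<bar>c\<bar>"]) auto

lemma ess_bounded_integrable:
  assumes "ess_bounded \<phi>" "integrable unit_leb f"
  shows "integrable unit_leb (\<lambda>x. \<phi> x * f x)"
proof -
  obtain K where K: "AE x in unit_leb. \<bar>\<phi> x\<bar> \<le> K" using assms unfolding ess_bounded_def by auto
  show ?thesis
  proof (rule Bochner_Integration.integrable_bound)
    show "integrable unit_leb (\<lambda>x. K * f x)" using assms by auto
    show "AE x in unit_leb. norm (\<phi> x * f x) \<le> norm (K * f x)"
      using K by eventually_elim (auto simp: abs_mult intro!: mult_right_mono)
  qed (use assms in \<open>auto simp: ess_bounded_def\<close>)
qed

lemma ess_bounded_mult:
  assumes "ess_bounded \<phi>" "ess_bounded \<psi>" shows "ess_bounded (\<lambda>x. \<phi> x * \<psi> x)"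
proof -
  obtain K L where K: "AE x in unit_leb. \<bar>\<phi> x\<bar> \<le> K" and L: "AE x in unit_leb. \<bar>\<psi> x\<bar> \<le> L"
    using assms unfolding ess_bounded_def by auto
  have "AE x in unit_leb. \<bar>\<phi> x * \<psi> x\<bar> \<le> K * L"
    using K L by eventually_elim (auto simp: abs_mult intro!: mult_mono)
  then show ?thesis using assms unfolding ess_bounded_def by auto
qed

lemma ess_bounded_indicator: "E \<in> sets borel \<Longrightarrow> ess_bounded (indicator E)"
  by (intro ess_boundedI[of _ 1] borel_measurable_unit_leb) auto

lemma ess_bounded_comp:
  assumes "ess_bounded \<phi>" "T \<in> unit_leb \<rightarrow>\<^sub>M unit_leb"
    and "\<And>P. (AE x in unit_leb. P x) \<Longrightarrow> (AE x in unit_leb. P (T x))"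
  shows "ess_bounded (\<lambda>x. \<phi> (T x))"
  using assms measurable_compose[OF assms(2)] unfolding ess_bounded_def by blast

text \<open>The sign of the difference is itself an admissible test function.\<close>

lemma integrable_eqI_AE:
  assumes f: "integrable unit_leb f" and g: "integrable unit_leb g"
    and eq: "\<And>\<phi>. ess_bounded \<phi> \<Longrightarrow> (\<integral>x. \<phi> x * f x \<partial>unit_leb) = (\<integral>x. \<phi> x * g x \<partial>unit_leb)"
  shows "AE x in unit_leb. f x = g x"
proof -
  define \<phi> where "\<phi> = (\<lambda>x. sgn (f x - g x))"
  have \<phi>: "ess_bounded \<phi>"
    using f g unfolding \<phi>_def by (intro ess_boundedI[of _ 1]) (auto simp: abs_sgn_eq)
  have "(\<integral>x. \<bar>f x - g x\<bar> \<partial>unit_leb) = (\<integral>x. \<phi> x * f x - \<phi> x * g x \<partial>unit_leb)"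
    unfolding \<phi>_def right_diff_distrib[symmetric]
    by (rule Bochner_Integration.integral_cong) (auto simp: abs_sgn)
  also have "\<dots> = 0"
    using eq[OF \<phi>] ess_bounded_integrable[OF \<phi> f] ess_bounded_integrable[OF \<phi> g] by simp
  finally have "AE x in unit_leb. \<bar>f x - g x\<bar> = 0"
    using f g by (subst integral_nonneg_eq_0_iff_AE[symmetric]) auto
  then show ?thesis by eventually_elim auto
qed

text \<open>\<open>g\<close> is the Radon-Nikodym density of the image under \<open>T\<close> of the
  measure with density \<open>f\<close>; absolute continuity is nonsingularity of \<open>T\<close>.
  The density is first extended-real valued, and finiteness of its total mass makes it finite almost
  everywhere.\<close>

lemma transfer_exists_nonneg:
  fixes f :: "real \<Rightarrow> real"
  assumes T: "piecewise_expanding T A" and f: "integrable unit_leb f" "\<And>x. 0 \<le> f x"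
  shows "\<exists>g. integrable unit_leb g \<and>
     (\<forall>\<phi>\<in>borel_measurable unit_leb. (\<integral>x. \<phi> (T x) * f x \<partial>unit_leb) = (\<integral>x. \<phi> x * g x \<partial>unit_leb))"
proof -
  note [measurable] = piecewise_expanding_measurable[OF T]
  have [measurable]: "f \<in> borel_measurable unit_leb" using f by auto
  define M where "M = density unit_leb (\<lambda>x. ennreal (f x))"
  define N where "N = distr M unit_leb T"
  have [measurable]: "T \<in> M \<rightarrow>\<^sub>M unit_leb"
    unfolding M_def by simp
  have fin: "emeasure M (space M) < \<infinity>"
  proof -
    have "emeasure M (space M) = (\<integral>\<^sup>+x. ennreal (f x) \<partial>unit_leb)"
      unfolding M_def by (subst emeasure_density) (auto intro!: nn_integral_cong simp: indicator_def simp del: space_unit_leb)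
    then show ?thesis using f by (simp add: nn_integral_eq_integral)
  qed
  have "finite_measure N"
    unfolding N_def using fin
    by (intro finite_measure.finite_measure_distr finite_measureI) auto
  moreover have "sets N = sets unit_leb" unfolding N_def by simp
  moreover have "absolutely_continuous unit_leb N"
  proof (unfold absolutely_continuous_def, rule subsetI)
    fix E assume E: "E \<in> null_sets unit_leb"
    then have "AE x in unit_leb. x \<notin> E" by (rule AE_not_in)
    then have "AE x in unit_leb. T x \<notin> E" by (rule piecewise_expanding_null[OF T])
    then have "AE x in M. T x \<notin> E" unfolding M_def by (auto simp: AE_density elim!: eventually_mono)
    moreover have "{x \<in> space unit_leb. x \<notin> E} \<in> sets unit_leb"
    proof -
      have "{x \<in> space unit_leb. x \<notin> E} = space unit_leb - E" by auto
      then show ?thesis using E by (metis null_setsD2 sets.compl_sets)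
    qed
    ultimately have "AE x in N. x \<notin> E"
      unfolding N_def by (subst AE_distr_iff) auto
    then show "E \<in> null_sets N"
      using E AE_iff_null_sets[of E N] by (auto simp: N_def)
  qed
  ultimately obtain k where k: "k \<in> borel_measurable unit_leb" "density unit_leb k = N"
    using unit.Radon_Nikodym_finite_measure[of N] by auto
  have "(\<integral>\<^sup>+x. k x \<partial>unit_leb) = emeasure N (space unit_leb)"
    unfolding k(2)[symmetric] using k(1)
    by (subst emeasure_density) (auto intro!: nn_integral_cong simp: indicator_def simp del: space_unit_leb)
  also have "\<dots> < \<infinity>"
    using finite_measure.emeasure_finite[OF \<open>finite_measure N\<close>] by (simp add: less_top)
  finally have kfin: "(\<integral>\<^sup>+x. k x \<partial>unit_leb) < \<infinity>" .
  then have "AE x in unit_leb. k x \<noteq> \<infinity>"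
    using k by (intro nn_integral_PInf_AE) auto
  then have AE: "AE x in unit_leb. k x = ennreal (enn2real (k x))"
    by eventually_elim (auto simp: less_top)
  define g where "g = (\<lambda>x. enn2real (k x))"
  have gm [measurable]: "g \<in> borel_measurable unit_leb" unfolding g_def using k by simp
  have N: "N = density unit_leb (\<lambda>x. ennreal (g x))"
    unfolding k(2)[symmetric] g_def using k AE by (intro density_cong) auto
  have gi: "integrable unit_leb g"
  proof (rule integrableI_nonneg)
    show "(\<integral>\<^sup>+x. ennreal (g x) \<partial>unit_leb) < \<infinity>"
      using kfin AE unfolding g_def by (simp cong: nn_integral_cong_AE)
  qed (use k in \<open>auto simp: g_def\<close>)
  have "(\<integral>x. \<phi> (T x) * f x \<partial>unit_leb) = (\<integral>x. \<phi> x * g x \<partial>unit_leb)"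
    if \<phi> [measurable]: "\<phi> \<in> borel_measurable unit_leb" for \<phi> :: "real \<Rightarrow> real"
  proof -
    have "(\<integral>x. \<phi> (T x) * f x \<partial>unit_leb) = (\<integral>x. \<phi> (T x) \<partial>M)"
      unfolding M_def using f by (subst integral_density) (auto simp: mult.commute)
    also have "\<dots> = (\<integral>x. \<phi> x \<partial>N)"
      unfolding N_def by (subst integral_distr) auto
    also have "\<dots> = (\<integral>x. \<phi> x * g x \<partial>unit_leb)"
      unfolding N using gm by (subst integral_density) (auto simp: mult.commute, simp add: g_def)
    finally show ?thesis .
  qed
  then show ?thesis using gi by blast
qed

text \<open>\<open>transfer\<close> is defined by choice. A candidate for signed \<open>f\<close> is
  the difference of the densities for the positive and the negative part; boundedness of the test
  functions keeps both integrals finite.\<close>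

lemma transfer:
  assumes T: "piecewise_expanding T A" and f: "integrable unit_leb f"
  shows "integrable unit_leb (transfer T f)"
    and "\<And>\<phi>. ess_bounded \<phi> \<Longrightarrow>
       (\<integral>x. \<phi> (T x) * f x \<partial>unit_leb) = (\<integral>x. \<phi> x * transfer T f x \<partial>unit_leb)"
proof -
  have p: "integrable unit_leb (\<lambda>x. max 0 (f x))" "integrable unit_leb (\<lambda>x. max 0 (- f x))"
    using f by auto
  obtain g where g: "integrable unit_leb g"
     "\<And>\<phi>. \<phi>\<in>borel_measurable unit_leb \<Longrightarrow> (\<integral>x. \<phi> (T x) * max 0 (f x) \<partial>unit_leb) = (\<integral>x. \<phi> x * g x \<partial>unit_leb)"
    using transfer_exists_nonneg[OF T p(1)] by auto
  obtain k where k: "integrable unit_leb k"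
     "\<And>\<phi>. \<phi>\<in>borel_measurable unit_leb \<Longrightarrow> (\<integral>x. \<phi> (T x) * max 0 (- f x) \<partial>unit_leb) = (\<integral>x. \<phi> x * k x \<partial>unit_leb)"
    using transfer_exists_nonneg[OF T p(2)] by auto
  have "(\<integral>x. \<phi> (T x) * f x \<partial>unit_leb) = (\<integral>x. \<phi> x * (g x - k x) \<partial>unit_leb)" if \<phi>: "ess_bounded \<phi>" for \<phi>
  proof -
    have \<phi>T: "ess_bounded (\<lambda>x. \<phi> (T x))"
      using \<phi> piecewise_expanding_measurable[OF T] piecewise_expanding_null[OF T] by (rule ess_bounded_comp)
    have m: "\<phi> \<in> borel_measurable unit_leb" using \<phi> unfolding ess_bounded_def by simp
    have "(\<integral>x. \<phi> (T x) * f x \<partial>unit_leb) = (\<integral>x. \<phi> (T x) * max 0 (f x) - \<phi> (T x) * max 0 (- f x) \<partial>unit_leb)"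
      by (rule Bochner_Integration.integral_cong) (auto simp: max_def)
    also have "\<dots> = (\<integral>x. \<phi> x * g x \<partial>unit_leb) - (\<integral>x. \<phi> x * k x \<partial>unit_leb)"
      using g(2)[OF m] k(2)[OF m] ess_bounded_integrable[OF \<phi>T p(1)] ess_bounded_integrable[OF \<phi>T p(2)] by simp
    also have "\<dots> = (\<integral>x. \<phi> x * (g x - k x) \<partial>unit_leb)"
      using ess_bounded_integrable[OF \<phi> g(1)] ess_bounded_integrable[OF \<phi> k(1)]
      by (simp add: right_diff_distrib)
    finally show ?thesis .
  qed
  then have "\<exists>g. integrable unit_leb g \<and>
        (\<forall>\<phi>. \<phi> \<in> borel_measurable unit_leb \<and> (\<exists>K. AE x in unit_leb. \<bar>\<phi> x\<bar> \<le> K) \<longrightarrow>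
           (\<integral>x. \<phi> (T x) * f x \<partial>unit_leb) = (\<integral>x. \<phi> x * g x \<partial>unit_leb))"
    using g(1) k(1) unfolding ess_bounded_def by (intro exI[of _ "\<lambda>x. g x - k x"]) auto
  from someI_ex[OF this, folded transfer_def]
  show "integrable unit_leb (transfer T f)"
    and "\<And>\<phi>. ess_bounded \<phi> \<Longrightarrow>
       (\<integral>x. \<phi> (T x) * f x \<partial>unit_leb) = (\<integral>x. \<phi> x * transfer T f x \<partial>unit_leb)"
    unfolding ess_bounded_def by auto
qed

section \<open>Cocycle identities and iterated transfer operators\<close>

lemma shift_add: "shift j (shift i \<omega>) = shift (i + j) \<omega>"
  by (simp add: shift_def fun_eq_iff ac_simps)

lemma shift_0 [simp]: "shift 0 \<omega> = \<omega>"
  by (simp add: shift_def)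

lemma rmap_add: "rmap T (m + n) \<omega> = rmap T n (shift (int m) \<omega>) \<circ> rmap T m \<omega>"
  by (induction n) (auto simp: shift_add o_assoc add.commute simp flip: of_nat_add)

lemma rtransfer_add: "rtransfer T (m + n) \<omega> f = rtransfer T n (shift (int m) \<omega>) (rtransfer T m \<omega> f)"
  by (induction n) (auto simp: shift_add simp flip: of_nat_add)

locale expanding_maps =
  fixes T :: "'q \<Rightarrow> real \<Rightarrow> real" and A :: "'q \<Rightarrow> real set set"
  assumes expanding: "\<And>i. piecewise_expanding (T i) (A i)"
begin

lemma rmap_measurable: "rmap T n \<omega> \<in> unit_leb \<rightarrow>\<^sub>M unit_leb"
proof (induction n)
  case 0
  then show ?case by (simp add: id_def)
next
  case (Suc n)
  then show ?case using piecewise_expanding_measurable[OF expanding] by (simp add: measurable_comp)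
qed

lemma rmap_in_unit: "x \<in> {0..1} \<Longrightarrow> rmap T n \<omega> x \<in> {0..1}"
  using measurable_space[OF rmap_measurable] by simp

lemma rmap_null:
  assumes "AE x in unit_leb. P x" shows "AE x in unit_leb. P (rmap T n \<omega> x)"
  using assms
proof (induction n arbitrary: P)
  case (Suc n)
  from Suc.IH[OF piecewise_expanding_null[OF expanding Suc.prems]] show ?case by simp
qed simp

lemma ess_bounded_rmap: "ess_bounded \<phi> \<Longrightarrow> ess_bounded (\<lambda>x. \<phi> (rmap T n \<omega> x))"
  by (rule ess_bounded_comp[OF _ rmap_measurable rmap_null])

lemma rtransfer_integrable: "integrable unit_leb f \<Longrightarrow> integrable unit_leb (rtransfer T n \<omega> f)"
  by (induction n) (auto intro: transfer(1)[OF expanding])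

lemma rtransfer_duality:
  assumes "integrable unit_leb f" "ess_bounded \<phi>"
  shows "(\<integral>x. \<phi> x * rtransfer T n \<omega> f x \<partial>unit_leb) = (\<integral>x. \<phi> (rmap T n \<omega> x) * f x \<partial>unit_leb)"
  using assms(2)
proof (induction n arbitrary: \<phi>)
  case (Suc n)
  let ?T = "T (shift (int n) \<omega> 0)"
  have b: "ess_bounded (\<lambda>x. \<phi> (?T x))"
    using Suc.prems piecewise_expanding_measurable[OF expanding] piecewise_expanding_null[OF expanding]
    by (rule ess_bounded_comp)
  show ?case
    using transfer(2)[OF expanding rtransfer_integrable[OF assms(1)] Suc.prems] Suc.IH[OF b]
    by simp
qed simp

text \<open>Each operator returns an arbitrary version, so that linearity and similar rules hold
  almost everywhere only and are obtained by testing against bounded functions.\<close>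

lemma rtransfer_eqI:
  assumes "integrable unit_leb f" "integrable unit_leb g"
    and "\<And>\<phi>. ess_bounded \<phi> \<Longrightarrow> (\<integral>x. \<phi> (rmap T n \<omega> x) * f x \<partial>unit_leb) = (\<integral>x. \<phi> x * g x \<partial>unit_leb)"
  shows "AE x in unit_leb. rtransfer T n \<omega> f x = g x"
  using assms by (intro integrable_eqI_AE rtransfer_integrable) (auto simp: rtransfer_duality)

lemma rtransfer_diff_cmult:
  assumes f: "integrable unit_leb f" and g: "integrable unit_leb g"
  shows "AE x in unit_leb. rtransfer T n \<omega> (\<lambda>x. f x - c * g x) x = rtransfer T n \<omega> f x - c * rtransfer T n \<omega> g x"
proof (rule rtransfer_eqI)
  fix \<phi> assume \<phi>: "ess_bounded \<phi>"
  note i = ess_bounded_integrable[OF ess_bounded_rmap[OF \<phi>] f] ess_bounded_integrable[OF ess_bounded_rmap[OF \<phi>] g]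
    ess_bounded_integrable[OF \<phi> rtransfer_integrable[OF f]] ess_bounded_integrable[OF \<phi> rtransfer_integrable[OF g]]
  show "(\<integral>x. \<phi> (rmap T n \<omega> x) * (f x - c * g x) \<partial>unit_leb) =
     (\<integral>x. \<phi> x * (rtransfer T n \<omega> f x - c * rtransfer T n \<omega> g x) \<partial>unit_leb)"
    using i by (simp add: right_diff_distrib mult.left_commute[of _ c] rtransfer_duality[OF f \<phi>] rtransfer_duality[OF g \<phi>])
qed (use f g rtransfer_integrable in auto)

lemma rtransfer_integral:
  "integrable unit_leb f \<Longrightarrow> (\<integral>x. rtransfer T n \<omega> f x \<partial>unit_leb) = (\<integral>x. f x \<partial>unit_leb)"
  using rtransfer_duality[of f "\<lambda>_. 1"] ess_bounded_const by simp

text \<open>Duality with the sign of the image as test function.\<close>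

lemma rtransfer_abs_le:
  assumes f: "integrable unit_leb f"
  shows "(\<integral>x. \<bar>rtransfer T n \<omega> f x\<bar> \<partial>unit_leb) \<le> (\<integral>x. \<bar>f x\<bar> \<partial>unit_leb)"
proof -
  let ?P = "rtransfer T n \<omega> f"
  have "?P \<in> borel_measurable unit_leb" using rtransfer_integrable[OF f] by auto
  then have \<phi>: "ess_bounded (\<lambda>x. sgn (?P x))"
    by (intro ess_boundedI[of _ 1]) (auto simp: abs_sgn_eq)
  have "(\<integral>x. \<bar>?P x\<bar> \<partial>unit_leb) = (\<integral>x. sgn (?P x) * ?P x \<partial>unit_leb)"
    by (simp add: abs_sgn mult.commute)
  also have "\<dots> = (\<integral>x. sgn (?P (rmap T n \<omega> x)) * f x \<partial>unit_leb)"
    by (rule rtransfer_duality[OF f \<phi>])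
  also have "\<dots> \<le> (\<integral>x. \<bar>f x\<bar> \<partial>unit_leb)"
    using ess_bounded_integrable[OF ess_bounded_rmap[OF \<phi>] f] f
    by (intro integral_mono) (auto simp: sgn_if)
  finally show ?thesis .
qed

end

section \<open>Sample densities\<close>

text \<open>The conditions in terms of real constants and \<open>BV_le\<close>, uniformly in
  \<open>\<omega>\<close>. With \<open>1 \<le> C\<close> the decay bound also covers
  \<open>n = 0\<close>.\<close>

locale random_expanding = expanding_maps T A
  for T :: "'q::finite \<Rightarrow> real \<Rightarrow> real" and A +
  fixes M C \<theta> c0 :: real
  assumes M_pos: "0 < M"
    and BV_le_rtransfer_1: "\<And>\<omega> f c. BV_le f c \<Longrightarrow> BV_le (rtransfer T 1 \<omega> f) (M * c)"
    and C_ge_1: "1 \<le> C" and \<theta>: "0 < \<theta>" "\<theta> < 1"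
    and decay_0: "\<And>n \<omega> f c. \<lbrakk>BV_le f c; (\<integral>x. f x \<partial>unit_leb) = 0\<rbrakk> \<Longrightarrow>
       BV_le (rtransfer T n \<omega> f) (C * \<theta> ^ n * c)"
    and c0_pos: "0 < c0"
    and lower_0: "\<And>n \<omega>. 1 \<le> n \<Longrightarrow> AE x in unit_leb. c0 \<le> rtransfer T n \<omega> (\<lambda>_. 1) x"
begin

abbreviation h :: "(int \<Rightarrow> 'q) \<Rightarrow> real \<Rightarrow> real" where
  "h \<equiv> sample_density T"

text \<open>The pullback iterates of the constant density, started at time \<open>- n\<close> and
  observed at time 0. They see only the coordinates in \<open>{- n..<0}\<close>, so for fixed
  \<open>n\<close> only finitely many functions \<open>G n \<omega>\<close> exist.\<close>

definition G :: "nat \<Rightarrow> (int \<Rightarrow> 'q) \<Rightarrow> real \<Rightarrow> real" where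
  "G n \<omega> = rtransfer T n (shift (- int n) \<omega>) (\<lambda>_. 1)"

text \<open>\<open>K * \<theta> ^ N\<close> is the tail of the geometric series of the increments of
  \<open>G\<close>, \<open>H\<close> bounds the limit in BV, and \<open>C'\<close> is the decay
  constant for functions of arbitrary mean. None of them depends on \<open>\<omega>\<close>.\<close>

definition K :: real where "K = C * (1 + M) / (1 - \<theta>)"

definition H :: real where "H = 1 + K"

definition C' :: real where "C' = C * (1 + H)"

lemma const_nonneg: "0 \<le> K" "1 \<le> H" "0 \<le> C'"
  using M_pos C_ge_1 \<theta> by (auto simp: K_def H_def C'_def)

lemma G_integrable: "integrable unit_leb (G n \<omega>)"
  unfolding G_def by (rule rtransfer_integrable) auto

lemma rtransfer_G: "rtransfer T m \<omega> (G n \<omega>) = G (n + m) (shift (int m) \<omega>)"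
  unfolding G_def by (simp add: shift_add rtransfer_add)

text \<open>The longer iterate has one additional initial step. After it, the difference of the two
  densities is \<open>?P - 1\<close>, of mean zero and BV bound \<open>M + 1\<close>; the remaining
  \<open>n\<close> steps are common to both and contract it.\<close>

lemma BV_le_G_diff: "BV_le (\<lambda>x. G (Suc n) \<omega> x - G n \<omega> x) (C * \<theta> ^ n * (1 + M))"
proof -
  let ?\<omega> = "shift (- int n) \<omega>" and ?\<omega>' = "shift (- int (Suc n)) \<omega>"
  let ?P = "rtransfer T 1 ?\<omega>' (\<lambda>_. 1)"
  have eq: "G (Suc n) \<omega> = rtransfer T n ?\<omega> ?P"
    using rtransfer_add[of T 1 n ?\<omega>' "\<lambda>_. 1"] by (simp add: G_def shift_add)
  have 1: "BV_le (\<lambda>_. 1) 1" using BV_le_const[of 1] by simp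
  then have "BV_le ?P (M * 1)" by (rule BV_le_rtransfer_1)
  then have d: "BV_le (\<lambda>x. ?P x - 1) (M * 1 + 1)" using 1 by (rule BV_le_diff)
  have Pi: "integrable unit_leb ?P" using BV_le_integrable[OF \<open>BV_le ?P (M * 1)\<close>] .
  have "(\<integral>x. ?P x - 1 \<partial>unit_leb) = 0"
    using rtransfer_integral[of "\<lambda>_. 1" 1 ?\<omega>'] Pi by simp
  with d have "BV_le (rtransfer T n ?\<omega> (\<lambda>x. ?P x - 1)) (C * \<theta> ^ n * (M * 1 + 1))"
    by (rule decay_0)
  then have "BV_le (\<lambda>x. G (Suc n) \<omega> x - G n \<omega> x) (C * \<theta> ^ n * (M * 1 + 1))"
  proof (rule BV_le_cong)
    show "AE x in unit_leb. rtransfer T n ?\<omega> (\<lambda>x. ?P x - 1) x = G (Suc n) \<omega> x - G n \<omega> x"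
      using rtransfer_diff_cmult[OF Pi, of "\<lambda>_. 1" n ?\<omega> 1] unfolding eq by (simp add: G_def)
  qed (use G_integrable in auto)
  then show ?thesis by (simp add: add.commute)
qed

lemma increment_bound_sums: "(\<lambda>n. C * \<theta> ^ (n + N) * (1 + M)) sums (K * \<theta> ^ N)"
proof -
  have "(\<lambda>n. \<theta> ^ n) sums (1 / (1 - \<theta>))" using \<theta> by (intro geometric_sums) auto
  from sums_mult[OF this, of "C * \<theta> ^ N * (1 + M)"]
  show ?thesis by (simp add: K_def power_add mult_ac)
qed

lemma density_limit_exists:
  obtains f where "BV_le f H" "\<And>N. BV_le (\<lambda>x. G N \<omega> x - f x) (K * \<theta> ^ N)"
proof -
  define d where "d = (\<lambda>n x. G (Suc n) \<omega> x - G n \<omega> x)"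
  have d: "BV_le (d n) (C * \<theta> ^ n * (1 + M))" for n
    unfolding d_def by (rule BV_le_G_diff)
  have tel: "(\<Sum>n<N. d n x) = G N \<omega> x - 1" for N x
    unfolding d_def by (subst sum_lessThan_telescope) (simp add: G_def)
  \<comment> \<open>The 1 is \<open>G 0 \<omega>\<close>, where the telescoping sum starts.\<close>
  define f where "f = (\<lambda>x. 1 + (\<Sum>n. d n x))"
  note ser = BV_le_series[of d, OF d]
  have "BV_le (\<lambda>x. \<Sum>n. d n x) K"
    using ser(1) increment_bound_sums[of 0] by (simp add: sums_iff)
  then have f: "BV_le f H"
    unfolding f_def H_def using BV_le_add[OF BV_le_const[of 1]] by fastforce
  have "BV_le (\<lambda>x. G N \<omega> x - f x) (K * \<theta> ^ N)" for N
  proof -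
    have "BV_le (\<lambda>x. \<Sum>n. d (n + N) x) (K * \<theta> ^ N)"
      using BV_le_series(1)[of "\<lambda>n. d (n + N)", OF d] increment_bound_sums[of N] by (simp add: sums_iff)
    then have "BV_le (\<lambda>x. - 1 * (\<Sum>n. d (n + N) x)) (\<bar>- 1\<bar> * (K * \<theta> ^ N))"
      by (rule BV_le_cmult)
    then have "BV_le (\<lambda>x. G N \<omega> x - f x) (\<bar>- 1\<bar> * (K * \<theta> ^ N))"
    proof (rule BV_le_cong)
      have "AE x in unit_leb. summable (\<lambda>n. \<bar>d n x\<bar>)"
        using ser(2) increment_bound_sums[of 0] by (simp add: sums_iff)
      then show "AE x in unit_leb. - 1 * (\<Sum>n. d (n + N) x) = G N \<omega> x - f x"
      proof eventually_elim
        case (elim x)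
        then have "summable (\<lambda>n. d n x)" by (rule summable_rabs_cancel)
        from suminf_minus_initial_segment[OF this, of N] show ?case
          unfolding f_def tel by simp
      qed
    qed (use G_integrable BV_le_integrable[OF f] in auto)
    then show ?thesis by simp
  qed
  with f show ?thesis by (rule that)
qed

text \<open>\<open>sample_density\<close> chooses some BV limit without any rate. The limit built
  from the telescoping series has rates, and uniqueness of limits modulo null sets carries them over
  to the chosen version.\<close>

lemma sample_density_limit:
  "BV_le (h \<omega>) H" "BV_le (\<lambda>x. G N \<omega> x - h \<omega> x) (K * \<theta> ^ N)"
proof -
  obtain f where f: "BV_le f H" "\<And>N. BV_le (\<lambda>x. G N \<omega> x - f x) (K * \<theta> ^ N)"
    using density_limit_exists[of \<omega>] by metis
  have lim: "(\<lambda>N. K * \<theta> ^ N) \<longlonglongrightarrow> 0"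
    using \<theta> by (auto intro!: tendsto_mult_right_zero LIMSEQ_power_zero)
  have "\<exists>g. g \<in> BV \<and>
        (\<lambda>n. BV_norm (\<lambda>x. rtransfer T n (shift (- int n) \<omega>) (\<lambda>_. 1) x - g x)) \<longlonglongrightarrow> 0"
  proof (intro exI[of _ f] conjI)
    show "f \<in> BV" using f(1) by (rule BV_le_imp_BV)
    show "(\<lambda>n. BV_norm (\<lambda>x. rtransfer T n (shift (- int n) \<omega>) (\<lambda>_. 1) x - f x)) \<longlonglongrightarrow> 0"
    proof (rule tendsto_sandwich[OF _ _ tendsto_const])
      show "(\<lambda>N. ennreal (K * \<theta> ^ N)) \<longlonglongrightarrow> 0"
        using tendsto_ennrealI[OF lim] by simp
      show "\<forall>\<^sub>F n in sequentially. BV_norm (\<lambda>x. rtransfer T n (shift (- int n) \<omega>) (\<lambda>_. 1) x - f x) \<le> ennreal (K * \<theta> ^ n)"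
        using f(2) unfolding BV_le_def G_def by auto
    qed auto
  qed
  from someI_ex[OF this, folded sample_density_def]
  have h: "h \<omega> \<in> BV" "(\<lambda>n. BV_norm (\<lambda>x. G n \<omega> x - h \<omega> x)) \<longlonglongrightarrow> 0"
    unfolding G_def by auto
  have hi: "integrable unit_leb (h \<omega>)" using h(1) unfolding BV_def by auto
  have fi: "integrable unit_leb f" by (rule BV_le_integrable[OF f(1)])
  have "(\<integral>x. \<bar>f x - h \<omega> x\<bar> \<partial>unit_leb) \<le> 0 + e" if e: "0 < e" for e
  proof -
    have "\<forall>\<^sub>F n in sequentially. BV_norm (\<lambda>x. G n \<omega> x - h \<omega> x) < ennreal (e / 2)"
      using e by (intro order_tendstoD(2)[OF h(2)]) auto
    moreover have "\<forall>\<^sub>F n in sequentially. K * \<theta> ^ n < e / 2"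
      using e by (intro order_tendstoD(2)[OF lim]) auto
    ultimately have "\<forall>\<^sub>F n in sequentially. BV_norm (\<lambda>x. G n \<omega> x - h \<omega> x) < ennreal (e / 2) \<and> K * \<theta> ^ n < e / 2"
      by eventually_elim auto
    then obtain n where n: "BV_norm (\<lambda>x. G n \<omega> x - h \<omega> x) < ennreal (e / 2)" "K * \<theta> ^ n < e / 2"
      using eventually_happens'[OF sequentially_bot] by blast
    have "BV_le (\<lambda>x. G n \<omega> x - h \<omega> x) (e / 2)"
      using n hi G_integrable e unfolding BV_le_def by auto
    from BV_le_diff[OF this f(2)[of n]] have "BV_le (\<lambda>x. f x - h \<omega> x) (e / 2 + K * \<theta> ^ n)" by simp
    from BV_le_integral_abs_le[OF this] show ?thesis using n by simp
  qed
  then have "(\<integral>x. \<bar>f x - h \<omega> x\<bar> \<partial>unit_leb) \<le> 0" by (rule field_le_epsilon)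
  moreover have "0 \<le> (\<integral>x. \<bar>f x - h \<omega> x\<bar> \<partial>unit_leb)" by simp
  ultimately have "(\<integral>x. \<bar>f x - h \<omega> x\<bar> \<partial>unit_leb) = 0" by linarith
  then have "AE x in unit_leb. \<bar>f x - h \<omega> x\<bar> = 0"
    using hi fi by (subst integral_nonneg_eq_0_iff_AE[symmetric]) auto
  then have eq: "AE x in unit_leb. f x = h \<omega> x" by eventually_elim auto
  show "BV_le (h \<omega>) H" by (rule BV_le_cong[OF f(1) hi eq])
  show "BV_le (\<lambda>x. G N \<omega> x - h \<omega> x) (K * \<theta> ^ N)"
    by (rule BV_le_cong[OF f(2)]) (use G_integrable hi eq in auto)
qed

lemma h_integrable: "integrable unit_leb (h \<omega>)"
  by (rule BV_le_integrable[OF sample_density_limit(1)])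

lemma tendsto_geometric: "(\<lambda>N. K * \<theta> ^ N) \<longlonglongrightarrow> 0"
  using \<theta> by (auto intro!: tendsto_mult_right_zero LIMSEQ_power_zero)

lemma h_lower: "AE x in unit_leb. c0 \<le> h \<omega> x"
proof -
  have "AE x in unit_leb. \<forall>n. \<bar>G n \<omega> x - h \<omega> x\<bar> \<le> K * \<theta> ^ n"
    unfolding AE_all_countable using BV_le_AE_abs_le[OF sample_density_limit(2)] by auto
  moreover have "AE x in unit_leb. \<forall>n\<in>{1..}. c0 \<le> G n \<omega> x"
    using lower_0 unfolding G_def by (subst AE_ball_countable) auto
  ultimately show ?thesis
  proof eventually_elim
    case (elim x)
    have "(\<lambda>n. c0 - K * \<theta> ^ n) \<longlonglongrightarrow> c0 - 0"
      by (intro tendsto_intros tendsto_geometric)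
    moreover have "\<exists>N. \<forall>n\<ge>N. c0 - K * \<theta> ^ n \<le> h \<omega> x"
    proof (intro exI[of _ 1] allI impI)
      fix n :: nat assume "1 \<le> n"
      then show "c0 - K * \<theta> ^ n \<le> h \<omega> x" using spec[OF elim(1), of n] bspec[OF elim(2), of n] by (auto simp: abs_le_iff)
    qed
    ultimately have "c0 - 0 \<le> h \<omega> x" by (rule LIMSEQ_le_const2)
    then show ?case by simp
  qed
qed

lemma h_nonneg: "AE x in unit_leb. 0 \<le> h \<omega> x"
  using h_lower[of \<omega>] by eventually_elim (use c0_pos in auto)

text \<open>Convergence of the densities in supremum norm makes the error proportional to the
  \<open>L1\<close> norm of \<open>\<phi>\<close>. For the indicator of a small ball it is therefore
  small relative to the ball.\<close>

lemma integral_G_h_le: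
  assumes \<phi>: "ess_bounded \<phi>"
  shows "\<bar>(\<integral>x. \<phi> x * G N \<omega> x \<partial>unit_leb) - (\<integral>x. \<phi> x * h \<omega> x \<partial>unit_leb)\<bar> \<le> K * \<theta> ^ N * (\<integral>x. \<bar>\<phi> x\<bar> \<partial>unit_leb)"
proof -
  have i: "integrable unit_leb \<phi>" using ess_bounded_integrable[OF \<phi>, of "\<lambda>_. 1"] by simp
  note j = ess_bounded_integrable[OF \<phi> G_integrable] ess_bounded_integrable[OF \<phi> h_integrable]
  have "\<bar>(\<integral>x. \<phi> x * G N \<omega> x \<partial>unit_leb) - (\<integral>x. \<phi> x * h \<omega> x \<partial>unit_leb)\<bar>
      = \<bar>\<integral>x. \<phi> x * (G N \<omega> x - h \<omega> x) \<partial>unit_leb\<bar>"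
    using j by (simp add: right_diff_distrib)
  also have "\<dots> \<le> (\<integral>x. \<bar>\<phi> x * (G N \<omega> x - h \<omega> x)\<bar> \<partial>unit_leb)" by (rule integral_abs_bound)
  also have "\<dots> \<le> (\<integral>x. K * \<theta> ^ N * \<bar>\<phi> x\<bar> \<partial>unit_leb)"
  proof (rule integral_mono_AE)
    show "AE x in unit_leb. \<bar>\<phi> x * (G N \<omega> x - h \<omega> x)\<bar> \<le> K * \<theta> ^ N * \<bar>\<phi> x\<bar>"
      using BV_le_AE_abs_le[OF sample_density_limit(2)[of N \<omega>]]
      by eventually_elim (metis abs_ge_zero abs_mult mult.commute mult_right_mono)
    show "integrable unit_leb (\<lambda>x. \<bar>\<phi> x * (G N \<omega> x - h \<omega> x)\<bar>)"
      using j by (simp add: right_diff_distrib)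
  qed (use i in auto)
  finally show ?thesis by simp
qed

lemma h_integral: "(\<integral>x. h \<omega> x \<partial>unit_leb) = 1"
proof -
  have "\<bar>1 - (\<integral>x. h \<omega> x \<partial>unit_leb)\<bar> \<le> K * \<theta> ^ N" for N
    using integral_G_h_le[OF ess_bounded_const[of 1], of N \<omega>]
      rtransfer_integral[of "\<lambda>_. 1" N "shift (- int N) \<omega>"] unit.prob_space by (simp add: G_def)
  then have "\<bar>1 - (\<integral>x. h \<omega> x \<partial>unit_leb)\<bar> \<le> 0"
    by (intro LIMSEQ_le_const[OF tendsto_geometric]) auto
  then show ?thesis by simp
qed

text \<open>For the iterates the relation is the identity \<open>rtransfer_G\<close>, at the price
  of passing from \<open>N\<close> to \<open>N + n\<close> on one side. Contraction in
  \<open>L1\<close> transports the approximation of \<open>h \<omega>\<close> through the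
  \<open>n\<close> steps.\<close>

lemma h_invariant: "AE x in unit_leb. rtransfer T n \<omega> (h \<omega>) x = h (shift (int n) \<omega>) x"
proof -
  let ?\<omega> = "shift (int n) \<omega>"
  let ?f = "\<lambda>x. rtransfer T n \<omega> (h \<omega>) x - h ?\<omega> x"
  have fi: "integrable unit_leb ?f" using h_integrable rtransfer_integrable by auto
  have "(\<integral>x. \<bar>?f x\<bar> \<partial>unit_leb) \<le> K * \<theta> ^ N + K * \<theta> ^ N" for N
  proof -
    have "AE x in unit_leb. rtransfer T n \<omega> (\<lambda>x. G N \<omega> x - 1 * h \<omega> x) x = rtransfer T n \<omega> (G N \<omega>) x - 1 * rtransfer T n \<omega> (h \<omega>) x"
      by (rule rtransfer_diff_cmult[OF G_integrable h_integrable])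
    then have AE: "AE x in unit_leb. \<bar>?f x\<bar> \<le> \<bar>rtransfer T n \<omega> (\<lambda>x. G N \<omega> x - h \<omega> x) x\<bar> + \<bar>G (N + n) ?\<omega> x - h ?\<omega> x\<bar>"
      unfolding rtransfer_G[symmetric] by eventually_elim simp
    have gi: "integrable unit_leb (\<lambda>x. G N \<omega> x - h \<omega> x)" using G_integrable h_integrable by auto
    have "(\<integral>x. \<bar>?f x\<bar> \<partial>unit_leb) \<le> (\<integral>x. \<bar>rtransfer T n \<omega> (\<lambda>x. G N \<omega> x - h \<omega> x) x\<bar> + \<bar>G (N + n) ?\<omega> x - h ?\<omega> x\<bar> \<partial>unit_leb)"
      using AE fi rtransfer_integrable[OF gi] G_integrable h_integrable
      by (intro integral_mono_AE) (auto intro!: Bochner_Integration.integrable_add)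
    also have "\<dots> = (\<integral>x. \<bar>rtransfer T n \<omega> (\<lambda>x. G N \<omega> x - h \<omega> x) x\<bar> \<partial>unit_leb) + (\<integral>x. \<bar>G (N + n) ?\<omega> x - h ?\<omega> x\<bar> \<partial>unit_leb)"
      using rtransfer_integrable[OF gi] G_integrable h_integrable by (intro Bochner_Integration.integral_add) auto
    also have "\<dots> \<le> (\<integral>x. \<bar>G N \<omega> x - h \<omega> x\<bar> \<partial>unit_leb) + K * \<theta> ^ (N + n)"
      by (intro add_mono rtransfer_abs_le gi BV_le_integral_abs_le sample_density_limit)
    also have "\<dots> \<le> K * \<theta> ^ N + K * \<theta> ^ N"
      using const_nonneg \<theta>
      by (intro add_mono BV_le_integral_abs_le sample_density_limit mult_left_mono power_decreasing) auto
    finally show ?thesis .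
  qed
  then have "(\<integral>x. \<bar>?f x\<bar> \<partial>unit_leb) \<le> 0 + 0"
    by (intro LIMSEQ_le_const[OF tendsto_add[OF tendsto_geometric tendsto_geometric]]) auto
  moreover have "0 \<le> (\<integral>x. \<bar>?f x\<bar> \<partial>unit_leb)" by simp
  ultimately have "(\<integral>x. \<bar>?f x\<bar> \<partial>unit_leb) = 0" by linarith
  then have "AE x in unit_leb. \<bar>?f x\<bar> = 0"
    using fi by (subst integral_nonneg_eq_0_iff_AE[symmetric]) auto
  then show ?thesis by eventually_elim auto
qed

text \<open>Since \<open>h \<omega>\<close> has integral 1, subtracting the mean times
  \<open>h \<omega>\<close> leaves a function of mean zero; this costs the factor
  \<open>1 + H\<close>, and invariance identifies the image of the subtracted part.\<close>

lemma decay: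
  assumes f: "BV_le f c"
  shows "BV_le (\<lambda>x. rtransfer T n \<omega> f x - (\<integral>x. f x \<partial>unit_leb) * h (shift (int n) \<omega>) x) (C' * \<theta> ^ n * c)"
proof -
  let ?I = "\<integral>x. f x \<partial>unit_leb"
  have fi: "integrable unit_leb f" by (rule BV_le_integrable[OF f])
  have I: "\<bar>?I\<bar> \<le> c"
    using integral_abs_bound[of unit_leb f] BV_le_integral_abs_le[OF f] by linarith
  have "BV_le (\<lambda>x. f x - ?I * h \<omega> x) (c + \<bar>?I\<bar> * H)"
    by (intro BV_le_diff f BV_le_cmult sample_density_limit)
  then have g: "BV_le (\<lambda>x. f x - ?I * h \<omega> x) (c * (1 + H))"
    by (rule BV_le_mono) (use I const_nonneg in \<open>simp add: distrib_left mult_right_mono\<close>)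
  have "(\<integral>x. f x - ?I * h \<omega> x \<partial>unit_leb) = 0"
    using fi h_integrable[of \<omega>] h_integral[of \<omega>] by simp
  from decay_0[OF g this]
  have "BV_le (rtransfer T n \<omega> (\<lambda>x. f x - ?I * h \<omega> x)) (C * \<theta> ^ n * (c * (1 + H)))" .
  then have "BV_le (\<lambda>x. rtransfer T n \<omega> f x - ?I * h (shift (int n) \<omega>) x) (C * \<theta> ^ n * (c * (1 + H)))"
  proof (rule BV_le_cong)
    show "AE x in unit_leb. rtransfer T n \<omega> (\<lambda>x. f x - ?I * h \<omega> x) x = rtransfer T n \<omega> f x - ?I * h (shift (int n) \<omega>) x"
      using rtransfer_diff_cmult[OF fi h_integrable, of n \<omega> ?I \<omega>] h_invariant[of n \<omega>]
      by eventually_elim simp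
  qed (use rtransfer_integrable fi h_integrable in auto)
  then show ?thesis by (simp add: C'_def mult_ac)
qed

section \<open>Sample measures\<close>

lemma sets_sample_measure [simp]: "sets (sample_measure T \<omega>) = sets unit_leb"
  and space_sample_measure [simp]: "space (sample_measure T \<omega>) = {0..1}"
  by (simp_all add: sample_measure_def)

lemma integral_sample_measure:
  assumes "\<phi> \<in> borel_measurable unit_leb"
  shows "(\<integral>x. \<phi> x \<partial>sample_measure T \<omega>) = (\<integral>x. \<phi> x * h \<omega> x \<partial>unit_leb)"
  unfolding sample_measure_def using assms h_integrable[of \<omega>] h_nonneg
  by (subst integral_density) (auto simp: mult.commute)

lemma prob_space_sample_measure: "prob_space (sample_measure T \<omega>)"
proof (rule prob_spaceI)
  have "emeasure (sample_measure T \<omega>) (space (sample_measure T \<omega>)) = (\<integral>\<^sup>+x. ennreal (h \<omega> x) \<partial>unit_leb)"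
    unfolding sample_measure_def using h_integrable[of \<omega>]
    by (subst emeasure_density) (auto intro!: nn_integral_cong simp: indicator_def simp del: space_unit_leb)
  also have "\<dots> = ennreal (\<integral>x. h \<omega> x \<partial>unit_leb)"
    by (rule nn_integral_eq_integral[OF h_integrable h_nonneg])
  finally show "emeasure (sample_measure T \<omega>) (space (sample_measure T \<omega>)) = 1"
    by (simp add: h_integral)
qed

lemma measure_sample_measure:
  assumes "E \<in> sets unit_leb"
  shows "measure (sample_measure T \<omega>) E = (\<integral>x. indicator E x * h \<omega> x \<partial>unit_leb)"
proof -
  have "E \<subseteq> {0..1}" using sets.sets_into_space[OF assms] by simp
  then show ?thesis
    using integral_sample_measure[of "indicator E" \<omega>] assms by (simp add: Int_absorb2)
qed

end

section \<open>The Bernoulli shift\<close>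

lemma prob_space_bernoulli: "prob_space (bernoulli p)"
  unfolding bernoulli_def by (intro prob_space_PiM measure_pmf.prob_space_axioms)

lemma space_bernoulli [simp]: "space (bernoulli p) = UNIV"
  unfolding bernoulli_def by (simp add: space_PiM)

lemma distr_shift: "distr (bernoulli p) (bernoulli p) (shift k) = bernoulli p"
proof -
  have "distr (bernoulli p) (bernoulli p) (\<lambda>\<omega>. \<lambda>n\<in>UNIV. \<omega> (n + k)) = bernoulli p"
    unfolding bernoulli_def
    by (rule distr_PiM_reindex[where f = "\<lambda>n. n + k" and K = UNIV and I = UNIV and M = "\<lambda>_. measure_pmf p"])
       (auto intro: measure_pmf.prob_space_axioms simp: inj_on_def)
  then show ?thesis by (simp add: shift_def[abs_def] restrict_def)
qed

lemma shift_measurable: "shift k \<in> bernoulli p \<rightarrow>\<^sub>M bernoulli p"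
proof -
  have "(\<lambda>\<omega>. \<lambda>i\<in>UNIV. \<omega> (i + k)) \<in> bernoulli p \<rightarrow>\<^sub>M bernoulli p"
    unfolding bernoulli_def by (intro measurable_restrict measurable_component_singleton) auto
  then show ?thesis by (simp add: shift_def[abs_def] restrict_def)
qed

lemma AE_shift:
  assumes "AE \<omega> in bernoulli p. P \<omega>" shows "AE \<omega> in bernoulli p. P (shift k \<omega>)"
proof (rule AE_distrD[OF shift_measurable])
  show "AE \<omega> in distr (bernoulli p) (bernoulli p) (shift k). P \<omega>"
    unfolding distr_shift by (rule assms)
qed

lemma integral_shift:
  fixes f :: "_ \<Rightarrow> real"
  assumes "f \<in> borel_measurable (bernoulli p)"
  shows "(\<integral>\<omega>. f (shift k \<omega>) \<partial>bernoulli p) = (\<integral>\<omega>. f \<omega> \<partial>bernoulli p)"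
  using integral_distr[OF shift_measurable[of k p] assms] by (simp add: distr_shift)

lemma indep_vars_bernoulli:
  "prob_space.indep_vars (bernoulli p) (\<lambda>_. measure_pmf p) (\<lambda>i \<omega>. \<omega> i) (UNIV :: int set)"
proof -
  interpret prob_space "bernoulli p" by (rule prob_space_bernoulli)
  have comp: "distr (bernoulli p) (measure_pmf p) (\<lambda>\<omega>. \<omega> i) = measure_pmf p" for i
    unfolding bernoulli_def by (rule distr_PiM_component) (auto intro: measure_pmf.prob_space_axioms)
  have rv: "random_variable (measure_pmf p) (\<lambda>\<omega>. \<omega> i)" for i
    unfolding bernoulli_def by (rule measurable_component_singleton) auto
  show ?thesis
  proof (subst indep_vars_iff_distr_eq_PiM)
    show "distr (bernoulli p) (Pi\<^sub>M UNIV (\<lambda>_. measure_pmf p)) (\<lambda>\<omega>. \<lambda>i\<in>UNIV. \<omega> i) =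
        Pi\<^sub>M UNIV (\<lambda>i. distr (bernoulli p) (measure_pmf p) (\<lambda>\<omega>. \<omega> i))"
      unfolding comp bernoulli_def[symmetric] by (simp add: restrict_def distr_id[unfolded id_def])
  qed (use rv in auto)
qed

section \<open>Functions of finitely many coordinates\<close>

definition depends_on :: "int set \<Rightarrow> ((int \<Rightarrow> 'q) \<Rightarrow> 'b) \<Rightarrow> bool" where
  "depends_on I f \<longleftrightarrow> (\<forall>\<omega> \<omega>'. (\<forall>i\<in>I. \<omega> i = \<omega>' i) \<longrightarrow> f \<omega> = f \<omega>')"

lemma depends_on_restrict: "depends_on I f \<Longrightarrow> f \<omega> = f (restrict \<omega> I)"
  unfolding depends_on_def by (metis restrict_apply')

text \<open>A finite product of finite discrete spaces is discrete, so every function on it is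
  measurable.\<close>

lemma measurable_PiM_finite:
  fixes f :: "(int \<Rightarrow> 'q::finite) \<Rightarrow> real"
  assumes "finite I" shows "f \<in> borel_measurable (Pi\<^sub>M I (\<lambda>_. measure_pmf p))"
proof -
  have "sets (Pi\<^sub>M I (\<lambda>_. measure_pmf p)) = sets (count_space (PiE I (\<lambda>_. UNIV)))"
    using assms
    by (subst count_space_PiM_finite[symmetric]) (auto intro!: sets_PiM_cong countableI_type)
  then have "Pi\<^sub>M I (\<lambda>_. measure_pmf p) \<rightarrow>\<^sub>M (borel :: real measure) = count_space (PiE I (\<lambda>_. UNIV)) \<rightarrow>\<^sub>M borel"
    by (rule measurable_cong_sets) simp
  then show ?thesis by simp
qed

lemma depends_on_measurable:
  fixes f :: "(int \<Rightarrow> 'q::finite) \<Rightarrow> real"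
  assumes f: "depends_on I f" and I: "finite I" shows "f \<in> borel_measurable (bernoulli p)"
proof -
  have "(\<lambda>\<omega>. f (restrict \<omega> I)) \<in> borel_measurable (bernoulli p)"
    unfolding bernoulli_def
    by (rule measurable_compose[OF measurable_restrict_subset measurable_PiM_finite[OF I]]) auto
  then show ?thesis using depends_on_restrict[OF f] by simp
qed

lemma depends_on_finite_range:
  fixes f :: "(int \<Rightarrow> 'q::finite) \<Rightarrow> 'b"
  assumes f: "depends_on I f" and I: "finite I" shows "finite (range f)"
proof -
  have "range f \<subseteq> f ` PiE I (\<lambda>_. UNIV)"
  proof safe
    fix \<omega> show "f \<omega> \<in> f ` PiE I (\<lambda>_. UNIV)"
      using depends_on_restrict[OF f, of \<omega>] by (intro image_eqI[of _ _ "restrict \<omega> I"]) auto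
  qed
  moreover have "finite (PiE I (\<lambda>_. UNIV :: 'q set))" using I by (intro finite_PiE) auto
  ultimately show ?thesis by (metis finite_imageI finite_subset)
qed

lemma depends_on_bounded:
  fixes f :: "(int \<Rightarrow> 'q::finite) \<Rightarrow> real"
  assumes f: "depends_on I f" and I: "finite I"
  obtains B where "0 < B" "\<And>\<omega>. \<bar>f \<omega>\<bar> \<le> B"
proof -
  have "bounded (range f)"
    using depends_on_finite_range[OF f I] by (rule finite_imp_bounded)
  then obtain B where "0 < B" "\<And>\<omega>. norm (f \<omega>) \<le> B" by (auto simp: bounded_pos)
  then show ?thesis using that by auto
qed

text \<open>Along a residue class modulo the window length, the shifted functions are independent, so
  Hoeffding's inequality and Borel--Cantelli apply to each class separately.\<close>

lemma LLN_residue_class: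
  fixes f :: "(int \<Rightarrow> 'q::finite) \<Rightarrow> real" and a k :: nat
  assumes f: "depends_on {- int k..int k} f" and e: "0 < e"
  defines "J \<equiv> \<lambda>n. {j. j < n \<and> j mod (2 * k + 1) = a}"
  shows "AE \<omega> in bernoulli p. \<forall>\<^sub>F n in sequentially.
    \<bar>(\<Sum>j\<in>J n. f (shift (int j) \<omega>)) - real (card (J n)) * (\<integral>\<omega>. f \<omega> \<partial>bernoulli p)\<bar> < real n * e"
proof -
  interpret prob_space "bernoulli p" by (rule prob_space_bernoulli)
  obtain B where B: "0 < B" "\<And>\<omega>. \<bar>f \<omega>\<bar> \<le> B" using depends_on_bounded[OF f] by auto
  define Y where "Y = (\<lambda>j \<omega>. f (shift (int j) \<omega>))"
  \<comment> \<open>The coordinates of \<open>\<omega>\<close> read by \<open>Y j\<close>. They have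
    length \<open>2 * k + 1\<close>, hence are disjoint for distinct times congruent modulo this
    number.\<close>
  define W where "W = (\<lambda>j::nat. {int j - int k..int j + int k})"
  have fm [measurable]: "f \<in> borel_measurable (bernoulli p)" by (rule depends_on_measurable[OF f]) auto
  have Ym [measurable]: "Y j \<in> borel_measurable (bernoulli p)" for j
    unfolding Y_def by (rule measurable_compose[OF shift_measurable fm])
  have Yr: "Y j \<omega> = f (shift (int j) (restrict \<omega> (W j)))" for j \<omega>
    using f unfolding Y_def depends_on_def shift_def W_def by (auto simp: restrict_def)
  have disj: "disjoint_family_on W {j. j mod (2 * k + 1) = a}"
  proof (unfold disjoint_family_on_def, intro ballI impI)
    fix i j assume ij: "i \<in> {j. j mod (2 * k + 1) = a}" "j \<in> {j. j mod (2 * k + 1) = a}" "i \<noteq> j"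
    have *: "W i \<inter> W j = {}" if "i < j" "i mod (2 * k + 1) = j mod (2 * k + 1)" for i j
    proof -
      have "(2 * k + 1) dvd (j - i)" using that by (metis mod_eq_dvd_iff_nat less_imp_le)
      then have "2 * k + 1 \<le> j - i" using that by (intro dvd_imp_le) auto
      then show ?thesis using that unfolding W_def by auto
    qed
    show "W i \<inter> W j = {}"
      using *[of i j] *[of j i] ij by (cases i j rule: linorder_cases) auto
  qed
  have "indep_vars (\<lambda>j. Pi\<^sub>M (W j) (\<lambda>_. measure_pmf p)) (\<lambda>j \<omega>. restrict (\<lambda>i. \<omega> i) (W j)) {j. j mod (2 * k + 1) = a}"
    by (rule indep_vars_restrict[OF indep_vars_bernoulli _ disj]) auto
  from indep_vars_compose2[OF this, of "\<lambda>j v. f (shift (int j) v)" "\<lambda>_. borel"]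
  have ind: "indep_vars (\<lambda>_. borel) Y {j. j mod (2 * k + 1) = a}"
    unfolding Yr[abs_def] by (auto intro!: measurable_PiM_finite simp: W_def)
  have E: "expectation (Y j) = expectation f" for j
    unfolding Y_def by (rule integral_shift[OF fm])
  define S where "S = (\<lambda>n \<omega>. (\<Sum>j\<in>J n. Y j \<omega>) - real (card (J n)) * expectation f)"
  have Sm [measurable]: "S n \<in> borel_measurable (bernoulli p)" for n unfolding S_def by measurable
  define Bad where "Bad = (\<lambda>n. {\<omega>. real n * e \<le> \<bar>S n \<omega>\<bar>})"
  \<comment> \<open>The Hoeffding exponent for deviation \<open>n * e\<close>, at most
    \<open>n\<close> variables and ranges of length \<open>2 * B\<close> is at least
    \<open>2 * (n * e)^2 / (n * 4 * B^2)\<close>. It is linear in \<open>n\<close>, so the bounds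
    are geometric with ratio \<open>q\<close>.\<close>
  define q where "q = exp (- (e\<^sup>2 / (2 * B\<^sup>2)))"
  have q: "0 < q" "q < 1" using e B unfolding q_def by auto
  have bound: "prob (Bad n) \<le> 2 * q ^ n" if n: "1 \<le> n" for n
  proof (cases "J n = {}")
    case True
    then have "Bad n = {}" using n e unfolding Bad_def S_def by (auto simp: not_le)
    then show ?thesis using q by simp
  next
    case False
    have fin: "finite (J n)" unfolding J_def by simp
    have card: "card (J n) \<le> n" "0 < card (J n)"
      using card_mono[of "{..<n}" "J n"] False fin unfolding J_def by (auto simp: card_gt_0_iff)
    interpret Hoeffding_ineq "bernoulli p" "J n" Y "\<lambda>_. - B" "\<lambda>_. B" "real (card (J n)) * expectation f"
    proof unfold_locales
      show "indep_vars (\<lambda>_. borel) Y (J n)" by (rule indep_vars_subset[OF ind]) (auto simp: J_def)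
      show "AE \<omega> in bernoulli p. Y i \<omega> \<in> {- B..B}" for i
        using B(2) unfolding Y_def by (auto simp: abs_le_iff minus_le_iff)
    qed (auto simp: fin E)
    have sq: "(\<Sum>i\<in>J n. (B - - B)\<^sup>2) = real (card (J n)) * (4 * B\<^sup>2)" by (simp add: power2_eq_square)
    have "prob (Bad n) \<le> 2 * exp (- 2 * (real n * e)\<^sup>2 / (real (card (J n)) * (4 * B\<^sup>2)))"
      using Hoeffding_ineq_abs_ge[of "real n * e", unfolded sq] e card B(1)
      unfolding Bad_def S_def by simp
    also have "\<dots> \<le> 2 * exp (- (real n * (e\<^sup>2 / (2 * B\<^sup>2))))"
    proof -
      have "real n * (e\<^sup>2 / (2 * B\<^sup>2)) = 2 * (real n * e)\<^sup>2 / (real n * (4 * B\<^sup>2))"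
        using n B by (simp add: power2_eq_square field_simps)
      also have "\<dots> \<le> 2 * (real n * e)\<^sup>2 / (real (card (J n)) * (4 * B\<^sup>2))"
        using card B by (intro divide_left_mono mult_right_mono mult_pos_pos) auto
      finally show ?thesis by simp
    qed
    also have "\<dots> = 2 * q ^ n" unfolding q_def by (simp add: exp_of_nat_mult[symmetric])
    finally show ?thesis .
  qed
  have "AE \<omega> in bernoulli p. \<forall>\<^sub>F n in sequentially. \<omega> \<in> space (bernoulli p) - Bad n"
  proof (rule borel_cantelli_AE1)
    show "Bad n \<in> events" for n unfolding Bad_def
      using measurable_sets[of "\<lambda>\<omega>. \<bar>S n \<omega>\<bar>" "bernoulli p" borel "{real n * e..}"] by (simp add: vimage_def)
    show "emeasure (bernoulli p) (Bad n) < \<infinity>" for n by (simp add: less_top[symmetric])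
    have "summable (\<lambda>n. 2 * q ^ n)" using q by (intro summable_mult summable_geometric) auto
    then show "summable (\<lambda>n. prob (Bad n))"
      by (rule summable_comparison_test'[of _ 1]) (use bound in auto)
  qed
  then show ?thesis
    by eventually_elim (auto simp: Bad_def S_def Y_def not_le elim!: eventually_mono)
qed

lemma LLN_depends_on:
  fixes f :: "(int \<Rightarrow> 'q::finite) \<Rightarrow> real" and k :: nat
  assumes f: "depends_on {- int k..int k} f"
  shows "AE \<omega> in bernoulli p. (\<lambda>n. (\<Sum>j<n. f (shift (int j) \<omega>)) / real n) \<longlonglongrightarrow> (\<integral>\<omega>. f \<omega> \<partial>bernoulli p)"
proof -
  define w where "w = 2 * k + 1"
  define J where "J = (\<lambda>a n. {j. j < n \<and> j mod w = a})"
  let ?E = "\<integral>\<omega>. f \<omega> \<partial>bernoulli p"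
  have "AE \<omega> in bernoulli p. \<forall>a<w. \<forall>m. \<forall>\<^sub>F n in sequentially.
    \<bar>(\<Sum>j\<in>J a n. f (shift (int j) \<omega>)) - real (card (J a n)) * ?E\<bar> < real n * (1 / real (Suc m))"
  proof (intro allI AE_impI AE_all_countable[THEN iffD2])
    fix a m :: nat
    have "(0::real) < 1 / real (Suc m)" by simp
    from LLN_residue_class[OF f this, where a = a] show "AE \<omega> in bernoulli p. \<forall>\<^sub>F n in sequentially.
        \<bar>(\<Sum>j\<in>J a n. f (shift (int j) \<omega>)) - real (card (J a n)) * ?E\<bar> < real n * (1 / real (Suc m))"
      unfolding J_def w_def .
  qed
  then show ?thesis
  proof eventually_elim
    case (elim \<omega>)
    show ?case
    proof (rule LIMSEQ_I)
      fix r :: real assume "0 < r"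
      \<comment> \<open>Each of the \<open>w\<close> residue classes may contribute an error of
        \<open>n / (m + 1)\<close>.\<close>
      then obtain m where m: "inverse (real (Suc m)) < r / real w"
        using reals_Archimedean[of "r / real w"] unfolding w_def by auto
      have "\<forall>\<^sub>F n in sequentially. \<forall>a\<in>{..<w}.
        \<bar>(\<Sum>j\<in>J a n. f (shift (int j) \<omega>)) - real (card (J a n)) * ?E\<bar> < real n * (1 / real (Suc m))"
        using elim by (intro eventually_ball_finite) auto
      moreover have "\<forall>\<^sub>F n in sequentially. 1 \<le> n" by (rule eventually_ge_at_top)
      ultimately have "\<forall>\<^sub>F n in sequentially. norm ((\<Sum>j<n. f (shift (int j) \<omega>)) / real n - ?E) < r"
      proof eventually_elim
        case (elim n)
        have Un: "{..<n} = (\<Union>a\<in>{..<w}. J a n)" unfolding J_def w_def by auto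
        have "(\<Sum>j<n. f (shift (int j) \<omega>) - ?E) = (\<Sum>a<w. \<Sum>j\<in>J a n. f (shift (int j) \<omega>) - ?E)"
          unfolding Un by (rule sum.UNION_disjoint) (auto simp: J_def)
        also have "\<dots> = (\<Sum>a<w. (\<Sum>j\<in>J a n. f (shift (int j) \<omega>)) - real (card (J a n)) * ?E)"
          by (simp add: sum_subtractf)
        also have "\<bar>\<dots>\<bar> \<le> (\<Sum>a<w. real n * (1 / real (Suc m)))"
          using elim(1) by (intro order.trans[OF sum_abs] sum_mono) (auto simp: less_imp_le)
        also have "\<dots> = real n * (real w * inverse (real (Suc m)))" by (simp add: field_simps)
        also have "\<dots> < real n * r"
          using m elim(2) unfolding w_def by (intro mult_strict_left_mono) (auto simp: field_simps)
        finally have "\<bar>(\<Sum>j<n. f (shift (int j) \<omega>)) - real n * ?E\<bar> < real n * r"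
          by (simp add: sum_subtractf)
        moreover have "(\<Sum>j<n. f (shift (int j) \<omega>)) / real n - ?E = ((\<Sum>j<n. f (shift (int j) \<omega>)) - real n * ?E) / real n"
          using elim(2) by (simp add: field_simps)
        ultimately show ?case using elim(2) by (simp add: abs_divide field_simps)
      qed
      then show "\<exists>no. \<forall>n\<ge>no. norm ((\<Sum>j<n. f (shift (int j) \<omega>)) / real n - ?E) < r"
        by (simp add: eventually_sequentially)
    qed
  qed
qed

lemma uniform_cylinder_approx:
  fixes f :: "(int \<Rightarrow> 'q::finite) \<Rightarrow> real"
  assumes "\<And>e. 0 < e \<Longrightarrow> \<exists>k::nat. \<forall>\<omega> \<omega>'. (\<forall>i\<in>{- int k..int k}. \<omega> i = \<omega>' i) \<longrightarrow> \<bar>f \<omega> - f \<omega>'\<bar> \<le> e"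
  obtains g and k :: "nat \<Rightarrow> nat" where "\<And>m. depends_on {- int (k m)..int (k m)} (g m)"
    "\<And>m \<omega>. \<bar>f \<omega> - g m \<omega>\<bar> \<le> 1 / real (Suc m)"
proof -
  have "\<forall>m. \<exists>k::nat. \<forall>\<omega> \<omega>'. (\<forall>i\<in>{- int k..int k}. \<omega> i = \<omega>' i) \<longrightarrow> \<bar>f \<omega> - f \<omega>'\<bar> \<le> 1 / real (Suc m)"
    by (intro allI assms) simp
  then obtain k where k: "\<And>m \<omega> \<omega>'. (\<forall>i\<in>{- int (k m)..int (k m)}. \<omega> i = \<omega>' i) \<Longrightarrow> \<bar>f \<omega> - f \<omega>'\<bar> \<le> 1 / real (Suc m)"
    by metis
  show ?thesis
  proof (rule that)
    \<comment> \<open>Restriction freezes all coordinates outside the window to one and the same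
      symbol.\<close>
    show "depends_on {- int (k m)..int (k m)} (\<lambda>\<omega>. f (restrict \<omega> {- int (k m)..int (k m)}))" for m
      unfolding depends_on_def by (metis restrict_ext)
    show "\<bar>f \<omega> - f (restrict \<omega> {- int (k m)..int (k m)})\<bar> \<le> 1 / real (Suc m)" for m \<omega>
      by (rule k) auto
  qed
qed

text \<open>The hypothesis is uniform continuity on the shift space. Measurability in
  \<open>\<omega>\<close> is a conclusion and not an assumption: versions of densities are chosen
  separately for each \<open>\<omega>\<close>, but their integrals over balls are continuous in this
  sense and therefore uniform limits of measurable cylinder functions.\<close>

lemma LLN_uniform_cylinder:
  fixes f :: "(int \<Rightarrow> 'q::finite) \<Rightarrow> real"
  assumes f: "\<And>e. 0 < e \<Longrightarrow> \<exists>k::nat. \<forall>\<omega> \<omega>'. (\<forall>i\<in>{- int k..int k}. \<omega> i = \<omega>' i) \<longrightarrow> \<bar>f \<omega> - f \<omega>'\<bar> \<le> e"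
  shows "integrable (bernoulli p) f"
    "AE \<omega> in bernoulli p. (\<lambda>n. (\<Sum>j<n. f (shift (int j) \<omega>)) / real n) \<longlonglongrightarrow> (\<integral>\<omega>. f \<omega> \<partial>bernoulli p)"
proof -
  interpret prob_space "bernoulli p" by (rule prob_space_bernoulli)
  obtain g and k :: "nat \<Rightarrow> nat" where g: "\<And>m. depends_on {- int (k m)..int (k m)} (g m)"
    "\<And>m \<omega>. \<bar>f \<omega> - g m \<omega>\<bar> \<le> 1 / real (Suc m)"
    using uniform_cylinder_approx[OF f] by metis
  have gm: "g m \<in> borel_measurable (bernoulli p)" for m by (rule depends_on_measurable[OF g(1)]) auto
  have lim: "(\<lambda>m. 1 / real (Suc m)) \<longlonglongrightarrow> 0" by (intro LIMSEQ_Suc lim_1_over_n)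
  have fm: "f \<in> borel_measurable (bernoulli p)"
  proof (rule borel_measurable_LIMSEQ_real[OF _ gm])
    fix \<omega> show "(\<lambda>m. g m \<omega>) \<longlonglongrightarrow> f \<omega>"
      by (rule LIM_zero_cancel, rule Lim_null_comparison[OF _ lim])
         (use g(2) in \<open>auto simp: abs_minus_commute\<close>)
  qed
  have gi: "integrable (bernoulli p) (g m)" for m
  proof -
    obtain B where "0 < B" "\<And>\<omega>. \<bar>g m \<omega>\<bar> \<le> B" using depends_on_bounded[OF g(1)] by auto
    then show ?thesis using gm by (intro integrable_const_bound[of _ B]) auto
  qed
  show fi: "integrable (bernoulli p) f"
  proof -
    obtain B where B: "0 < B" "\<And>\<omega>. \<bar>g 0 \<omega>\<bar> \<le> B" using depends_on_bounded[OF g(1)] by auto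
    have "\<bar>f \<omega>\<bar> \<le> B + 1" for \<omega> using g(2)[of \<omega> 0] B(2)[of \<omega>] by simp
    then show ?thesis using fm by (intro integrable_const_bound[of _ "B + 1"]) auto
  qed
  have Ed: "\<bar>expectation f - expectation (g m)\<bar> \<le> 1 / real (Suc m)" for m
  proof -
    have "\<bar>expectation f - expectation (g m)\<bar> = \<bar>\<integral>\<omega>. f \<omega> - g m \<omega> \<partial>bernoulli p\<bar>"
      using fi gi by simp
    also have "\<dots> \<le> (\<integral>\<omega>. \<bar>f \<omega> - g m \<omega>\<bar> \<partial>bernoulli p)" by (rule integral_abs_bound)
    also have "\<dots> \<le> (\<integral>\<omega>. 1 / real (Suc m) \<partial>bernoulli p)"
      using fi gi g(2) by (intro integral_mono) auto
    also have "\<dots> = 1 / real (Suc m)" using prob_space by (simp del: space_bernoulli)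
    finally show ?thesis .
  qed
  have "AE \<omega> in bernoulli p. \<forall>m. (\<lambda>n. (\<Sum>j<n. g m (shift (int j) \<omega>)) / real n) \<longlonglongrightarrow> expectation (g m)"
    unfolding AE_all_countable using LLN_depends_on[OF g(1)] by auto
  then show "AE \<omega> in bernoulli p. (\<lambda>n. (\<Sum>j<n. f (shift (int j) \<omega>)) / real n) \<longlonglongrightarrow> expectation f"
  proof eventually_elim
    case (elim \<omega>)
    show ?case
    proof (rule LIMSEQ_I)
      fix r :: real assume "0 < r"
      then obtain m where m: "inverse (real (Suc m)) < r / 3" using reals_Archimedean[of "r / 3"] by auto
      have "\<forall>\<^sub>F n in sequentially. dist ((\<Sum>j<n. g m (shift (int j) \<omega>)) / real n) (expectation (g m)) < r / 3"
        using elim[rule_format, of m] \<open>0 < r\<close> by (intro tendstoD) auto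
      moreover have "\<forall>\<^sub>F n in sequentially. 1 \<le> n" by (rule eventually_ge_at_top)
      ultimately have "\<forall>\<^sub>F n in sequentially. norm ((\<Sum>j<n. f (shift (int j) \<omega>)) / real n - expectation f) < r"
      proof eventually_elim
        case (elim n)
        have "\<bar>(\<Sum>j<n. f (shift (int j) \<omega>)) / real n - (\<Sum>j<n. g m (shift (int j) \<omega>)) / real n\<bar>
            = \<bar>\<Sum>j<n. f (shift (int j) \<omega>) - g m (shift (int j) \<omega>)\<bar> / real n"
          by (simp add: sum_subtractf diff_divide_distrib[symmetric] abs_divide)
        also have "\<dots> \<le> (\<Sum>j<n. 1 / real (Suc m)) / real n"
          using g(2) by (intro divide_right_mono order.trans[OF sum_abs] sum_mono) auto
        also have "\<dots> = inverse (real (Suc m))" using elim(2) by (simp add: inverse_eq_divide)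
        finally show ?case
          using elim(1) m Ed[of m] unfolding dist_real_def real_norm_def inverse_eq_divide by linarith
      qed
      then show "\<exists>no. \<forall>n\<ge>no. norm ((\<Sum>j<n. f (shift (int j) \<omega>)) / real n - expectation f) < r"
        by (simp add: eventually_sequentially)
    qed
  qed
qed

section \<open>Local asymptotics of the sample measures\<close>

lemma rmap_word: "(\<And>i. i \<in> {0..<int n} \<Longrightarrow> \<omega> i = \<omega>' i) \<Longrightarrow> rmap T n \<omega> = rmap T n \<omega>'"
  by (induction n) (auto simp: shift_def)

lemma rtransfer_word: "(\<And>i. i \<in> {0..<int n} \<Longrightarrow> \<omega> i = \<omega>' i) \<Longrightarrow> rtransfer T n \<omega> f = rtransfer T n \<omega>' f"
  by (induction n) (auto simp: shift_def)

text \<open>As \<open>t = 0\<close> is allowed, \<open>m n\<close> need not tend to infinity and the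
  averages cannot just be evaluated along \<open>m n\<close>. Instead the deviation of the
  \<open>n\<close>-th partial sum from \<open>n * L\<close> is at most \<open>c + d * n\<close> for
  all \<open>n\<close>, with \<open>d\<close> small, and \<open>m n = O(n)\<close>.\<close>

lemma LIMSEQ_average_subsequence:
  fixes f :: "nat \<Rightarrow> real" and m :: "nat \<Rightarrow> nat"
  assumes f: "(\<lambda>n. (\<Sum>j<n. f j) / real n) \<longlonglongrightarrow> L" and m: "(\<lambda>n. real (m n) / real n) \<longlonglongrightarrow> t"
  shows "(\<lambda>n. (\<Sum>j<m n. f j) / real n) \<longlonglongrightarrow> t * L"
proof -
  define g where "g = (\<lambda>n. (\<Sum>j<n. f j) - real n * L)"
  have "(\<lambda>n. g (m n) / real n) \<longlonglongrightarrow> 0"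
  proof (rule LIMSEQ_I)
    fix e :: real assume e: "0 < e"
    have "Bseq (\<lambda>n. real (m n) / real n)" using m by (intro convergent_imp_Bseq convergentI)
    then obtain B where B: "0 < B" "\<And>n. \<bar>real (m n) / real n\<bar> \<le> B" unfolding Bseq_def by auto
    define d where "d = e / (2 * B)"
    have d: "0 < d" "d * B = e / 2" using e B by (auto simp: d_def)
    obtain N where N: "\<And>n. N \<le> n \<Longrightarrow> \<bar>(\<Sum>j<n. f j) / real n - L\<bar> < d"
      using LIMSEQ_D[OF f d(1)] by auto
    define c where "c = (\<Sum>n\<le>N. \<bar>g n\<bar>)"
    have c: "\<bar>g n\<bar> \<le> c + d * real n" for n
    proof (cases "n \<le> N")
      case True
      then have "\<bar>g n\<bar> \<le> c" unfolding c_def by (intro member_le_sum) auto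
      then show ?thesis using d by (simp add: add_increasing2)
    next
      case False
      then have "g n = ((\<Sum>j<n. f j) / real n - L) * real n" unfolding g_def by (simp add: field_simps)
      then have "\<bar>g n\<bar> \<le> d * real n"
        using N[of n] False by (simp add: abs_mult mult_right_mono less_imp_le)
      moreover have "0 \<le> c" unfolding c_def by (intro sum_nonneg) auto
      ultimately show ?thesis by linarith
    qed
    obtain N' where N': "\<And>n. N' \<le> n \<Longrightarrow> \<bar>c / real n\<bar> < e / 2"
      using LIMSEQ_D[OF lim_const_over_n[of c], of "e / 2"] e by auto
    show "\<exists>no. \<forall>n\<ge>no. norm (g (m n) / real n - 0) < e"
    proof (intro exI[of _ "max N' 1"] allI impI)
      fix n assume n: "max N' 1 \<le> n"
      have "\<bar>g (m n) / real n\<bar> \<le> (c + d * real (m n)) / real n"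
        using c[of "m n"] by (simp add: abs_divide divide_right_mono)
      also have "\<dots> = c / real n + d * (real (m n) / real n)" by (simp add: add_divide_distrib)
      also have "\<dots> < e / 2 + d * B"
        using le_less_trans[OF abs_ge_self N'[of n]] n B(2)[of n] d
        by (intro add_less_le_mono mult_left_mono) auto
      finally show "norm (g (m n) / real n - 0) < e" using d by simp
    qed
  qed
  from tendsto_add[OF this tendsto_mult_right[OF m, of L]]
  show ?thesis by (simp add: g_def diff_divide_distrib)
qed

context random_expanding
begin

lemma G_word: "depends_on {- int n..<0} (G n)"
  unfolding depends_on_def
proof (intro allI impI)
  fix \<omega> \<omega>' :: "int \<Rightarrow> 'q" assume "\<forall>i\<in>{- int n..<0}. \<omega> i = \<omega>' i"
  then show "G n \<omega> = G n \<omega>'" unfolding G_def by (intro rtransfer_word) (auto simp: shift_def)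
qed

section \<open>Masses of small balls, uniformly in the environment\<close>

definition ball_mass :: "real \<Rightarrow> (int \<Rightarrow> 'q) \<Rightarrow> real \<Rightarrow> real" where
  "ball_mass z \<omega> r = (\<integral>x. indicator {y. \<bar>y - z\<bar> < r} x * h \<omega> x \<partial>unit_leb)"

definition ball_size :: "real \<Rightarrow> real \<Rightarrow> real" where
  "ball_size z r = (\<integral>x. indicator {y. \<bar>y - z\<bar> < r} x \<partial>unit_leb)"

lemma ball_borel: "{y. \<bar>y - z\<bar> < r} \<in> sets borel" for z r :: real
  by simp

lemma ball_integrable: "integrable unit_leb (\<lambda>x. indicator {y. \<bar>y - z\<bar> < r} x :: real)" for z r :: real
  using integrable_indicator_mult[OF ball_borel, of "\<lambda>_. 1" z r] by simp

lemma ball_size_eq: "ball_size z r = measure lborel ({y. \<bar>y - z\<bar> < r} \<inter> {0..1})"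
  unfolding ball_size_def
  by (simp add: measure_def emeasure_unit_leb[OF sets_unit_leb_I[OF ball_borel]])

lemma ball_size_le: "0 \<le> r \<Longrightarrow> ball_size z r \<le> 2 * r"
proof -
  assume "0 \<le> r"
  have "ball_size z r \<le> measure lborel {z - r..z + r}"
    unfolding ball_size_eq
    by (rule measure_mono_fmeasurable) (auto simp: fmeasurable_def emeasure_lborel_Icc_eq)
  then show ?thesis using \<open>0 \<le> r\<close> by simp
qed

text \<open>On one of its sides \<open>z\<close> has distance at least \<open>1 / 2\<close> from the
  end of the unit interval.\<close>

lemma ball_size_ge:
  assumes "z \<in> {0..1}" "0 \<le> r" shows "min r (1 / 2) \<le> ball_size z r"
proof -
  let ?m = "min r (1 / 2)"
  have fm: "{y. \<bar>y - z\<bar> < r} \<inter> {0..1} \<in> fmeasurable lborel"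
  proof (rule fmeasurableI2)
    show "{0..1::real} \<in> fmeasurable lborel" by (auto simp: fmeasurable_def)
  qed auto
  show ?thesis
  proof (cases "z \<le> 1 / 2")
    case True
    have "measure lborel {z..<z + ?m} \<le> ball_size z r"
      unfolding ball_size_eq by (rule measure_mono_fmeasurable[OF _ _ fm]) (use True assms in auto)
    then show ?thesis using assms by simp
  next
    case False
    have "measure lborel {z - ?m<..z} \<le> ball_size z r"
      unfolding ball_size_eq by (rule measure_mono_fmeasurable[OF _ _ fm]) (use False assms in auto)
    then show ?thesis using assms by simp
  qed
qed

lemma ball_mass_lower:
  "c0 * ball_size z r \<le> ball_mass z \<omega> r"
proof -
  have "(\<integral>x. c0 * indicator {y. \<bar>y - z\<bar> < r} x \<partial>unit_leb) \<le> ball_mass z \<omega> r"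
    unfolding ball_mass_def
  proof (rule integral_mono_AE)
    show "AE x in unit_leb. c0 * indicator {y. \<bar>y - z\<bar> < r} x \<le> indicator {y. \<bar>y - z\<bar> < r} x * h \<omega> x"
      using h_lower[of \<omega>] by eventually_elim (auto simp: indicator_def)
  qed (use ball_integrable integrable_indicator_mult[OF ball_borel h_integrable] in auto)
  then show ?thesis unfolding ball_size_def by simp
qed

lemma ball_mass_G:
  assumes "0 \<le> r"
  shows "\<bar>(\<integral>x. indicator {y. \<bar>y - z\<bar> < r} x * G N \<omega> x \<partial>unit_leb) - ball_mass z \<omega> r\<bar> \<le> K * \<theta> ^ N * (2 * r)"
proof -
  have "\<bar>(\<integral>x. indicator {y. \<bar>y - z\<bar> < r} x * G N \<omega> x \<partial>unit_leb) - ball_mass z \<omega> r\<bar> \<le> K * \<theta> ^ N * ball_size z r"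
    using integral_G_h_le[OF ess_bounded_indicator[OF ball_borel], of z r N \<omega>]
    unfolding ball_mass_def ball_size_def by simp
  also have "\<dots> \<le> K * \<theta> ^ N * (2 * r)"
    using ball_size_le[OF assms] const_nonneg \<theta> by (intro mult_left_mono) auto
  finally show ?thesis .
qed

lemma ball_mass_cylinder:
  assumes "0 \<le> r" "\<forall>i\<in>{- int N..int N}. \<omega> i = \<omega>' i"
  shows "\<bar>ball_mass z \<omega> r - ball_mass z \<omega>' r\<bar> \<le> 4 * (K * \<theta> ^ N) * r"
proof -
  have "G N \<omega> = G N \<omega>'" using G_word[of N] assms(2) unfolding depends_on_def by auto
  then show ?thesis
    using ball_mass_G[OF assms(1), of z N \<omega>] ball_mass_G[OF assms(1), of z N \<omega>'] by simp
qed

text \<open>Uniformity in \<open>\<omega>\<close> comes from finiteness. Replacing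
  \<open>h \<omega>\<close> by \<open>G N \<omega>\<close> costs at most \<open>e / 2\<close>
  relative to the radius, and only finitely many functions \<open>G N \<omega>\<close> occur, so the
  least of their thresholds serves every environment.\<close>

lemma ball_mass_average:
  assumes z: "z \<in> {0..1}" and e: "0 < e"
  shows "\<exists>L. \<exists>d>0. \<forall>\<omega> r. 0 < r \<and> r < d \<longrightarrow> \<bar>ball_mass z \<omega> r - L \<omega> * r\<bar> \<le> e * r"
proof -
  obtain N where N: "K * \<theta> ^ N < e / 4"
  proof -
    have "\<forall>\<^sub>F N in sequentially. K * \<theta> ^ N < e / 4"
      using e by (intro order_tendstoD(2)[OF tendsto_geometric]) auto
    then show ?thesis using that eventually_happens'[OF sequentially_bot] by blast
  qed
  have fin: "finite (range (G N))" using depends_on_finite_range[OF G_word] by simp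
  have "0 < e / 2" using e by simp
  have "\<forall>g\<in>range (G N). \<exists>L. \<exists>d>0. \<forall>r. 0 < r \<and> r < d \<longrightarrow>
     \<bar>(\<integral>x. indicator {y. \<bar>y - z\<bar> < r} x * g x \<partial>unit_leb) - L * r\<bar> \<le> e / 2 * r"
  proof
    fix g assume "g \<in> range (G N)"
    then obtain \<omega> where g: "g = G N \<omega>" by auto
    have "BV_le g (K * \<theta> ^ N + H)"
      using BV_le_add[OF sample_density_limit(2)[of N \<omega>] sample_density_limit(1)[of \<omega>]] unfolding g by simp
    then show "\<exists>L. \<exists>d>0. \<forall>r. 0 < r \<and> r < d \<longrightarrow>
     \<bar>(\<integral>x. indicator {y. \<bar>y - z\<bar> < r} x * g x \<partial>unit_leb) - L * r\<bar> \<le> e / 2 * r"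
      by (rule BV_ball_average[OF _ z \<open>0 < e / 2\<close>])
  qed
  from bchoice[OF this] obtain L where "\<forall>g\<in>range (G N). \<exists>d>0. \<forall>r. 0 < r \<and> r < d \<longrightarrow>
     \<bar>(\<integral>x. indicator {y. \<bar>y - z\<bar> < r} x * g x \<partial>unit_leb) - L g * r\<bar> \<le> e / 2 * r" by blast
  from bchoice[OF this] obtain d where Ld: "\<And>g. g \<in> range (G N) \<Longrightarrow> 0 < d g"
    "\<And>g r. \<lbrakk>g \<in> range (G N); 0 < r; r < d g\<rbrakk> \<Longrightarrow>
     \<bar>(\<integral>x. indicator {y. \<bar>y - z\<bar> < r} x * g x \<partial>unit_leb) - L g * r\<bar> \<le> e / 2 * r"
    by blast
  define d0 where "d0 = Min (d ` range (G N))"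
  have "0 < d0" unfolding d0_def using fin Ld(1) by (subst Min_gr_iff) auto
  have d0: "d0 \<le> d (G N \<omega>)" for \<omega> unfolding d0_def using fin by (intro Min_le) auto
  show ?thesis
  proof (rule exI[of _ "\<lambda>\<omega>. L (G N \<omega>)"], rule exI[of _ d0], intro conjI allI impI)
    fix \<omega> r assume r: "0 < r \<and> r < d0"
    have "K * \<theta> ^ N * (2 * r) \<le> e / 4 * (2 * r)" using N r by (intro mult_right_mono) auto
    moreover have "\<bar>(\<integral>x. indicator {y. \<bar>y - z\<bar> < r} x * G N \<omega> x \<partial>unit_leb) - L (G N \<omega>) * r\<bar> \<le> e / 2 * r"
      using r less_le_trans[OF _ d0[of \<omega>], of r] by (intro Ld(2)) auto
    moreover have "\<bar>(\<integral>x. indicator {y. \<bar>y - z\<bar> < r} x * G N \<omega> x \<partial>unit_leb) - ball_mass z \<omega> r\<bar> \<le> K * \<theta> ^ N * (2 * r)"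
      using r by (intro ball_mass_G) auto
    ultimately show "\<bar>ball_mass z \<omega> r - L (G N \<omega>) * r\<bar> \<le> e * r"
      unfolding abs_le_iff by linarith
  qed fact
qed

text \<open>Mass per radius, not per length: the sum of the one-sided limits of the sample density
  at \<open>z\<close>. The radii \<open>1 / (n + 1)\<close> only serve to single out a
  value.\<close>

definition local_density :: "real \<Rightarrow> (int \<Rightarrow> 'q) \<Rightarrow> real" where
  "local_density z \<omega> = lim (\<lambda>n. ball_mass z \<omega> (1 / real (Suc n)) * real (Suc n))"

text \<open>The numbers \<open>L \<omega>\<close> of \<open>ball_mass_average\<close> change with
  \<open>e\<close>. The quotients along the radii \<open>1 / (n + 1)\<close> are eventually within
  any given error of them, hence form a Cauchy sequence, and their limit inherits the uniform
  estimate.\<close>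

lemma local_density:
  assumes z: "z \<in> {0..1}" and e: "0 < e"
  shows "\<exists>d>0. \<forall>\<omega> r. 0 < r \<and> r < d \<longrightarrow> \<bar>ball_mass z \<omega> r - local_density z \<omega> * r\<bar> \<le> e * r"
proof -
  let ?D = "\<lambda>\<omega> n. ball_mass z \<omega> (1 / real (Suc n)) * real (Suc n)"
  have small: "\<forall>\<^sub>F n in sequentially. 1 / real (Suc n) < d" if "0 < d" for d
    using that by (intro order_tendstoD(2)[OF LIMSEQ_Suc[OF lim_1_over_n]]) auto
  have close: "\<exists>L. \<exists>d>0. (\<forall>\<omega> r. 0 < r \<and> r < d \<longrightarrow> \<bar>ball_mass z \<omega> r - L \<omega> * r\<bar> \<le> \<epsilon> * r) \<and>
     (\<forall>\<^sub>F n in sequentially. \<forall>\<omega>. \<bar>?D \<omega> n - L \<omega>\<bar> \<le> \<epsilon>)" if \<epsilon>: "0 < \<epsilon>" for \<epsilon>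
  proof -
    obtain L d where d: "0 < d" "\<And>\<omega> r. \<lbrakk>0 < r; r < d\<rbrakk> \<Longrightarrow> \<bar>ball_mass z \<omega> r - L \<omega> * r\<bar> \<le> \<epsilon> * r"
      using ball_mass_average[OF z \<epsilon>] by blast
    have "\<forall>\<^sub>F n in sequentially. \<forall>\<omega>. \<bar>?D \<omega> n - L \<omega>\<bar> \<le> \<epsilon>"
      using small[OF d(1)]
    proof eventually_elim
      case (elim n)
      show ?case
      proof
        fix \<omega>
        have "\<bar>ball_mass z \<omega> (1 / real (Suc n)) - L \<omega> * (1 / real (Suc n))\<bar> * real (Suc n) \<le> \<epsilon> * (1 / real (Suc n)) * real (Suc n)"
          using d(2)[of "1 / real (Suc n)" \<omega>] elim by (intro mult_right_mono) auto
        also have "\<bar>ball_mass z \<omega> (1 / real (Suc n)) - L \<omega> * (1 / real (Suc n))\<bar> * real (Suc n) = \<bar>(ball_mass z \<omega> (1 / real (Suc n)) - L \<omega> * (1 / real (Suc n))) * real (Suc n)\<bar>"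
          by (simp add: abs_mult)
        also have "(ball_mass z \<omega> (1 / real (Suc n)) - L \<omega> * (1 / real (Suc n))) * real (Suc n) = ?D \<omega> n - L \<omega>"
          by (simp add: left_diff_distrib del: of_nat_Suc)
        finally show "\<bar>?D \<omega> n - L \<omega>\<bar> \<le> \<epsilon>" by (simp del: of_nat_Suc)
      qed
    qed
    then show ?thesis using d by blast
  qed
  have conv: "?D \<omega> \<longlonglongrightarrow> local_density z \<omega>" for \<omega>
  proof -
    have "Cauchy (?D \<omega>)"
    proof (rule metric_CauchyI)
      fix \<epsilon> :: real assume "0 < \<epsilon>"
      then have "0 < \<epsilon> / 3" by simp
      obtain L where "\<forall>\<^sub>F n in sequentially. \<forall>\<omega>. \<bar>?D \<omega> n - L \<omega>\<bar> \<le> \<epsilon> / 3"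
        using close[OF \<open>0 < \<epsilon> / 3\<close>] by blast
      then obtain N where N: "\<And>n. N \<le> n \<Longrightarrow> \<bar>?D \<omega> n - L \<omega>\<bar> \<le> \<epsilon> / 3"
        unfolding eventually_sequentially by blast
      show "\<exists>M. \<forall>m\<ge>M. \<forall>n\<ge>M. dist (?D \<omega> m) (?D \<omega> n) < \<epsilon>"
      proof (intro exI[of _ N] allI impI)
        fix m n assume "N \<le> m" "N \<le> n"
        then show "dist (?D \<omega> m) (?D \<omega> n) < \<epsilon>"
          using N[of m] N[of n] \<open>0 < \<epsilon>\<close> unfolding dist_real_def by linarith
      qed
    qed
    then have "convergent (?D \<omega>)" by (rule Cauchy_convergent)
    then show ?thesis unfolding local_density_def by (simp only: convergent_LIMSEQ_iff)
  qed
  have "0 < e / 2" using e by simp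
  obtain L d where d: "0 < d" "\<And>\<omega> r. \<lbrakk>0 < r; r < d\<rbrakk> \<Longrightarrow> \<bar>ball_mass z \<omega> r - L \<omega> * r\<bar> \<le> e / 2 * r"
    and L: "\<forall>\<^sub>F n in sequentially. \<forall>\<omega>. \<bar>?D \<omega> n - L \<omega>\<bar> \<le> e / 2"
    using close[OF \<open>0 < e / 2\<close>] by blast
  have "\<bar>local_density z \<omega> - L \<omega>\<bar> \<le> e / 2" for \<omega>
  proof (rule tendsto_upperbound)
    show "(\<lambda>n. \<bar>?D \<omega> n - L \<omega>\<bar>) \<longlonglongrightarrow> \<bar>local_density z \<omega> - L \<omega>\<bar>"
      by (intro tendsto_intros conv)
    show "\<forall>\<^sub>F n in sequentially. \<bar>?D \<omega> n - L \<omega>\<bar> \<le> e / 2" using L by eventually_elim auto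
  qed auto
  note Hx = this
  show ?thesis
  proof (intro exI[of _ d] conjI allI impI)
    fix \<omega> r assume r: "0 < r \<and> r < d"
    have "\<bar>local_density z \<omega> - L \<omega>\<bar> * r \<le> e / 2 * r"
      using Hx r by (intro mult_right_mono) auto
    then have "\<bar>local_density z \<omega> * r - L \<omega> * r\<bar> \<le> e / 2 * r"
      using r by (simp add: left_diff_distrib[symmetric] abs_mult)
    then show "\<bar>ball_mass z \<omega> r - local_density z \<omega> * r\<bar> \<le> e * r"
      using d(2)[of r \<omega>] r by linarith
  qed fact
qed

lemma geometric_tail_small: "\<exists>k::nat. K * \<theta> ^ k * a \<le> e" if "0 < e" for e a :: real
proof -
  have "(\<lambda>k. K * \<theta> ^ k * a) \<longlonglongrightarrow> 0 * a" by (intro tendsto_intros tendsto_geometric)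
  then have "\<forall>\<^sub>F k in sequentially. K * \<theta> ^ k * a < e" using that by (intro order_tendstoD(2)) auto
  then show ?thesis using eventually_happens'[OF sequentially_bot] less_imp_le by blast
qed

lemma ball_mass_uniform_cylinder:
  assumes "0 \<le> r" "0 < e"
  shows "\<exists>k::nat. \<forall>\<omega> \<omega>'. (\<forall>i\<in>{- int k..int k}. \<omega> i = \<omega>' i) \<longrightarrow> \<bar>ball_mass z \<omega> r - ball_mass z \<omega>' r\<bar> \<le> e"
proof -
  obtain k where k: "K * \<theta> ^ k * (4 * r) \<le> e" using geometric_tail_small[OF assms(2)] by blast
  show ?thesis
  proof (intro exI[of _ k] allI impI)
    fix \<omega> \<omega>' :: "int \<Rightarrow> 'q" assume "\<forall>i\<in>{- int k..int k}. \<omega> i = \<omega>' i"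
    from ball_mass_cylinder[OF assms(1) this, of z] k
    show "\<bar>ball_mass z \<omega> r - ball_mass z \<omega>' r\<bar> \<le> e" by (simp add: mult_ac)
  qed
qed

text \<open>At one fixed small radius the local density is the quotient of mass and radius up to a
  uniform error, and at a fixed radius the mass is uniformly continuous in
  \<open>\<omega>\<close>.\<close>

lemma local_density_uniform_cylinder:
  assumes z: "z \<in> {0..1}" and e: "0 < e"
  shows "\<exists>k::nat. \<forall>\<omega> \<omega>'. (\<forall>i\<in>{- int k..int k}. \<omega> i = \<omega>' i) \<longrightarrow> \<bar>local_density z \<omega> - local_density z \<omega>'\<bar> \<le> e"
proof -
  have "0 < e / 4" using e by simp
  obtain d where d: "0 < d" "\<And>\<omega> r. \<lbrakk>0 < r; r < d\<rbrakk> \<Longrightarrow> \<bar>ball_mass z \<omega> r - local_density z \<omega> * r\<bar> \<le> e / 4 * r"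
    using local_density[OF z \<open>0 < e / 4\<close>] by blast
  define r where "r = d / 2"
  have r: "0 < r" "r < d" using d by (auto simp: r_def)
  have "0 < e / 4 * r" using e r by simp
  then obtain k :: nat where k: "\<And>\<omega> \<omega>'. (\<forall>i\<in>{- int k..int k}. \<omega> i = \<omega>' i) \<Longrightarrow> \<bar>ball_mass z \<omega> r - ball_mass z \<omega>' r\<bar> \<le> e / 4 * r"
    using ball_mass_uniform_cylinder[OF less_imp_le[OF r(1)] \<open>0 < e / 4 * r\<close>, of z] by blast
  show ?thesis
  proof (intro exI[of _ k] allI impI)
    fix \<omega> \<omega>' :: "int \<Rightarrow> 'q" assume "\<forall>i\<in>{- int k..int k}. \<omega> i = \<omega>' i"
    from k[OF this] have "\<bar>local_density z \<omega> * r - local_density z \<omega>' * r\<bar> \<le> e * r"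
      using d(2)[OF r, of \<omega>] d(2)[OF r, of \<omega>'] by linarith
    then have "\<bar>local_density z \<omega> - local_density z \<omega>'\<bar> * r \<le> e * r"
      using r by (simp add: left_diff_distrib[symmetric] abs_mult)
    then show "\<bar>local_density z \<omega> - local_density z \<omega>'\<bar> \<le> e" using r by simp
  qed
qed

lemma local_density_lower:
  assumes z: "z \<in> {0..1}" shows "c0 \<le> local_density z \<omega>"
proof (rule field_le_epsilon)
  fix e :: real assume e: "0 < e"
  obtain d where d: "0 < d" "\<And>\<omega> r. \<lbrakk>0 < r; r < d\<rbrakk> \<Longrightarrow> \<bar>ball_mass z \<omega> r - local_density z \<omega> * r\<bar> \<le> e * r"
    using local_density[OF z e] by blast
  define r where "r = min (d / 2) (1 / 2)"
  have r: "0 < r" "r < d" "r \<le> 1 / 2" using d by (auto simp: r_def)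
  have "c0 * r \<le> c0 * ball_size z r"
    using ball_size_ge[OF z, of r] r c0_pos by (intro mult_left_mono) auto
  also have "\<dots> \<le> ball_mass z \<omega> r" by (rule ball_mass_lower)
  also have "\<dots> \<le> (local_density z \<omega> + e) * r"
    using d(2)[OF r(1,2), of \<omega>] by (simp add: distrib_right)
  finally show "c0 \<le> local_density z \<omega> + e" using r(1) by simp
qed

section \<open>Radii normalised by the stationary measure\<close>

context
  fixes p :: "'q pmf" and z :: real and r :: "nat \<Rightarrow> real"
  assumes z: "z \<in> {0..1}" and r_pos: "\<And>n. 1 \<le> n \<Longrightarrow> 0 < r n"
    and r_scale: "(\<lambda>n. real n * (\<integral>\<omega>. ball_mass z \<omega> (r n) \<partial>bernoulli p)) \<longlonglongrightarrow> 1"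
begin

lemma ball_mass_integrable: "0 \<le> s \<Longrightarrow> integrable (bernoulli p) (\<lambda>\<omega>. ball_mass z \<omega> s)"
  by (rule LLN_uniform_cylinder(1)) (rule ball_mass_uniform_cylinder)

lemma local_density_integrable: "integrable (bernoulli p) (local_density z)"
  by (rule LLN_uniform_cylinder(1)) (rule local_density_uniform_cylinder[OF z])

lemma prob_bernoulli: "measure (bernoulli p) UNIV = 1"
  using prob_space.prob_space[OF prob_space_bernoulli[of p]] by simp

lemma local_density_mean_pos: "c0 \<le> (\<integral>\<omega>. local_density z \<omega> \<partial>bernoulli p)"
proof -
  interpret prob_space "bernoulli p" by (rule prob_space_bernoulli)
  have "(\<integral>\<omega>. c0 \<partial>bernoulli p) \<le> (\<integral>\<omega>. local_density z \<omega> \<partial>bernoulli p)"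
    using local_density_integrable local_density_lower[OF z] by (intro integral_mono) auto
  then show ?thesis by (simp add: prob_bernoulli)
qed

text \<open>By the lower bound on densities, \<open>n * c0 * min (r n) (1 / 2)\<close> is eventually
  below 2. For \<open>n \<ge> 4 / c0\<close> this rules out \<open>r n > 1 / 2\<close>, so that the
  minimum is \<open>r n\<close>.\<close>

lemma r_bound: "\<forall>\<^sub>F n in sequentially. real n * r n \<le> 2 / c0"
proof -
  have "\<forall>\<^sub>F n in sequentially. real n * (\<integral>\<omega>. ball_mass z \<omega> (r n) \<partial>bernoulli p) < 2"
    by (rule order_tendstoD(2)[OF r_scale]) simp
  moreover have "\<forall>\<^sub>F n in sequentially. max 1 (nat \<lceil>4 / c0\<rceil>) \<le> n" by (rule eventually_ge_at_top)
  ultimately show ?thesis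
  proof eventually_elim
    case (elim n)
    interpret prob_space "bernoulli p" by (rule prob_space_bernoulli)
    have n: "1 \<le> n" "4 / c0 \<le> real n" using elim(2) by linarith+
    have rn: "0 < r n" using r_pos n by simp
    have "(\<integral>\<omega>. c0 * min (r n) (1 / 2) \<partial>bernoulli p) \<le> (\<integral>\<omega>. ball_mass z \<omega> (r n) \<partial>bernoulli p)"
    proof (rule integral_mono)
      fix \<omega>
      have "c0 * min (r n) (1 / 2) \<le> c0 * ball_size z (r n)"
        using ball_size_ge[OF z, of "r n"] rn c0_pos by (intro mult_left_mono) auto
      also have "\<dots> \<le> ball_mass z \<omega> (r n)" by (rule ball_mass_lower)
      finally show "c0 * min (r n) (1 / 2) \<le> ball_mass z \<omega> (r n)" .
    qed (use ball_mass_integrable[of "r n"] rn in auto)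
    then have "real n * (c0 * min (r n) (1 / 2)) \<le> real n * (\<integral>\<omega>. ball_mass z \<omega> (r n) \<partial>bernoulli p)"
      by (intro mult_left_mono) (auto simp: prob_bernoulli)
    then have *: "real n * (c0 * min (r n) (1 / 2)) < 2" using elim(1) by linarith
    have "2 \<le> real n * (c0 * (1 / 2))" using n c0_pos by (simp add: field_simps)
    then have "r n \<le> 1 / 2" using * by (auto simp: min_def split: if_splits)
    then show ?case using * c0_pos by (simp add: min_def field_simps)
  qed
qed

lemma r_tendsto_0: "r \<longlonglongrightarrow> 0"
proof (rule tendsto_sandwich[OF _ _ tendsto_const])
  show "\<forall>\<^sub>F n in sequentially. 0 \<le> r n"
    using eventually_ge_at_top[of 1] by eventually_elim (use r_pos less_imp_le in auto)
  show "(\<lambda>n. 2 / c0 / real n) \<longlonglongrightarrow> 0" by (rule lim_const_over_n)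
  show "\<forall>\<^sub>F n in sequentially. r n \<le> 2 / c0 / real n"
    using r_bound eventually_ge_at_top[of 1]
    by eventually_elim (auto simp: pos_le_divide_eq mult.commute simp del: divide_divide_eq_left)
qed

text \<open>The error is measured against \<open>1 / n\<close>, because it is going to be summed
  over \<open>O(n)\<close> times.\<close>

lemma ball_mass_r_asymp:
  assumes v: "0 < v" and e: "0 < e"
  shows "\<forall>\<^sub>F n in sequentially. \<forall>\<omega>. \<bar>ball_mass z \<omega> (v * r n) - local_density z \<omega> * (v * r n)\<bar> \<le> e / real n"
proof -
  \<comment> \<open>With \<open>r n \<le> 2 / (c0 * n)\<close> this gives
    \<open>\<epsilon> * (v * r n) \<le> e / n\<close>.\<close>
  define \<epsilon> where "\<epsilon> = e * c0 / (2 * v)"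
  have \<epsilon>: "0 < \<epsilon>" using e v c0_pos by (simp add: \<epsilon>_def)
  obtain d where d: "0 < d" "\<And>\<omega> r. \<lbrakk>0 < r; r < d\<rbrakk> \<Longrightarrow> \<bar>ball_mass z \<omega> r - local_density z \<omega> * r\<bar> \<le> \<epsilon> * r"
    using local_density[OF z \<epsilon>] by blast
  have "(\<lambda>n. v * r n) \<longlonglongrightarrow> v * 0" by (intro tendsto_intros r_tendsto_0)
  then have "\<forall>\<^sub>F n in sequentially. v * r n < d" using d by (intro order_tendstoD(2)) auto
  then show ?thesis
    using r_bound eventually_ge_at_top[of 1]
  proof eventually_elim
    case (elim n)
    have rn: "0 < v * r n" using r_pos[of n] elim v by simp
    have "\<epsilon> * (v * r n) = e * c0 / 2 * r n" using v by (simp add: \<epsilon>_def)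
    also have "\<dots> \<le> e * c0 / 2 * (2 / c0 / real n)"
      using elim e c0_pos by (intro mult_left_mono) (auto simp: field_simps)
    also have "\<dots> = e / real n" using c0_pos by simp
    finally show ?case using d(2)[OF rn] elim(1) order_trans by blast
  qed
qed

lemma r_asymp: "(\<lambda>n. real n * r n) \<longlonglongrightarrow> 1 / (\<integral>\<omega>. local_density z \<omega> \<partial>bernoulli p)"
proof -
  interpret prob_space "bernoulli p" by (rule prob_space_bernoulli)
  let ?L = "\<integral>\<omega>. local_density z \<omega> \<partial>bernoulli p"
  have L: "0 < ?L" using local_density_mean_pos c0_pos by linarith
  have "(\<lambda>n. real n * (\<integral>\<omega>. ball_mass z \<omega> (r n) \<partial>bernoulli p) - real n * r n * ?L) \<longlonglongrightarrow> 0"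
  proof (rule LIMSEQ_I)
    fix e :: real assume e: "0 < e"
    then have e2: "0 < e / 2" by simp
    have "\<forall>\<^sub>F n in sequentially. norm (real n * (\<integral>\<omega>. ball_mass z \<omega> (r n) \<partial>bernoulli p) - real n * r n * ?L - 0) < e"
      using ball_mass_r_asymp[OF zero_less_one e2] eventually_ge_at_top[of 1]
    proof eventually_elim
      case (elim n)
      have i: "integrable (bernoulli p) (\<lambda>\<omega>. ball_mass z \<omega> (r n))"
        using r_pos[of n] elim by (intro ball_mass_integrable) auto
      have "\<bar>(\<integral>\<omega>. ball_mass z \<omega> (r n) \<partial>bernoulli p) - ?L * r n\<bar> = \<bar>\<integral>\<omega>. ball_mass z \<omega> (r n) - local_density z \<omega> * r n \<partial>bernoulli p\<bar>"
        using i local_density_integrable by simp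
      also have "\<dots> \<le> (\<integral>\<omega>. \<bar>ball_mass z \<omega> (r n) - local_density z \<omega> * r n\<bar> \<partial>bernoulli p)"
        by (rule integral_abs_bound)
      also have "\<dots> \<le> (\<integral>\<omega>. e / 2 / real n \<partial>bernoulli p)"
        using elim(1) i local_density_integrable by (intro integral_mono) auto
      finally have "\<bar>(\<integral>\<omega>. ball_mass z \<omega> (r n) \<partial>bernoulli p) - ?L * r n\<bar> \<le> e / 2 / real n"
        by (simp add: prob_bernoulli)
      then have "real n * \<bar>(\<integral>\<omega>. ball_mass z \<omega> (r n) \<partial>bernoulli p) - ?L * r n\<bar> \<le> real n * (e / 2 / real n)"
        by (intro mult_left_mono) auto
      then have "\<bar>real n * ((\<integral>\<omega>. ball_mass z \<omega> (r n) \<partial>bernoulli p) - ?L * r n)\<bar> \<le> e / 2"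
        using elim(2) by (simp add: abs_mult)
      then show ?case using e by (simp add: algebra_simps)
    qed
    then show "\<exists>no. \<forall>n\<ge>no. norm (real n * (\<integral>\<omega>. ball_mass z \<omega> (r n) \<partial>bernoulli p) - real n * r n * ?L - 0) < e"
      by (simp add: eventually_sequentially)
  qed
  from tendsto_diff[OF r_scale this] have "(\<lambda>n. real n * r n * ?L) \<longlonglongrightarrow> 1" by simp
  from tendsto_divide[OF this tendsto_const, of ?L] show ?thesis using L by simp
qed

text \<open>The sum is close to \<open>v * r n\<close> times the sum of local densities. The latter
  grows like \<open>t * n\<close> times the mean local density, whereas \<open>n * r n\<close> tends
  to the reciprocal of that mean. What is left is the area of a rectangle, independent of the
  dynamics.\<close>

lemma ball_mass_sums:
  fixes m :: "nat \<Rightarrow> nat"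
  assumes \<omega>: "(\<lambda>n. (\<Sum>j<n. local_density z (shift (int j) \<omega>)) / real n) \<longlonglongrightarrow> (\<integral>\<omega>. local_density z \<omega> \<partial>bernoulli p)"
    and m: "(\<lambda>n. real (m n) / real n) \<longlonglongrightarrow> t" and v: "0 \<le> v"
  shows "(\<lambda>n. \<Sum>j<m n. ball_mass z (shift (int j) \<omega>) (v * r n)) \<longlonglongrightarrow> t * v"
proof (cases "v = 0")
  case True
  then show ?thesis by (simp add: ball_mass_def)
next
  case False
  with v have v: "0 < v" by simp
  let ?L = "\<integral>\<omega>. local_density z \<omega> \<partial>bernoulli p"
  have L: "0 < ?L" using local_density_mean_pos c0_pos by linarith
  let ?S = "\<lambda>n. \<Sum>j<m n. local_density z (shift (int j) \<omega>)"
  have S: "(\<lambda>n. ?S n / real n) \<longlonglongrightarrow> t * ?L" by (rule LIMSEQ_average_subsequence[OF \<omega> m])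
  have "(\<lambda>n. v * (real n * r n) * (?S n / real n)) \<longlonglongrightarrow> v * (1 / ?L) * (t * ?L)"
    by (intro tendsto_intros r_asymp S)
  then have A: "(\<lambda>n. v * (real n * r n) * (?S n / real n)) \<longlonglongrightarrow> t * v" using L by (simp add: mult_ac)
  have "(\<lambda>n. (\<Sum>j<m n. ball_mass z (shift (int j) \<omega>) (v * r n)) - v * (real n * r n) * (?S n / real n)) \<longlonglongrightarrow> 0"
  proof (rule LIMSEQ_I)
    fix e :: real assume e: "0 < e"
    have "Bseq (\<lambda>n. real (m n) / real n)" using m by (intro convergent_imp_Bseq convergentI)
    then obtain B where B: "0 < B" "\<And>n. \<bar>real (m n) / real n\<bar> \<le> B" unfolding Bseq_def by auto
    define \<epsilon> where "\<epsilon> = e / (2 * B)"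
    have \<epsilon>: "0 < \<epsilon>" "\<epsilon> * B = e / 2" using e B by (auto simp: \<epsilon>_def)
    have "\<forall>\<^sub>F n in sequentially. norm ((\<Sum>j<m n. ball_mass z (shift (int j) \<omega>) (v * r n)) - v * (real n * r n) * (?S n / real n) - 0) < e"
      using ball_mass_r_asymp[OF v \<epsilon>(1)] eventually_ge_at_top[of 1]
    proof eventually_elim
      case (elim n)
      have "(\<Sum>j<m n. ball_mass z (shift (int j) \<omega>) (v * r n)) - v * (real n * r n) * (?S n / real n)
         = (\<Sum>j<m n. ball_mass z (shift (int j) \<omega>) (v * r n) - local_density z (shift (int j) \<omega>) * (v * r n))"
      proof -
        have "v * (real n * r n) * (?S n / real n) = ?S n * (v * r n)" using elim(2) by simp
        then show ?thesis by (simp add: sum_subtractf sum_distrib_right)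
      qed
      also have "\<bar>\<dots>\<bar> \<le> (\<Sum>j<m n. \<epsilon> / real n)"
        using elim(1) by (intro order.trans[OF sum_abs] sum_mono) auto
      also have "\<dots> = \<epsilon> * (real (m n) / real n)" by simp
      also have "\<dots> \<le> \<epsilon> * B" using B(2)[of n] \<epsilon> by (intro mult_left_mono) auto
      finally show ?case using \<epsilon> e by simp
    qed
    then show "\<exists>no. \<forall>n\<ge>no. norm ((\<Sum>j<m n. ball_mass z (shift (int j) \<omega>) (v * r n)) - v * (real n * r n) * (?S n / real n) - 0) < e"
      by (simp add: eventually_sequentially)
  qed
  from tendsto_add[OF this A] show ?thesis by simp
qed

end

end

section \<open>Poisson limits from factorial moments\<close>

text \<open>Truncating the alternating sum leaves a single binomial coefficient of sign
  \<open>(- 1) ^ r\<close>; this is the source of the alternating bounds that follow.\<close>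

lemma alternating_choose_partial: "(\<Sum>i\<le>r. (- 1) ^ i * real (Suc D choose i)) = (- 1) ^ r * real (D choose r)"
  by (induction r) (auto simp: algebra_simps)

text \<open>From \<open>(k + i choose k) * (N choose (k + i)) = (N choose k) * (N - k choose
  i)\<close> the sum is a multiple of a truncated alternating sum over the subsets of an
  \<open>N - k\<close> element set.\<close>

lemma bonferroni:
  fixes N k r :: nat
  defines "S \<equiv> (\<Sum>i\<le>r. (- 1) ^ i * real ((k + i) choose k) * real (N choose (k + i)))"
  shows "even r \<Longrightarrow> of_bool (N = k) \<le> S" "odd r \<Longrightarrow> S \<le> of_bool (N = k)"
proof -
  have S: "S = real (N choose k) * (\<Sum>i\<le>r. (- 1) ^ i * real ((N - k) choose i))" if "k \<le> N"
  proof -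
    have "((k + i) choose k) * (N choose (k + i)) = (N choose k) * ((N - k) choose i)" for i
    proof (cases "k + i \<le> N")
      case True
      then show ?thesis using choose_mult[of k "k + i" N] by (simp add: mult.commute)
    next
      case False
      then have "N - k < i" using that by linarith
      then show ?thesis using False by (simp add: binomial_eq_0)
    qed
    then have "real ((k + i) choose k) * real (N choose (k + i)) = real (N choose k) * real ((N - k) choose i)" for i
      by (simp flip: of_nat_mult)
    then show ?thesis unfolding S_def sum_distrib_left
      by (intro sum.cong refl) (simp add: mult.assoc mult.left_commute)
  qed
  consider "N < k" | "N = k" | D where "N = k + Suc D" 
    by (metis less_imp_Suc_add linorder_neqE_nat add_Suc_right)
  then have "(even r \<longrightarrow> of_bool (N = k) \<le> S) \<and> (odd r \<longrightarrow> S \<le> of_bool (N = k))"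
  proof cases
    case 1
    then show ?thesis by (simp add: S_def binomial_eq_0)
  next
    case 2
    have "(\<Sum>i\<le>r. (- 1) ^ i * real (0 choose i)) = 1"
      by (induction r) auto
    then show ?thesis using S 2 by simp
  next
    case (3 D)
    then have "S = real (N choose k) * ((- 1) ^ r * real (D choose r))"
      using S by (simp add: alternating_choose_partial del: binomial_Suc_Suc)
    then show ?thesis using 3 by auto
  qed
  then show "even r \<Longrightarrow> of_bool (N = k) \<le> S" "odd r \<Longrightarrow> S \<le> of_bool (N = k)" by auto
qed

lemma poisson_series_partial:
  "(\<lambda>r. \<Sum>i\<le>r. (- 1) ^ i * real ((k + i) choose k) * (\<mu> ^ (k + i) / fact (k + i)))
     \<longlonglongrightarrow> \<mu> ^ k / fact k * exp (- \<mu> :: real)"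
proof -
  have "(- 1) ^ i * real ((k + i) choose k) * (\<mu> ^ (k + i) / fact (k + i)) = \<mu> ^ k / fact k * ((- \<mu>) ^ i /\<^sub>R fact i)" for i
  proof -
    have "real ((k + i) choose k) = fact (k + i) / (fact k * fact i)"
      by (subst binomial_fact) auto
    then show ?thesis by (simp add: power_add power_minus[of \<mu>] field_simps)
  qed
  moreover have "(\<lambda>r. \<Sum>i\<le>r. \<mu> ^ k / fact k * ((- \<mu>) ^ i /\<^sub>R fact i)) \<longlonglongrightarrow> \<mu> ^ k / fact k * exp (- \<mu>)"
    using sums_mult[OF exp_converges[of "- \<mu>"], of "\<mu> ^ k / fact k"] unfolding sums_def_le .
  ultimately show ?thesis by simp
qed

text \<open>Truncations at an even and at the next odd level bracket the probability. The levels are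
  fixed first, far enough out in the exponential series, and only then \<open>n\<close> grows, so
  convergence of finitely many moments is used at a time. The bounds \<open>b n\<close> ensure
  integrability and need not be uniform.\<close>

lemma factorial_moments_imp_poisson:
  fixes M :: "nat \<Rightarrow> 'a measure" and X :: "nat \<Rightarrow> 'a \<Rightarrow> nat"
  assumes P: "\<And>n. prob_space (M n)" and X: "\<And>n. X n \<in> measurable (M n) (count_space UNIV)"
    and bdd: "\<And>n x. X n x \<le> b n"
    and lim: "\<And>k. (\<lambda>n. \<integral>x. real (X n x choose k) \<partial>M n) \<longlonglongrightarrow> \<mu> ^ k / fact k"
  shows "(\<lambda>n. measure (M n) {x \<in> space (M n). X n x = k}) \<longlonglongrightarrow> \<mu> ^ k / fact k * exp (- \<mu>)"
proof -
  let ?L = "\<mu> ^ k / fact k * exp (- \<mu>)"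
  define p where "p = (\<lambda>n. measure (M n) {x \<in> space (M n). X n x = k})"
  define A where "A = (\<lambda>r n. \<Sum>i\<le>r. (- 1) ^ i * real ((k + i) choose k) * (\<integral>x. real (X n x choose (k + i)) \<partial>M n))"
  define a where "a = (\<lambda>r. \<Sum>i\<le>r. (- 1) ^ i * real ((k + i) choose k) * (\<mu> ^ (k + i) / fact (k + i)))"
  have Aa: "A r \<longlonglongrightarrow> a r" for r
    unfolding A_def a_def by (intro tendsto_intros lim)
  have aL: "a \<longlonglongrightarrow> ?L" unfolding a_def by (rule poisson_series_partial)
  have cm: "integrable (M n) (\<lambda>x. real (X n x choose j))" for n j
  proof -
    interpret prob_space "M n" by (rule P)
    show ?thesis
    proof (rule integrable_const_bound)
      have "X n x choose j \<le> b n choose j" for x by (rule binomial_right_mono[OF bdd])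
      then show "AE x in M n. norm (real (X n x choose j)) \<le> real (b n choose j)" by simp
      show "(\<lambda>x. real (X n x choose j)) \<in> borel_measurable (M n)"
        using measurable_compose[OF X, of "\<lambda>i. real (i choose j)" borel] by simp
    qed
  qed
  have S: "A r n = (\<integral>x. (\<Sum>i\<le>r. (- 1) ^ i * real ((k + i) choose k) * real (X n x choose (k + i))) \<partial>M n)" for r n
    unfolding A_def using cm by (subst Bochner_Integration.integral_sum) auto
  have ms: "{x \<in> space (M n). X n x = k} \<in> sets (M n)" for n
    using measurable_sets[OF X, of "{k}" n] by (simp add: vimage_def Int_def conj_commute)
  have p: "p n = (\<integral>x. of_bool (X n x = k) \<partial>M n)" for n
  proof -
    interpret prob_space "M n" by (rule P)
    have "p n = (\<integral>x. indicator {x \<in> space (M n). X n x = k} x \<partial>M n)"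
      using ms by (simp add: p_def Int_absorb2)
    also have "\<dots> = (\<integral>x. of_bool (X n x = k) \<partial>M n)"
      by (rule Bochner_Integration.integral_cong) (auto simp: indicator_def)
    finally show ?thesis .
  qed
  have bi: "integrable (M n) (\<lambda>x. of_bool (X n x = k) :: real)" for n
  proof -
    interpret prob_space "M n" by (rule P)
    show ?thesis
    proof (rule integrable_const_bound[of _ 1])
      show "(\<lambda>x. of_bool (X n x = k) :: real) \<in> borel_measurable (M n)"
        using measurable_compose[OF X, of "\<lambda>i. of_bool (i = k)" borel] by simp
    qed auto
  qed
  have up: "p n \<le> A (2 * r) n" for n r
    unfolding p S using cm bi bonferroni(1)[of "2 * r" _ k] by (intro integral_mono) auto
  have low: "A (Suc (2 * r)) n \<le> p n" for n r
    unfolding p S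
  proof (rule integral_mono)
    show "integrable (M n) (\<lambda>x. \<Sum>i\<le>Suc (2 * r). (- 1) ^ i * real ((k + i) choose k) * real (X n x choose (k + i)))"
      using cm by (intro Bochner_Integration.integrable_sum) auto
  qed (rule bi, rule bonferroni(2), simp)
  show ?thesis
    unfolding p_def[symmetric]
  proof (rule LIMSEQ_I)
    fix e :: real assume "0 < e"
    then have "0 < e / 2" by simp
    obtain R where R: "\<And>r. R \<le> r \<Longrightarrow> \<bar>a r - ?L\<bar> < e / 2"
      using LIMSEQ_D[OF aL \<open>0 < e / 2\<close>] by auto
    obtain N where N: "\<And>n. N \<le> n \<Longrightarrow> \<bar>A (2 * R) n - a (2 * R)\<bar> < e / 2"
      using LIMSEQ_D[OF Aa[of "2 * R"] \<open>0 < e / 2\<close>] by auto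
    obtain N' where N': "\<And>n. N' \<le> n \<Longrightarrow> \<bar>A (Suc (2 * R)) n - a (Suc (2 * R))\<bar> < e / 2"
      using LIMSEQ_D[OF Aa[of "Suc (2 * R)"] \<open>0 < e / 2\<close>] by auto
    show "\<exists>no. \<forall>n\<ge>no. norm (p n - ?L) < e"
    proof (intro exI[of _ "max N N'"] allI impI)
      fix n assume "max N N' \<le> n"
      then have n: "N \<le> n" "N' \<le> n" by auto
      have "R \<le> 2 * R" "R \<le> Suc (2 * R)" by auto
      note N[OF n(1)] N'[OF n(2)] R[OF this(1)] R[OF this(2)]
      then show "norm (p n - ?L) < e"
        using up[of n R] low[of R n] unfolding real_norm_def by linarith
    qed
  qed
qed

section \<open>A Riemann sum estimate for powers\<close>

lemma power_diff_bounds: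
  fixes x y :: real
  assumes "0 \<le> x" "x \<le> y"
  shows "real (Suc k) * (y - x) * x ^ k \<le> y ^ Suc k - x ^ Suc k"
    "y ^ Suc k - x ^ Suc k \<le> real (Suc k) * (y - x) * y ^ k"
proof -
  have eq: "y ^ Suc k - x ^ Suc k = (y - x) * (\<Sum>p<Suc k. y ^ p * x ^ (k - p))"
    using diff_power_eq_sum[of y k x] .
  have t: "x ^ k \<le> y ^ p * x ^ (k - p)" "y ^ p * x ^ (k - p) \<le> y ^ k" if "p < Suc k" for p
  proof -
    have k: "k = p + (k - p)" using that by simp
    have "x ^ p * x ^ (k - p) \<le> y ^ p * x ^ (k - p)" using assms by (intro mult_right_mono power_mono) auto
    then show "x ^ k \<le> y ^ p * x ^ (k - p)" using k by (metis power_add)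
    have "y ^ p * x ^ (k - p) \<le> y ^ p * y ^ (k - p)" using assms by (intro mult_left_mono power_mono) auto
    then show "y ^ p * x ^ (k - p) \<le> y ^ k" using k by (metis power_add)
  qed
  have "(\<Sum>p<Suc k. x ^ k) \<le> (\<Sum>p<Suc k. y ^ p * x ^ (k - p))" by (intro sum_mono t) auto
  then have "(y - x) * (real (Suc k) * x ^ k) \<le> (y - x) * (\<Sum>p<Suc k. y ^ p * x ^ (k - p))"
    using assms by (intro mult_left_mono) auto
  then show "real (Suc k) * (y - x) * x ^ k \<le> y ^ Suc k - x ^ Suc k" unfolding eq by (simp only: mult_ac)
  have "(\<Sum>p<Suc k. y ^ p * x ^ (k - p)) \<le> (\<Sum>p<Suc k. y ^ k)" by (intro sum_mono t) auto
  then have "(y - x) * (\<Sum>p<Suc k. y ^ p * x ^ (k - p)) \<le> (y - x) * (real (Suc k) * y ^ k)"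
    using assms by (intro mult_left_mono) auto
  then show "y ^ Suc k - x ^ Suc k \<le> real (Suc k) * (y - x) * y ^ k" unfolding eq by (simp only: mult_ac)
qed

text \<open>A Riemann sum for the integral of \<open>S ^ k / fact k\<close> with respect to
  \<open>S\<close>. Each increment of \<open>S ^ Suc k / fact (Suc k)\<close> lies between the left
  and the right summand; their difference is at most \<open>d\<close> times the increment of
  \<open>S ^ k / fact k\<close>, and these increments telescope.\<close>

lemma power_sum_error:
  fixes a :: "nat \<Rightarrow> real"
  assumes a: "\<And>i. i < j \<Longrightarrow> 0 \<le> a i \<and> a i \<le> d" and d: "0 \<le> d"
  defines "S \<equiv> \<lambda>i. \<Sum>l<i. a l"
  shows "\<bar>(\<Sum>i<j. a i * (S i ^ k / fact k)) - S j ^ Suc k / fact (Suc k)\<bar> \<le> d * S j ^ k / fact k"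
proof -
  let ?D = "\<lambda>i. S (Suc i) ^ Suc k / fact (Suc k) - S i ^ Suc k / fact (Suc k)"
  have f: "(fact (Suc k) :: real) = real (Suc k) * fact k" by simp
  have step: "S (Suc i) = S i + a i" for i by (simp add: S_def)
  have S0: "0 \<le> S i" if "i \<le> j" for i using a that unfolding S_def by (intro sum_nonneg) auto
  have eq: "(\<Sum>i<j. a i * (S i ^ k / fact k)) - S j ^ Suc k / fact (Suc k) = (\<Sum>i<j. a i * (S i ^ k / fact k) - ?D i)"
  proof -
    have 1: "(\<Sum>i<j. a i * (S i ^ k / fact k) - ?D i) = (\<Sum>i<j. a i * (S i ^ k / fact k)) - (\<Sum>i<j. ?D i)"
      by (rule sum_subtractf)
    have 2: "(\<Sum>i<j. ?D i) = S j ^ Suc k / fact (Suc k) - S 0 ^ Suc k / fact (Suc k)"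
      by (rule sum_lessThan_telescope)
    have 3: "S 0 ^ Suc k / fact (Suc k) = 0" by (simp add: S_def)
    show ?thesis unfolding 1 2 3 by (simp only: diff_zero)
  qed
  have "\<bar>(\<Sum>i<j. a i * (S i ^ k / fact k)) - S j ^ Suc k / fact (Suc k)\<bar> \<le> (\<Sum>i<j. \<bar>a i * (S i ^ k / fact k) - ?D i\<bar>)"
    unfolding eq by (rule sum_abs)
  also have "\<dots> \<le> (\<Sum>i<j. d * (S (Suc i) ^ k - S i ^ k) / fact k)"
  proof (rule sum_mono)
    fix i assume "i \<in> {..<j}"
    then have i: "i < j" by simp
    have ord: "0 \<le> S i" "S i \<le> S (Suc i)" using S0[of i] a[OF i] i by (auto simp: step)
    have ai: "S (Suc i) - S i = a i" by (simp add: step)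
    have D: "?D i = (S (Suc i) ^ Suc k - S i ^ Suc k) / (real (Suc k) * fact k)"
      unfolding f by (rule diff_divide_distrib[symmetric])
    have "a i * (S i ^ k / fact k) = (real (Suc k) * (S (Suc i) - S i) * S i ^ k) / (real (Suc k) * fact k)"
      unfolding ai by (simp del: of_nat_Suc)
    also have "\<dots> \<le> ?D i"
      unfolding D by (intro divide_right_mono power_diff_bounds(1) ord) auto
    finally have 1: "a i * (S i ^ k / fact k) \<le> ?D i" .
    have "?D i \<le> (real (Suc k) * (S (Suc i) - S i) * S (Suc i) ^ k) / (real (Suc k) * fact k)"
      unfolding D by (intro divide_right_mono power_diff_bounds(2) ord) auto
    also have "\<dots> = a i * (S (Suc i) ^ k / fact k)"
      unfolding ai by (simp del: of_nat_Suc)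
    finally have "?D i - a i * (S i ^ k / fact k) \<le> a i * ((S (Suc i) ^ k - S i ^ k) / fact k)"
      unfolding right_diff_distrib diff_divide_distrib by linarith
    also have "\<dots> \<le> d * ((S (Suc i) ^ k - S i ^ k) / fact k)"
      using a[OF i] power_mono[OF ord(2,1), of k] by (intro mult_right_mono) auto
    finally show "\<bar>a i * (S i ^ k / fact k) - ?D i\<bar> \<le> d * (S (Suc i) ^ k - S i ^ k) / fact k"
      using 1 by simp
  qed
  also have "\<dots> = d * (S j ^ k - S 0 ^ k) / fact k"
  proof -
    have "(\<Sum>i<j. S (Suc i) ^ k - S i ^ k) = S j ^ k - S 0 ^ k" by (rule sum_lessThan_telescope)
    then show ?thesis by (simp only: sum_divide_distrib[symmetric] sum_distrib_left[symmetric])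
  qed
  also have "\<dots> \<le> d * S j ^ k / fact k"
    using d by (intro divide_right_mono mult_left_mono) (auto simp: S_def)
  finally show ?thesis .
qed

context random_expanding
begin

section \<open>Hit counts and densities weighted by earlier hits\<close>

definition hits :: "(nat \<Rightarrow> real set) \<Rightarrow> (int \<Rightarrow> 'q) \<Rightarrow> nat \<Rightarrow> real \<Rightarrow> nat" where
  "hits E \<omega> j x = card {i. i < j \<and> rmap T i \<omega> x \<in> E i}"

lemma hits_Suc: "hits E \<omega> (Suc j) x = hits E \<omega> j x + (if rmap T j \<omega> x \<in> E j then 1 else 0)"
proof -
  have "{i. i < Suc j \<and> rmap T i \<omega> x \<in> E i} =
     (if rmap T j \<omega> x \<in> E j then insert j {i. i < j \<and> rmap T i \<omega> x \<in> E i} else {i. i < j \<and> rmap T i \<omega> x \<in> E i})"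
    by (auto simp: less_Suc_eq)
  then show ?thesis by (simp add: hits_def)
qed

lemma hits_0 [simp]: "hits E \<omega> 0 x = 0"
  by (simp add: hits_def)

lemma hits_le: "hits E \<omega> j x \<le> j"
  by (induction j) (auto simp: hits_Suc)

text \<open>The sets of \<open>Suc k\<close> hits are sorted by their last element
  \<open>i\<close>.\<close>

lemma hits_choose_Suc:
  "real (hits E \<omega> j x choose Suc k) = (\<Sum>i<j. indicator (E i) (rmap T i \<omega> x) * real (hits E \<omega> i x choose k))"
  by (induction j) (auto simp: hits_Suc)

lemma hits_measurable:
  assumes "\<And>i. E i \<in> sets borel"
  shows "hits E \<omega> j \<in> measurable unit_leb (count_space UNIV)"
proof (induction j)
  case 0
  then show ?case by simp
next
  case (Suc j)
  have "{x \<in> space unit_leb. rmap T j \<omega> x \<in> E j} = rmap T j \<omega> -` (E j \<inter> {0..1}) \<inter> space unit_leb"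
    using rmap_in_unit by auto
  also have "\<dots> \<in> sets unit_leb"
    by (rule measurable_sets[OF rmap_measurable]) (rule sets_unit_leb_I[OF assms])
  finally have [measurable]: "Measurable.pred unit_leb (\<lambda>x. rmap T j \<omega> x \<in> E j)"
    by (simp add: pred_def)
  note Suc [measurable]
  show ?case unfolding hits_Suc by measurable
qed

lemma ess_bounded_hits_choose:
  assumes "\<And>i. E i \<in> sets borel"
  shows "ess_bounded (\<lambda>x. real (hits E \<omega> j x choose k))"
proof (rule ess_boundedI)
  show "(\<lambda>x. real (hits E \<omega> j x choose k)) \<in> borel_measurable unit_leb"
    using measurable_compose[OF hits_measurable[OF assms], of "\<lambda>i. real (i choose k)" borel] by simp
  show "\<bar>real (hits E \<omega> j x choose k)\<bar> \<le> real (j choose k)" for x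
    using binomial_right_mono[OF hits_le] by simp
qed

text \<open>The density at time \<open>j\<close> weighted by the number of \<open>k\<close>-element sets of earlier hits.\<close>

primrec hit_density :: "(nat \<Rightarrow> real set) \<Rightarrow> (int \<Rightarrow> 'q) \<Rightarrow> nat \<Rightarrow> nat \<Rightarrow> real \<Rightarrow> real" where
  "hit_density E \<omega> 0 = (\<lambda>j. h (shift (int j) \<omega>))"
| "hit_density E \<omega> (Suc k) = (\<lambda>j x. \<Sum>i<j. rtransfer T (j - i) (shift (int i) \<omega>)
      (\<lambda>y. indicator (E i) y * hit_density E \<omega> k i y) x)"

lemma hit_density_integrable:
  assumes "\<And>i. E i \<in> sets borel"
  shows "integrable unit_leb (hit_density E \<omega> k j)"
proof (induction k arbitrary: j)
  case 0
  then show ?case by (simp add: h_integrable)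
next
  case (Suc k)
  then show ?case
    by (auto intro!: Bochner_Integration.integrable_sum rtransfer_integrable integrable_indicator_mult assms)
qed

text \<open>Duality moves \<open>\<phi>\<close> back across the steps from the last hit
  \<open>i\<close> to \<open>j\<close>. The induction hypothesis is then applied at time
  \<open>i\<close> to \<open>\<phi>\<close> composed with these steps and cut off to
  \<open>E i\<close>, which is why the statement is made for every bounded
  \<open>\<phi>\<close>.\<close>

lemma hit_density_duality:
  assumes E: "\<And>i. E i \<in> sets borel" and \<phi>: "ess_bounded \<phi>"
  shows "(\<integral>x. \<phi> x * hit_density E \<omega> k j x \<partial>unit_leb)
     = (\<integral>x. \<phi> (rmap T j \<omega> x) * real (hits E \<omega> j x choose k) * h \<omega> x \<partial>unit_leb)"
  using \<phi>
proof (induction k arbitrary: j \<phi>)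
  case 0
  have "(\<integral>x. \<phi> x * hit_density E \<omega> 0 j x \<partial>unit_leb) = (\<integral>x. \<phi> x * rtransfer T j \<omega> (h \<omega>) x \<partial>unit_leb)"
  proof (rule integral_cong_AE)
    show "AE x in unit_leb. \<phi> x * hit_density E \<omega> 0 j x = \<phi> x * rtransfer T j \<omega> (h \<omega>) x"
      using h_invariant[of j \<omega>] by eventually_elim simp
  qed (use 0 ess_bounded_integrable[OF 0] rtransfer_integrable[OF h_integrable] h_integrable
       in \<open>auto intro!: borel_measurable_integrable\<close>)
  then show ?case using rtransfer_duality[OF h_integrable 0, of j \<omega> \<omega>] by simp
next
  case (Suc k)
  let ?u = "\<lambda>i x. indicator (E i) x * hit_density E \<omega> k i x"
  let ?\<omega> = "\<lambda>i. shift (int i) \<omega>"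
  have u: "integrable unit_leb (?u i)" for i
    by (rule integrable_indicator_mult[OF E hit_density_integrable[OF E]])
  have b: "ess_bounded (\<lambda>x. \<phi> (rmap T (j - i) (?\<omega> i) x) * indicator (E i) x)" for i
    by (intro ess_bounded_mult ess_bounded_rmap Suc.prems ess_bounded_indicator E)
  have step: "(\<integral>x. \<phi> x * rtransfer T (j - i) (?\<omega> i) (?u i) x \<partial>unit_leb) =
     (\<integral>x. \<phi> (rmap T j \<omega> x) * (indicator (E i) (rmap T i \<omega> x) * real (hits E \<omega> i x choose k)) * h \<omega> x \<partial>unit_leb)"
    if "i < j" for i
  proof -
    have rm: "rmap T (j - i) (?\<omega> i) (rmap T i \<omega> x) = rmap T j \<omega> x" for x
      using rmap_add[of T i "j - i" \<omega>] that by simp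
    have "(\<integral>x. \<phi> x * rtransfer T (j - i) (?\<omega> i) (?u i) x \<partial>unit_leb) = (\<integral>x. \<phi> (rmap T (j - i) (?\<omega> i) x) * indicator (E i) x * hit_density E \<omega> k i x \<partial>unit_leb)"
      using rtransfer_duality[OF u Suc.prems] by (simp add: mult.assoc)
    also have "\<dots> = (\<integral>x. \<phi> (rmap T (j - i) (?\<omega> i) (rmap T i \<omega> x)) * indicator (E i) (rmap T i \<omega> x) * real (hits E \<omega> i x choose k) * h \<omega> x \<partial>unit_leb)"
      using Suc.IH[OF b, of i i] .
    finally show ?thesis by (simp add: rm mult.assoc)
  qed
  have int: "integrable unit_leb (\<lambda>x. \<phi> (rmap T j \<omega> x) * (indicator (E i) (rmap T i \<omega> x) * real (hits E \<omega> i x choose k)) * h \<omega> x)" for i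
    by (intro ess_bounded_integrable h_integrable ess_bounded_mult ess_bounded_rmap[OF Suc.prems]
        ess_bounded_rmap[OF ess_bounded_indicator[OF E]] ess_bounded_hits_choose E)
  have "(\<integral>x. \<phi> x * hit_density E \<omega> (Suc k) j x \<partial>unit_leb) = (\<Sum>i<j. \<integral>x. \<phi> x * rtransfer T (j - i) (?\<omega> i) (?u i) x \<partial>unit_leb)"
    using ess_bounded_integrable[OF Suc.prems rtransfer_integrable[OF u]]
    by (simp add: sum_distrib_left)
  also have "\<dots> = (\<Sum>i<j. \<integral>x. \<phi> (rmap T j \<omega> x) * (indicator (E i) (rmap T i \<omega> x) * real (hits E \<omega> i x choose k)) * h \<omega> x \<partial>unit_leb)"
    by (rule sum.cong) (auto simp: step)
  also have "\<dots> = (\<integral>x. (\<Sum>i<j. \<phi> (rmap T j \<omega> x) * (indicator (E i) (rmap T i \<omega> x) * real (hits E \<omega> i x choose k)) * h \<omega> x) \<partial>unit_leb)"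
    using int by (rule Bochner_Integration.integral_sum[symmetric])
  also have "\<dots> = (\<integral>x. \<phi> (rmap T j \<omega> x) * real (hits E \<omega> j x choose Suc k) * h \<omega> x \<partial>unit_leb)"
    unfolding hits_choose_Suc sum_distrib_left sum_distrib_right ..
  finally show ?case .
qed

lemma hit_density_moment:
  assumes E: "\<And>i. E i \<in> sets borel"
  shows "(\<integral>x. hit_density E \<omega> k j x \<partial>unit_leb) = (\<integral>x. real (hits E \<omega> j x choose k) \<partial>sample_measure T \<omega>)"
  using hit_density_duality[OF E ess_bounded_const[of 1], where k = k and j = j and \<omega> = \<omega>]
    ess_bounded_hits_choose[OF E, where \<omega> = \<omega> and j = j and k = k]
  by (simp add: integral_sample_measure ess_bounded_def)

lemma geometric_gap_sum:
  "(\<Sum>i<j. \<theta> ^ (j - i)) \<le> 1 / (1 - \<theta>)"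
  "(\<Sum>i | i < j \<and> q \<le> j - i. \<theta> ^ (j - i)) \<le> \<theta> ^ q / (1 - \<theta>)"
proof -
  have *: "(\<Sum>i | i < j \<and> q \<le> j - i. \<theta> ^ (j - i)) \<le> \<theta> ^ q / (1 - \<theta>)" for q
  proof -
    have "(\<Sum>i | i < j \<and> q \<le> j - i. \<theta> ^ (j - i)) = (\<Sum>l | 1 \<le> l \<and> l \<le> j \<and> q \<le> l. \<theta> ^ l)"
      by (rule sum.reindex_bij_witness[of _ "\<lambda>l. j - l" "\<lambda>i. j - i"]) auto
    also have "\<dots> \<le> (\<Sum>l\<in>(\<lambda>i. i + q) ` {..j}. \<theta> ^ l)"
    proof (rule sum_mono2)
      show "{l. 1 \<le> l \<and> l \<le> j \<and> q \<le> l} \<subseteq> (\<lambda>i. i + q) ` {..j}"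
      proof
        fix l assume "l \<in> {l. 1 \<le> l \<and> l \<le> j \<and> q \<le> l}"
        then show "l \<in> (\<lambda>i. i + q) ` {..j}" by (intro image_eqI[of _ _ "l - q"]) auto
      qed
    qed (use \<theta> in auto)
    also have "\<dots> = \<theta> ^ q * (\<Sum>i\<le>j. \<theta> ^ i)"
      by (subst sum.reindex) (auto simp: inj_on_def power_add sum_distrib_left mult.commute)
    also have "\<dots> \<le> \<theta> ^ q * (1 / (1 - \<theta>))"
    proof (intro mult_left_mono)
      have "(\<lambda>n. \<theta> ^ n) sums (1 / (1 - \<theta>))" using \<theta> by (intro geometric_sums) auto
      then show "(\<Sum>i\<le>j. \<theta> ^ i) \<le> 1 / (1 - \<theta>)"
        using \<theta> sum_le_suminf[of "\<lambda>n. \<theta> ^ n" "{..j}"] by (simp add: sums_iff)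
    qed (use \<theta> in auto)
    finally show ?thesis by simp
  qed
  show "(\<Sum>i<j. \<theta> ^ (j - i)) \<le> 1 / (1 - \<theta>)" using *[of 0] by (simp add: lessThan_def)
  show "(\<Sum>i | i < j \<and> q \<le> j - i. \<theta> ^ (j - i)) \<le> \<theta> ^ q / (1 - \<theta>)" by (rule *)
qed

lemma integral_indicator_BV:
  assumes "E \<in> sets borel" "BV_le f c"
  shows "\<bar>\<integral>x. indicator E x * f x \<partial>unit_leb\<bar> \<le> c * (\<integral>x. indicator E x \<partial>unit_leb)"
proof -
  have i: "integrable unit_leb (\<lambda>x. indicator E x :: real)"
    using integrable_indicator_mult[OF assms(1), of "\<lambda>_. 1"] by simp
  have j: "integrable unit_leb (\<lambda>x. indicator E x * f x)"
    by (rule integrable_indicator_mult[OF assms(1) BV_le_integrable[OF assms(2)]])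
  have "\<bar>\<integral>x. indicator E x * f x \<partial>unit_leb\<bar> \<le> (\<integral>x. \<bar>indicator E x * f x\<bar> \<partial>unit_leb)"
    by (rule integral_abs_bound)
  also have "\<dots> \<le> (\<integral>x. c * indicator E x \<partial>unit_leb)"
  proof (rule integral_mono_AE)
    show "AE x in unit_leb. \<bar>indicator E x * f x\<bar> \<le> c * indicator E x"
      using BV_le_AE_abs_le[OF assms(2)] by eventually_elim (auto simp: indicator_def)
  qed (use i j in auto)
  finally show ?thesis by simp
qed

section \<open>Uniform bounds and decorrelation for given targets\<close>

context
  fixes E :: "nat \<Rightarrow> real set" and \<omega> :: "int \<Rightarrow> 'q" and m :: nat and s \<Lambda> Q :: real
  assumes E: "\<And>i. E i \<in> sets borel"
    and s: "\<And>i. i < m \<Longrightarrow> (\<integral>x. indicator (E i) x \<partial>unit_leb) \<le> s" "0 \<le> s"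
    and \<Lambda>: "\<And>i f c. BV_le f c \<Longrightarrow> BV_le (\<lambda>x. indicator (E i) x * f x) (\<Lambda> * c)" "0 \<le> \<Lambda>"
    and Q: "real m * s * H + C' * \<Lambda> / (1 - \<theta>) \<le> Q" "1 \<le> Q"
begin

lemma indicator_integral_le:
  assumes "i < m" "BV_le f c"
  shows "\<bar>\<integral>x. indicator (E i) x * f x \<partial>unit_leb\<bar> \<le> c * s"
  using integral_indicator_BV[OF E assms(2), of i] mult_left_mono[OF s(1)[OF assms(1)] BV_le_nonneg[OF assms(2)]]
  by linarith

text \<open>After a hit at time \<open>i\<close> the density is its mass times the sample density
  plus a remainder that is geometrically small in the gap \<open>j - i\<close>. Summed over
  \<open>i\<close> these parts cost the factors \<open>m * s * H\<close> and
  \<open>C' * \<Lambda> / (1 - \<theta>)\<close>, so each further hit multiplies the bound by at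
  most \<open>Q\<close>.\<close>

lemma hit_density_BV: "j \<le> m \<Longrightarrow> BV_le (hit_density E \<omega> k j) (H * Q ^ k)"
proof (induction k arbitrary: j)
  case 0
  then show ?case by (simp add: sample_density_limit)
next
  case (Suc k)
  let ?B = "H * Q ^ k"
  let ?u = "\<lambda>i x. indicator (E i) x * hit_density E \<omega> k i x"
  have B: "0 \<le> ?B" using const_nonneg Q by simp
  have summand: "BV_le (rtransfer T (j - i) (shift (int i) \<omega>) (?u i)) (C' * \<theta> ^ (j - i) * (\<Lambda> * ?B) + ?B * s * H)" if "i < j" for i
  proof -
    have im: "i < m" using that Suc.prems by simp
    have f: "BV_le (hit_density E \<omega> k i) ?B" using Suc.IH[of i] im by simp
    let ?I = "\<integral>x. ?u i x \<partial>unit_leb"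
    have I: "\<bar>?I\<bar> \<le> ?B * s" by (rule indicator_integral_le[OF im f])
    have 1: "BV_le (\<lambda>x. rtransfer T (j - i) (shift (int i) \<omega>) (?u i) x - ?I * h (shift (int (j - i)) (shift (int i) \<omega>)) x) (C' * \<theta> ^ (j - i) * (\<Lambda> * ?B))"
      by (rule decay[OF \<Lambda>(1)[OF f]])
    have 2: "BV_le (\<lambda>x. ?I * h (shift (int (j - i)) (shift (int i) \<omega>)) x) (\<bar>?I\<bar> * H)"
      by (rule BV_le_cmult[OF sample_density_limit(1)])
    have "BV_le (rtransfer T (j - i) (shift (int i) \<omega>) (?u i)) (C' * \<theta> ^ (j - i) * (\<Lambda> * ?B) + \<bar>?I\<bar> * H)"
      using BV_le_add[OF 1 2] by simp
    then show ?thesis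
      by (rule BV_le_mono) (use mult_right_mono[OF I, of H] const_nonneg in simp)
  qed
  have "BV_le (hit_density E \<omega> (Suc k) j) (\<Sum>i<j. C' * \<theta> ^ (j - i) * (\<Lambda> * ?B) + ?B * s * H)"
    unfolding hit_density.simps by (rule BV_le_sum) (auto intro: summand)
  then show ?case
  proof (rule BV_le_mono)
    have "(\<Sum>i<j. C' * \<theta> ^ (j - i) * (\<Lambda> * ?B) + ?B * s * H)
        = C' * \<Lambda> * ?B * (\<Sum>i<j. \<theta> ^ (j - i)) + real j * (?B * s * H)"
      by (simp add: sum.distrib sum_distrib_left sum_distrib_right mult_ac)
    also have "\<dots> \<le> C' * \<Lambda> * ?B * (1 / (1 - \<theta>)) + real m * (?B * s * H)"
      using const_nonneg \<Lambda>(2) B s(2) Q(2) Suc.prems geometric_gap_sum(1)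
      by (intro add_mono mult_left_mono mult_right_mono mult_nonneg_nonneg) auto
    also have "\<dots> = ?B * (real m * s * H + C' * \<Lambda> / (1 - \<theta>))" by (simp add: distrib_left mult_ac)
    also have "\<dots> \<le> ?B * Q" using B Q(1) by (intro mult_left_mono) auto
    finally show "(\<Sum>i<j. C' * \<theta> ^ (j - i) * (\<Lambda> * ?B) + ?B * s * H) \<le> H * Q ^ Suc k" by (simp add: mult_ac)
  qed
qed

text \<open>Terms with a gap below \<open>q\<close> vanish on \<open>E j\<close> by the absence of short returns; the other ones
  have relaxed to multiples of the sample density.\<close>

lemma hit_density_decorrelation:
  assumes ret: "\<And>i j x. \<lbrakk>i < j; j < m; j - i < q; x \<in> {0..1}; x \<in> E i\<rbrakk> \<Longrightarrow> rmap T (j - i) (shift (int i) \<omega>) x \<notin> E j"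
    and j: "j < m"
  shows "\<bar>(\<integral>x. indicator (E j) x * hit_density E \<omega> k j x \<partial>unit_leb)
     - (\<integral>x. indicator (E j) x * h (shift (int j) \<omega>) x \<partial>unit_leb) * (\<integral>x. hit_density E \<omega> k j x \<partial>unit_leb)\<bar>
     \<le> s * (H * Q ^ k) * (C' * \<Lambda> * \<theta> ^ q / (1 - \<theta>) + real q * s * H)"
proof (cases k)
  \<comment> \<open>Here the weighted density is the sample density, of integral 1, and the
    difference vanishes.\<close>
  case 0
  then show ?thesis
    using const_nonneg \<Lambda>(2) s(2) Q \<theta> by (simp add: h_integral)
next
  case (Suc k')
  let ?B = "H * Q ^ k'"
  let ?a = "\<integral>x. indicator (E j) x * h (shift (int j) \<omega>) x \<partial>unit_leb"
  let ?u = "\<lambda>i x. indicator (E i) x * hit_density E \<omega> k' i x"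
  let ?P = "\<lambda>i. rtransfer T (j - i) (shift (int i) \<omega>) (?u i)"
  let ?I = "\<lambda>i. \<integral>x. ?u i x \<partial>unit_leb"
  have B: "0 \<le> ?B" using const_nonneg Q by simp
  have u: "integrable unit_leb (?u i)" for i
    by (rule integrable_indicator_mult[OF E hit_density_integrable[OF E]])
  have P: "integrable unit_leb (?P i)" for i by (rule rtransfer_integrable[OF u])
  have EP: "integrable unit_leb (\<lambda>x. indicator (E j) x * ?P i x)" for i
    by (rule integrable_indicator_mult[OF E P])
  have split: "(\<integral>x. indicator (E j) x * hit_density E \<omega> k j x \<partial>unit_leb) - ?a * (\<integral>x. hit_density E \<omega> k j x \<partial>unit_leb)
     = (\<Sum>i<j. (\<integral>x. indicator (E j) x * ?P i x \<partial>unit_leb) - ?a * ?I i)"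
  proof -
    have "(\<integral>x. indicator (E j) x * hit_density E \<omega> k j x \<partial>unit_leb) = (\<Sum>i<j. \<integral>x. indicator (E j) x * ?P i x \<partial>unit_leb)"
      unfolding Suc hit_density.simps sum_distrib_left by (rule Bochner_Integration.integral_sum[OF EP])
    moreover have "(\<integral>x. hit_density E \<omega> k j x \<partial>unit_leb) = (\<Sum>i<j. ?I i)"
      unfolding Suc hit_density.simps using P rtransfer_integral[OF u] by simp
    ultimately show ?thesis by (simp add: sum_distrib_left sum_subtractf)
  qed
  have a: "\<bar>?a\<bar> \<le> H * s" by (rule indicator_integral_le[OF j sample_density_limit(1)])
  \<comment> \<open>No orbit hits both targets, so only the product of the two masses remains, which
    is of second order in \<open>s\<close>.\<close>
  have near: "\<bar>(\<integral>x. indicator (E j) x * ?P i x \<partial>unit_leb) - ?a * ?I i\<bar> \<le> (H * s) * (?B * s)"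
    if i: "i < j" "j - i < q" for i
  proof -
    have "(\<integral>x. indicator (E j) x * ?P i x \<partial>unit_leb) = (\<integral>x. indicator (E j) (rmap T (j - i) (shift (int i) \<omega>) x) * ?u i x \<partial>unit_leb)"
      by (rule rtransfer_duality[OF u ess_bounded_indicator[OF E]])
    also have "\<dots> = (\<integral>x. 0 \<partial>unit_leb)"
      using ret[OF i(1) j i(2)] by (intro Bochner_Integration.integral_cong) (auto simp: indicator_def)
    finally have "(\<integral>x. indicator (E j) x * ?P i x \<partial>unit_leb) = 0" by simp
    moreover have "\<bar>?I i\<bar> \<le> ?B * s"
      using i j by (intro indicator_integral_le hit_density_BV) auto
    ultimately show ?thesis
      using a const_nonneg s(2) by (simp add: abs_mult mult_mono)
  qed
  \<comment> \<open>The multiple of the sample density cancels exactly. The remainder is bounded in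
    supremum by its BV bound, whence the additional factor \<open>s\<close> from integration over
    \<open>E j\<close>.\<close>
  have far: "\<bar>(\<integral>x. indicator (E j) x * ?P i x \<partial>unit_leb) - ?a * ?I i\<bar> \<le> C' * \<theta> ^ (j - i) * (\<Lambda> * ?B) * s"
    if i: "i < j" for i
  proof -
    have sh: "shift (int (j - i)) (shift (int i) \<omega>) = shift (int j) \<omega>" using i by (simp add: shift_add)
    have "BV_le (?u i) (\<Lambda> * ?B)" using i j by (intro \<Lambda>(1) hit_density_BV) auto
    from decay[OF this, of "j - i" "shift (int i) \<omega>"]
    have d: "BV_le (\<lambda>x. ?P i x - ?I i * h (shift (int j) \<omega>) x) (C' * \<theta> ^ (j - i) * (\<Lambda> * ?B))" unfolding sh .
    have "(\<integral>x. indicator (E j) x * ?P i x \<partial>unit_leb) - ?a * ?I i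
        = (\<integral>x. indicator (E j) x * (?P i x - ?I i * h (shift (int j) \<omega>) x) \<partial>unit_leb)"
      using EP[of i] integrable_indicator_mult[OF E h_integrable, of j "shift (int j) \<omega>"]
      by (simp add: right_diff_distrib mult.left_commute[of _ "?I i"])
    then show ?thesis using indicator_integral_le[OF j d] by simp
  qed
  have "(\<Sum>i<j. \<bar>(\<integral>x. indicator (E j) x * ?P i x \<partial>unit_leb) - ?a * ?I i\<bar>)
     = (\<Sum>i | i < j \<and> j - i < q. \<bar>(\<integral>x. indicator (E j) x * ?P i x \<partial>unit_leb) - ?a * ?I i\<bar>)
     + (\<Sum>i | i < j \<and> q \<le> j - i. \<bar>(\<integral>x. indicator (E j) x * ?P i x \<partial>unit_leb) - ?a * ?I i\<bar>)"
    by (subst sum.union_disjoint[symmetric]) (auto intro!: sum.cong)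
  also have "\<dots> \<le> (\<Sum>i | i < j \<and> j - i < q. (H * s) * (?B * s)) + (\<Sum>i | i < j \<and> q \<le> j - i. C' * \<theta> ^ (j - i) * (\<Lambda> * ?B) * s)"
    by (intro add_mono sum_mono near far) auto
  also have "(\<Sum>i | i < j \<and> j - i < q. (H * s) * (?B * s)) \<le> real q * ((H * s) * (?B * s))"
  proof -
    have "card {i. i < j \<and> j - i < q} \<le> card ((\<lambda>l. j - l) ` {..<q})"
    proof (rule card_mono)
      show "{i. i < j \<and> j - i < q} \<subseteq> (\<lambda>l. j - l) ` {..<q}"
      proof
        fix i assume "i \<in> {i. i < j \<and> j - i < q}"
        then show "i \<in> (\<lambda>l. j - l) ` {..<q}" by (intro image_eqI[of _ _ "j - i"]) auto
      qed
    qed simp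
    also have "\<dots> \<le> q" using card_image_le[of "{..<q}" "\<lambda>l. j - l"] by simp
    finally show ?thesis using const_nonneg s(2) B by (simp add: mult_right_mono)
  qed
  also have "(\<Sum>i | i < j \<and> q \<le> j - i. C' * \<theta> ^ (j - i) * (\<Lambda> * ?B) * s) = C' * \<Lambda> * ?B * s * (\<Sum>i | i < j \<and> q \<le> j - i. \<theta> ^ (j - i))"
    by (simp add: sum_distrib_left mult_ac)
  also have "\<dots> \<le> C' * \<Lambda> * ?B * s * (\<theta> ^ q / (1 - \<theta>))"
    using const_nonneg \<Lambda>(2) B s(2) by (intro mult_left_mono geometric_gap_sum(2)) auto
  also have "real q * ((H * s) * (?B * s)) + C' * \<Lambda> * ?B * s * (\<theta> ^ q / (1 - \<theta>))
      = ?B * (s * (C' * \<Lambda> * \<theta> ^ q / (1 - \<theta>) + real q * s * H))" by (simp add: distrib_left mult_ac)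
  also have "\<dots> \<le> (H * Q ^ k) * (s * (C' * \<Lambda> * \<theta> ^ q / (1 - \<theta>) + real q * s * H))"
  proof (intro mult_right_mono)
    \<comment> \<open>This step uses \<open>1 \<le> Q\<close>, as \<open>k = Suc k'\<close>.\<close>
    show "?B \<le> H * Q ^ k" using const_nonneg Q by (simp add: Suc mult_left_mono mult_le_cancel_right1)
    show "0 \<le> s * (C' * \<Lambda> * \<theta> ^ q / (1 - \<theta>) + real q * s * H)"
      using const_nonneg \<Lambda>(2) s(2) \<theta> by simp
  qed
  finally have "(\<Sum>i<j. \<bar>(\<integral>x. indicator (E j) x * ?P i x \<partial>unit_leb) - ?a * ?I i\<bar>)
     \<le> s * (H * Q ^ k) * (C' * \<Lambda> * \<theta> ^ q / (1 - \<theta>) + real q * s * H)" by (simp add: mult_ac)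
  then show ?thesis unfolding split by (intro order.trans[OF sum_abs])
qed

end

section \<open>Asymptotics of the factorial moments\<close>

context
  fixes E :: "nat \<Rightarrow> nat \<Rightarrow> real set" and \<omega> :: "int \<Rightarrow> 'q" and m :: "nat \<Rightarrow> nat" and \<kappa> R \<Lambda> \<mu> :: real
  assumes E: "\<And>n i. E n i \<in> sets borel"
    and size: "\<forall>\<^sub>F n in sequentially. \<forall>i<m n. (\<integral>x. indicator (E n i) x \<partial>unit_leb) \<le> \<kappa> / real n"
    and \<kappa>: "0 \<le> \<kappa>" and R: "0 \<le> R" "\<forall>\<^sub>F n in sequentially. real (m n) \<le> R * real n"
    and \<Lambda>: "\<And>n i f c. BV_le f c \<Longrightarrow> BV_le (\<lambda>x. indicator (E n i) x * f x) (\<Lambda> * c)" "0 \<le> \<Lambda>"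
    and ret: "\<And>q. \<forall>\<^sub>F n in sequentially. \<forall>i j x. i < j \<longrightarrow> j < m n \<longrightarrow> j - i < q \<longrightarrow> x \<in> {0..1} \<longrightarrow> x \<in> E n i \<longrightarrow>
        rmap T (j - i) (shift (int i) \<omega>) x \<notin> E n j"
    and int: "(\<lambda>n. \<Sum>i<m n. \<integral>x. indicator (E n i) x * h (shift (int i) \<omega>) x \<partial>unit_leb) \<longlonglongrightarrow> \<mu>"
begin

abbreviation (input) hit_prob :: "nat \<Rightarrow> nat \<Rightarrow> real" where
  "hit_prob n i \<equiv> (\<integral>x. indicator (E n i) x * h (shift (int i) \<omega>) x \<partial>unit_leb)"

abbreviation (input) moment :: "nat \<Rightarrow> nat \<Rightarrow> nat \<Rightarrow> real" where
  "moment k n j \<equiv> (\<integral>x. hit_density (E n) \<omega> k j x \<partial>unit_leb)"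

lemma hit_prob_nonneg: "0 \<le> hit_prob n i"
  by (intro integral_nonneg_AE eventually_mono[OF h_nonneg[of "shift (int i) \<omega>"]]) simp

text \<open>The moment of order \<open>Suc k\<close> at time \<open>j\<close> is a sum involving
  order \<open>k\<close> at all earlier times, so the induction needs uniformity in
  \<open>j\<close>. Three errors of \<open>e / 3\<close> arise: decorrelation of the last hit, the
  induction hypothesis, and replacing a Riemann sum by a power.\<close>

lemma moment_uniform:
  "0 < e \<Longrightarrow> \<forall>\<^sub>F n in sequentially. \<forall>j\<le>m n. \<bar>moment k n j - (\<Sum>i<j. hit_prob n i) ^ k / fact k\<bar> \<le> e"
proof (induction k arbitrary: e)
  case 0
  then show ?case by (simp add: h_integral)
next
  case (Suc k)
  \<comment> \<open>\<open>V\<close> bounds the summed hitting probabilities and \<open>W\<close>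
    the factor in front of the summed decorrelation errors. The bracket there is at most
    \<open>2 * e1\<close>, one share for long and one for short gaps. The \<open>+ 1\<close> in the
    denominators avoids division by 0.\<close>
  define V where "V = R * \<kappa> * H"
  define Q where "Q = max 1 (V + C' * \<Lambda> / (1 - \<theta>))"
  define W where "W = R * \<kappa> * (H * Q ^ k)"
  define e1 where "e1 = e / (6 * (W + 1))"
  define e2 where "e2 = e / (3 * (V + 1))"
  have V: "0 \<le> V" using R \<kappa> const_nonneg by (simp add: V_def)
  have W: "0 \<le> W" using R \<kappa> const_nonneg by (simp add: W_def Q_def)
  have e1: "0 < e1" "W * (2 * e1) \<le> e / 3" using W Suc.prems unfolding e1_def by (auto simp: field_simps)
  have e2: "0 < e2" "V * e2 \<le> e / 3" using V Suc.prems unfolding e2_def by (auto simp: field_simps)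
  \<comment> \<open>The threshold between short and long gaps is fixed before \<open>n\<close>; the
    contribution of the short gaps, \<open>q * \<kappa> * H / n\<close>, is made small afterwards by
    \<open>n\<close>.\<close>
  obtain q where q: "C' * \<Lambda> * \<theta> ^ q / (1 - \<theta>) \<le> e1"
  proof -
    have "(\<lambda>q. C' * \<Lambda> * \<theta> ^ q / (1 - \<theta>)) \<longlonglongrightarrow> C' * \<Lambda> * 0 / (1 - \<theta>)"
      using \<theta> by (intro tendsto_intros LIMSEQ_power_zero) auto
    then have "\<forall>\<^sub>F q in sequentially. C' * \<Lambda> * \<theta> ^ q / (1 - \<theta>) < e1"
      using e1 by (intro order_tendstoD(2)) auto
    then show ?thesis using that eventually_happens'[OF sequentially_bot] less_imp_le by blast
  qed
  have lim: "\<forall>\<^sub>F n in sequentially. c / real n < \<epsilon>" if "0 < \<epsilon>" for c \<epsilon> :: real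
    using that by (intro order_tendstoD(2)[OF lim_const_over_n]) auto
  have "0 < e / 3" using Suc.prems by simp
  show ?case
    using Suc.IH[OF e2(1)] size R(2) ret[of q] lim[OF e1(1), of "real q * \<kappa> * H"]
      lim[OF \<open>0 < e / 3\<close>, of "H * \<kappa> * V ^ k / fact k"] eventually_ge_at_top[of 1]
  proof eventually_elim
    case (elim n)
    define s where "s = \<kappa> / real n"
    have n: "0 < real n" using elim(7) by simp
    have s0: "0 \<le> s" using \<kappa> by (simp add: s_def)
    have s: "(\<integral>x. indicator (E n i) x \<partial>unit_leb) \<le> s" if "i < m n" for i using elim(2) that by (simp add: s_def)
    have ms: "real (m n) * s \<le> R * \<kappa>"
    proof -
      have "real (m n) * s \<le> (R * real n) * s" using elim(3) s0 by (intro mult_right_mono)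
      then show ?thesis using n by (simp add: s_def)
    qed
    have Q: "real (m n) * s * H + C' * \<Lambda> / (1 - \<theta>) \<le> Q" "1 \<le> Q"
      using mult_right_mono[OF ms, of H] const_nonneg unfolding Q_def V_def
      by (auto intro!: max.coboundedI2)
    note dec = hit_density_decorrelation[OF E s s0 \<Lambda> Q]
    have a: "0 \<le> hit_prob n i \<and> hit_prob n i \<le> H * s" if "i < m n" for i
      using hit_prob_nonneg[of n i] mult_left_mono[OF s[OF that], of H] const_nonneg
        integral_indicator_BV[OF E sample_density_limit(1), of n i "shift (int i) \<omega>"] by linarith
    have Ssum: "(\<Sum>i<j. hit_prob n i) \<le> V" if "j \<le> m n" for j
    proof -
      have "(\<Sum>i<j. hit_prob n i) \<le> (\<Sum>i<j. H * s)" using a that by (intro sum_mono) auto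
      also have "\<dots> = real j * s * H" by simp
      also have "\<dots> \<le> real (m n) * s * H" using that s0 const_nonneg by (intro mult_right_mono) auto
      also have "\<dots> \<le> V" using mult_right_mono[OF ms, of H] const_nonneg by (simp add: V_def)
      finally show ?thesis .
    qed
    have S0: "0 \<le> (\<Sum>i<j. hit_prob n i)" for j by (intro sum_nonneg hit_prob_nonneg)
    show ?case
    proof (intro allI impI)
      fix j assume j: "j \<le> m n"
      let ?S = "\<lambda>i. \<Sum>l<i. hit_prob n l"
      let ?X = "\<lambda>i. \<integral>x. indicator (E n i) x * hit_density (E n) \<omega> k i x \<partial>unit_leb"
      have u: "integrable unit_leb (\<lambda>y. indicator (E n i) y * hit_density (E n) \<omega> k i y)" for i
        by (rule integrable_indicator_mult[OF E hit_density_integrable[OF E]])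
      have mom: "moment (Suc k) n j = (\<Sum>i<j. ?X i)"
        unfolding hit_density.simps using rtransfer_integrable[OF u] rtransfer_integral[OF u] by simp
      have 1: "\<bar>(\<Sum>i<j. ?X i) - (\<Sum>i<j. hit_prob n i * moment k n i)\<bar> \<le> e / 3"
      proof -
        define \<delta> where "\<delta> = C' * \<Lambda> * \<theta> ^ q / (1 - \<theta>) + real q * s * H"
        have \<delta>: "0 \<le> \<delta>" unfolding \<delta>_def using const_nonneg \<Lambda>(2) \<theta> s0 by simp
        have "real q * s * H = real q * \<kappa> * H / real n" by (simp add: s_def)
        then have "\<delta> \<le> 2 * e1" unfolding \<delta>_def using q elim(5) by linarith
        note \<delta> = \<delta> this
        have "\<bar>(\<Sum>i<j. ?X i) - (\<Sum>i<j. hit_prob n i * moment k n i)\<bar> \<le> (\<Sum>i<j. \<bar>?X i - hit_prob n i * moment k n i\<bar>)"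
          unfolding sum_subtractf[symmetric] by (rule sum_abs)
        also have "\<dots> \<le> (\<Sum>i<j. s * (H * Q ^ k) * \<delta>)"
          unfolding \<delta>_def using elim(4) j by (intro sum_mono dec) auto
        also have "\<dots> = real j * s * (H * Q ^ k) * \<delta>" by simp
        also have "\<dots> \<le> real (m n) * s * (H * Q ^ k) * \<delta>"
          using j s0 const_nonneg Q \<delta> by (intro mult_right_mono) auto
        also have "\<dots> \<le> W * \<delta>"
          unfolding W_def using ms const_nonneg Q \<delta> by (intro mult_right_mono) auto
        also have "\<dots> \<le> W * (2 * e1)" using W \<delta> by (intro mult_left_mono)
        finally show ?thesis using e1 by linarith
      qed
      have 2: "\<bar>(\<Sum>i<j. hit_prob n i * moment k n i) - (\<Sum>i<j. hit_prob n i * (?S i ^ k / fact k))\<bar> \<le> e / 3"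
      proof -
        have "\<bar>(\<Sum>i<j. hit_prob n i * moment k n i) - (\<Sum>i<j. hit_prob n i * (?S i ^ k / fact k))\<bar>
           \<le> (\<Sum>i<j. \<bar>hit_prob n i * moment k n i - hit_prob n i * (?S i ^ k / fact k)\<bar>)"
          unfolding sum_subtractf[symmetric] by (rule sum_abs)
        also have "\<dots> \<le> (\<Sum>i<j. hit_prob n i * e2)"
          unfolding right_diff_distrib[symmetric] abs_mult
          using elim(1) j hit_prob_nonneg by (intro sum_mono) (auto intro!: mult_left_mono)
        also have "\<dots> = ?S j * e2" by (simp only: sum_distrib_right)
        also have "\<dots> \<le> V * e2" using Ssum[OF j] e2 by (intro mult_right_mono) auto
        finally show ?thesis using e2 by linarith
      qed
      have 3: "\<bar>(\<Sum>i<j. hit_prob n i * (?S i ^ k / fact k)) - ?S j ^ Suc k / fact (Suc k)\<bar> \<le> e / 3"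
      proof -
        have "\<bar>(\<Sum>i<j. hit_prob n i * (?S i ^ k / fact k)) - ?S j ^ Suc k / fact (Suc k)\<bar> \<le> (H * s) * ?S j ^ k / fact k"
          using a j s0 const_nonneg by (intro power_sum_error) auto
        also have "\<dots> \<le> (H * s) * V ^ k / fact k"
          using Ssum[OF j] S0 s0 const_nonneg by (intro divide_right_mono mult_left_mono power_mono) auto
        also have "\<dots> = H * \<kappa> * V ^ k / fact k / real n" by (simp add: s_def)
        finally show ?thesis using elim(6) by linarith
      qed
      show "\<bar>moment (Suc k) n j - ?S j ^ Suc k / fact (Suc k)\<bar> \<le> e"
        using 1 2 3 unfolding mom by linarith
    qed
  qed
qed

text \<open>All information about \<open>\<omega>\<close> is contained in the limit of the summed
  hitting probabilities and in the absence of short returns.\<close>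

theorem poisson_limit:
  "(\<lambda>n. measure (sample_measure T \<omega>) {x \<in> {0..1}. hits (E n) \<omega> (m n) x = k}) \<longlonglongrightarrow> \<mu> ^ k / fact k * exp (- \<mu>)"
proof -
  have "(\<lambda>n. measure (sample_measure T \<omega>) {x \<in> space (sample_measure T \<omega>). hits (E n) \<omega> (m n) x = k}) \<longlonglongrightarrow> \<mu> ^ k / fact k * exp (- \<mu>)"
  proof (rule factorial_moments_imp_poisson)
    show "prob_space (sample_measure T \<omega>)" by (rule prob_space_sample_measure)
    show "hits (E n) \<omega> (m n) \<in> measurable (sample_measure T \<omega>) (count_space UNIV)" for n
      using hits_measurable[OF E] by (simp add: sample_measure_def)
    show "hits (E n) \<omega> (m n) x \<le> m n" for n x by (rule hits_le)
    show "(\<lambda>n. \<integral>x. real (hits (E n) \<omega> (m n) x choose k) \<partial>sample_measure T \<omega>) \<longlonglongrightarrow> \<mu> ^ k / fact k" for k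
      unfolding hit_density_moment[OF E, symmetric]
    proof -
      have "(\<lambda>n. moment k n (m n) - (\<Sum>i<m n. hit_prob n i) ^ k / fact k) \<longlonglongrightarrow> 0"
      proof (rule tendstoI)
        fix e :: real assume "0 < e"
        then have "0 < e / 2" by simp
        from moment_uniform[OF this, of k]
        show "\<forall>\<^sub>F n in sequentially. dist (moment k n (m n) - (\<Sum>i<m n. hit_prob n i) ^ k / fact k) 0 < e"
          by eventually_elim (use \<open>0 < e\<close> in force)
      qed
      moreover have "(\<lambda>n. (\<Sum>i<m n. hit_prob n i) ^ k / fact k) \<longlonglongrightarrow> \<mu> ^ k / fact k"
        by (intro tendsto_intros int) auto
      ultimately show "(\<lambda>n. moment k n (m n)) \<longlonglongrightarrow> \<mu> ^ k / fact k"
        using tendsto_add by fastforce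
    qed
  qed
  then show ?thesis by simp
qed

end

end

section \<open>Short returns and grid cells\<close>

text \<open>Off the discontinuity set \<open>z\<close> is interior, relative to the unit interval,
  to its cell \<open>J\<close>. On \<open>J\<close> each step stays within a single branch, so the
  composition is continuous on a neighbourhood of \<open>z\<close>.\<close>

lemma (in expanding_maps) continuous_rmap:
  assumes z: "z \<in> {0..1} - disc_set T A"
  shows "continuous (at z within {0..1}) (rmap T n \<omega>)"
proof -
  have "\<forall>k. \<exists>I. I \<in> A (shift (int k) \<omega> 0) \<and> rmap T k \<omega> z \<in> I"
  proof
    fix k
    have "\<Union>(A (shift (int k) \<omega> 0)) = {0..1}"
      using expanding unfolding piecewise_expanding_def partition_on_def by auto
    then show "\<exists>I. I \<in> A (shift (int k) \<omega> 0) \<and> rmap T k \<omega> z \<in> I"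
      using rmap_in_unit[of z k \<omega>] z by auto
  qed
  then obtain I where I: "\<And>k. I k \<in> A (shift (int k) \<omega> 0)" "\<And>k. rmap T k \<omega> z \<in> I k" by metis
  define J where "J = {0..1} \<inter> (\<Inter>k<n. rmap T k \<omega> -` I k)"
  have zJ: "z \<in> J" using I(2) z unfolding J_def by auto
  have "J \<in> dyn_partition T A n \<omega>" unfolding dyn_partition_def J_def using I(1) by auto
  then have "z \<notin> top_of_set {0..1} frontier_of J" using z unfolding disc_set_def by blast
  moreover have "z \<in> top_of_set {0..1} closure_of J"
    using closure_of_subset[of J "top_of_set {0..1}"] zJ unfolding J_def by auto
  ultimately have "z \<in> top_of_set {0..1} interior_of J" by (simp add: frontier_of_def)
  then obtain U where U: "openin (top_of_set {0..1}) U" "z \<in> U" "U \<subseteq> J"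
    unfolding interior_of_def by auto
  then obtain O' where O': "open O'" "U = {0..1} \<inter> O'" by (auto simp: openin_open)
  have "continuous_on J (rmap T k \<omega>)" if "k \<le> n" for k
    using that
  proof (induction k)
    case 0
    then show ?case by (simp add: id_def)
  next
    case (Suc k)
    have "rmap T k \<omega> ` J \<subseteq> I k" using Suc.prems unfolding J_def by auto
    moreover have "continuous_on J (rmap T k \<omega>)" using Suc by simp
    moreover have "continuous_on (I k) (T (shift (int k) \<omega> 0))"
      using piecewise_expanding_restrict(1)[OF expanding I(1)] .
    ultimately show ?case
      using continuous_on_compose2[of "I k" "T (shift (int k) \<omega> 0)" J "rmap T k \<omega>"]
      by (simp add: o_def)
  qed
  then have "continuous_on U (rmap T n \<omega>)" using U(3) by (auto intro: continuous_on_subset)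
  then have "continuous (at z within U) (rmap T n \<omega>)" using U(2) by (simp add: continuous_on_eq_continuous_within)
  moreover have "at z within U = at z within {0..1}"
    by (rule at_within_nhd[of z O']) (use U O' in auto)
  ultimately show ?thesis by (simp add: continuous_within)
qed

text \<open>The starting time \<open>i\<close> ranges over all natural numbers, but fewer than
  \<open>q\<close> steps over a finite alphabet yield only finitely many maps. Each of them is
  continuous at \<open>z\<close> and moves \<open>z\<close>, and the least of finitely many radii
  works for all.\<close>

lemma no_short_returns:
  fixes T :: "'q::finite \<Rightarrow> real \<Rightarrow> real"
  assumes T: "\<And>i. piecewise_expanding (T i) (A i)"
    and z: "z \<in> {0..1} - disc_set T A"
    and nr: "\<And>i l. 1 \<le> l \<Longrightarrow> rmap T l (shift (int i) \<omega>) z \<noteq> z"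
  shows "\<exists>\<epsilon>>0. \<forall>i l x. 1 \<le> l \<longrightarrow> l < q \<longrightarrow> x \<in> {0..1} \<longrightarrow> \<bar>x - z\<bar> < \<epsilon> \<longrightarrow>
     \<epsilon> \<le> \<bar>rmap T l (shift (int i) \<omega>) x - z\<bar>"
proof -
  interpret expanding_maps T A by unfold_locales (rule T)
  define \<F> where "\<F> = (\<Union>l\<in>{1..<q}. range (\<lambda>i. rmap T l (shift (int i) \<omega>)))"
  have "finite (range (\<lambda>i. rmap T l (shift (int i) \<omega>)))" for l
  proof (rule finite_subset)
    show "finite (range (rmap T l))"
      by (rule depends_on_finite_range[of "{0..<int l}"]) (auto simp: depends_on_def intro: rmap_word)
  qed auto
  then have fin: "finite \<F>" unfolding \<F>_def by auto
  have "\<exists>\<epsilon>>0. \<forall>x\<in>{0..1}. \<bar>x - z\<bar> < \<epsilon> \<longrightarrow> \<epsilon> \<le> \<bar>f x - z\<bar>" if f: "f \<in> \<F>" for f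
  proof -
    obtain l i where l: "1 \<le> l" "f = rmap T l (shift (int i) \<omega>)" using f unfolding \<F>_def by auto
    \<comment> \<open>Half the displacement of \<open>z\<close>: an image within \<open>d\<close> of
      \<open>f z\<close> keeps distance at least \<open>d\<close> from \<open>z\<close>.\<close>
    define d where "d = \<bar>f z - z\<bar> / 2"
    have d: "0 < d" using nr[OF l(1), of i] l(2) by (simp add: d_def)
    have "continuous (at z within {0..1}) f" unfolding l(2) by (rule continuous_rmap[OF z])
    then obtain \<delta> where \<delta>: "0 < \<delta>" "\<And>x. x \<in> {0..1} \<Longrightarrow> dist x z < \<delta> \<Longrightarrow> dist (f x) (f z) < d"
      using d unfolding continuous_within_eps_delta by blast
    show ?thesis
    proof (intro exI[of _ "min \<delta> d"] conjI ballI impI)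
      fix x assume x: "x \<in> {0..1}" "\<bar>x - z\<bar> < min \<delta> d"
      then have "\<bar>f x - f z\<bar> < d" using \<delta>(2)[of x] by (simp add: dist_real_def)
      moreover have "\<bar>f z - z\<bar> = 2 * d" by (simp add: d_def)
      ultimately show "min \<delta> d \<le> \<bar>f x - z\<bar>" by linarith
    qed (use \<delta> d in auto)
  qed
  then obtain \<epsilon> where \<epsilon>: "\<And>f. f \<in> \<F> \<Longrightarrow> 0 < \<epsilon> f"
    "\<And>f x. \<lbrakk>f \<in> \<F>; x \<in> {0..1}; \<bar>x - z\<bar> < \<epsilon> f\<rbrakk> \<Longrightarrow> \<epsilon> f \<le> \<bar>f x - z\<bar>" by metis
  define \<eta> where "\<eta> = Min (insert 1 (\<epsilon> ` \<F>))"
  have "0 < \<eta>" unfolding \<eta>_def using fin \<epsilon>(1) by (subst Min_gr_iff) auto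
  moreover have \<eta>: "\<eta> \<le> \<epsilon> f" if "f \<in> \<F>" for f unfolding \<eta>_def using fin that by (intro Min_le) auto
  have "\<eta> \<le> \<bar>rmap T l (shift (int i) \<omega>) x - z\<bar>"
    if "1 \<le> l" "l < q" "x \<in> {0..1}" "\<bar>x - z\<bar> < \<eta>" for i l x
  proof -
    have f: "rmap T l (shift (int i) \<omega>) \<in> \<F>"
      unfolding \<F>_def using that(1,2) by (intro UN_I[of l] rangeI) auto
    show ?thesis using \<eta>[OF f] \<epsilon>(2)[OF f that(3)] that(4) by linarith
  qed
  with \<open>0 < \<eta>\<close> show ?thesis by blast
qed

text \<open>The return after a hit at time \<open>i\<close> takes place in the environment shifted
  by \<open>i\<close>. Invariance of the Bernoulli measure gives non-recurrence for each shift, and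
  there are countably many.\<close>

lemma AE_nonrecurrent:
  assumes "nonrecurrent p T z"
  shows "AE \<omega> in bernoulli p. \<forall>i l. 1 \<le> l \<longrightarrow> rmap T l (shift (int i) \<omega>) z \<noteq> z"
  using AE_shift[OF assms[unfolded nonrecurrent_def]] by (subst AE_all_countable) auto

text \<open>In the coordinates \<open>(time, size powr - \<alpha>)\<close> the cells are squares of side \<open>g\<close>.\<close>

definition grid_cell :: "real \<Rightarrow> real \<Rightarrow> nat \<times> nat \<Rightarrow> (real \<times> real) set" where
  "grid_cell \<alpha> g = (\<lambda>(a, c). {real a * g<..real (Suc a) * g} \<times>
     {y. 0 < y \<and> real c * g \<le> y powr - \<alpha> \<and> y powr - \<alpha> < real (Suc c) * g})"

section \<open>Grid cells and their targets\<close>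

lemma size_slot_borel: "{y::real. 0 < y \<and> u \<le> y powr - \<alpha> \<and> y powr - \<alpha> < v} \<in> sets borel"
  by measurable

lemma grid_cell_borel: "grid_cell \<alpha> g c \<in> sets borel"
  using size_slot_borel unfolding grid_cell_def borel_prod[symmetric] by (auto split: prod.split)

lemma grid_unique:
  fixes g :: real
  assumes "0 < g" "real a * g < \<tau>" "\<tau> \<le> real (Suc a) * g" "real a' * g < \<tau>" "\<tau> \<le> real (Suc a') * g"
  shows "a = a'"
proof -
  have "real a * g < real (Suc a') * g" "real a' * g < real (Suc a) * g" using assms by linarith+
  then have "a < Suc a'" "a' < Suc a" using assms(1) by simp_all
  then show ?thesis by simp
qed

lemma grid_unique_closed_left:
  fixes g :: real
  assumes "0 < g" "real a * g \<le> \<tau>" "\<tau> < real (Suc a) * g" "real a' * g \<le> \<tau>" "\<tau> < real (Suc a') * g"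
  shows "a = a'"
proof -
  have "real a * g < real (Suc a') * g" "real a' * g < real (Suc a) * g" using assms by linarith+
  then have "a < Suc a'" "a' < Suc a" using assms(1) by simp_all
  then show ?thesis by simp
qed

lemma grid_cell_disjoint:
  assumes "0 < g" "x \<in> grid_cell \<alpha> g c" "x \<in> grid_cell \<alpha> g c'" shows "c = c'"
  using assms grid_unique[OF assms(1)] grid_unique_closed_left[OF assms(1)]
  unfolding grid_cell_def by (auto split: prod.splits)

lemma disjoint_indicator_sum:
  assumes "finite F" "\<And>c c'. \<lbrakk>c \<in> F; c' \<in> F; x \<in> B c; x \<in> B c'\<rbrakk> \<Longrightarrow> c = c'"
  shows "indicator (\<Union>c\<in>F. B c) x = (\<Sum>c\<in>F. indicator (B c) x :: real)"
proof (cases "\<exists>c\<in>F. x \<in> B c")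
  case True
  then obtain c where c: "c \<in> F" "x \<in> B c" by auto
  have "(\<Sum>c'\<in>F. indicator (B c') x :: real) = (\<Sum>c'\<in>F. if c' = c then 1 else 0)"
    using assms(2) c by (intro sum.cong) (auto simp: indicator_def)
  also have "\<dots> = 1" using c assms(1) by simp
  finally show ?thesis using c by (simp add: indicator_def) blast
qed auto

text \<open>The target at iterate \<open>i\<close>. Its time is \<open>Suc i / n\<close>, since the
  \<open>j\<close>-th observation is made at the iterate \<open>j - 1\<close>.\<close>

definition level :: "(real \<Rightarrow> real) \<Rightarrow> (nat \<Rightarrow> real) \<Rightarrow> (real \<times> real) set \<Rightarrow> nat \<Rightarrow> nat \<Rightarrow> real set" where
  "level \<phi> b B n i = {x. (real (Suc i) / real n, \<phi> x / b n) \<in> B}"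

lemma obs_measurable: "obs \<alpha> z \<in> borel_measurable borel"
  unfolding obs_def[abs_def] by measurable

lemma level_borel:
  assumes "B \<in> sets borel" shows "level (obs \<alpha> z) b B n i \<in> sets borel"
proof -
  note [measurable] = obs_measurable
  have "(\<lambda>x. (real (Suc i) / real n, obs \<alpha> z x / b n)) \<in> borel \<rightarrow>\<^sub>M borel \<Otimes>\<^sub>M borel"
    by measurable
  then have "(\<lambda>x. (real (Suc i) / real n, obs \<alpha> z x / b n)) \<in> borel \<rightarrow>\<^sub>M (borel :: (real \<times> real) measure)"
    by (simp add: borel_prod)
  from measurable_sets[OF this assms] show ?thesis by (simp add: level_def vimage_def)
qed

lemma level_time_0: "B \<subseteq> {0<..} \<times> UNIV \<Longrightarrow> level \<phi> b B 0 i = {}"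
  by (auto simp: level_def)

lemma grid_cell_time: "0 < g \<Longrightarrow> grid_cell \<alpha> g c \<subseteq> {0<..} \<times> UNIV"
  unfolding grid_cell_def
  by (auto split: prod.splits intro: le_less_trans[rotated])

definition in_slot :: "real \<Rightarrow> nat \<Rightarrow> nat \<Rightarrow> nat \<Rightarrow> real" where
  "in_slot g n a i = of_bool (real a * g < real (Suc i) / real n \<and> real (Suc i) / real n \<le> real (Suc a) * g)"

text \<open>Off \<open>z\<close> the scaled observation raised to the power
  \<open>- \<alpha>\<close> is \<open>\<bar>x - z\<bar> / b n powr - \<alpha>\<close>. A slot in
  this coordinate is a ring around \<open>z\<close>, and a ring is a difference of two
  balls.\<close>

lemma level_grid_cell:
  assumes \<alpha>: "0 < \<alpha>" and g: "0 < g" and b: "0 < b n" and x: "x \<noteq> z"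
  shows "indicator (level (obs \<alpha> z) b (grid_cell \<alpha> g (a, c)) n i) x =
     in_slot g n a i * (indicator {y. \<bar>y - z\<bar> < real (Suc c) * g * b n powr - \<alpha>} x
        - indicator {y. \<bar>y - z\<bar> < real c * g * b n powr - \<alpha>} x)"
proof -
  have pos: "0 < obs \<alpha> z x / b n" using x b by (simp add: obs_def)
  have r: "0 < b n powr - \<alpha>" using b by simp
  have "(obs \<alpha> z x / b n) powr - \<alpha> = \<bar>x - z\<bar> / b n powr - \<alpha>"
    using x b \<alpha> by (simp add: obs_def powr_divide powr_powr)
  then have *: "real c * g \<le> (obs \<alpha> z x / b n) powr - \<alpha> \<longleftrightarrow> \<not> \<bar>x - z\<bar> < real c * g * b n powr - \<alpha>"
    "(obs \<alpha> z x / b n) powr - \<alpha> < real (Suc c) * g \<longleftrightarrow> \<bar>x - z\<bar> < real (Suc c) * g * b n powr - \<alpha>"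
    using r by (simp_all add: not_less pos_le_divide_eq pos_divide_less_eq del: of_nat_Suc)
  have mono: "real c * g * b n powr - \<alpha> \<le> real (Suc c) * g * b n powr - \<alpha>"
    using g r by (intro mult_right_mono) auto
  show ?thesis
    using pos mono unfolding level_def grid_cell_def in_slot_def
    by (auto simp: * indicator_def simp del: of_nat_Suc)
qed

lemma count_process_eq_card:
  assumes "B \<subseteq> {0<..real K} \<times> UNIV"
  shows "count_process T \<phi> b n \<omega> B x = card {i. i < K * n \<and> rmap T i \<omega> x \<in> level \<phi> b B n i}"
proof -
  have "{j. 1 \<le> j \<and> (real j / real n, \<phi> (rmap T (j - 1) \<omega> x) / b n) \<in> B}
      = Suc ` {i. i < K * n \<and> rmap T i \<omega> x \<in> level \<phi> b B n i}" (is "?L = Suc ` ?R")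
  proof
    show "?L \<subseteq> Suc ` ?R"
    proof
      fix j assume j: "j \<in> ?L"
      \<comment> \<open>Positive times exclude \<open>n = 0\<close>, for which every quotient is 0;
        the upper bound makes the set of indices finite.\<close>
      then have "0 < real j / real n" "real j / real n \<le> real K" using assms by auto
      then have "0 < real n" "real j \<le> real (K * n)" by (auto simp: zero_less_divide_iff field_simps)
      then have "j \<le> K * n" by linarith
      then show "j \<in> Suc ` ?R" using j by (intro image_eqI[of _ _ "j - 1"]) (auto simp: level_def)
    qed
  qed (auto simp: level_def)
  then show ?thesis unfolding count_process_def by (simp add: card_image)
qed

text \<open>A slot that is open on the left and closed on the right, together with the offset
  \<open>Suc i\<close>, selects exactly the indices from one floor up to, and excluding, the
  next.\<close>

lemma in_slot_sum:
  assumes g: "0 \<le> g" and m: "nat \<lfloor>real (Suc a) * g * real n\<rfloor> \<le> m" and n: "1 \<le> n"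
  shows "(\<Sum>i<m. in_slot g n a i * f i) =
     (\<Sum>i<nat \<lfloor>real (Suc a) * g * real n\<rfloor>. f i) - (\<Sum>i<nat \<lfloor>real a * g * real n\<rfloor>. f i)"
proof -
  let ?u = "nat \<lfloor>real (Suc a) * g * real n\<rfloor>" and ?l = "nat \<lfloor>real a * g * real n\<rfloor>"
  have n0: "0 < real n" using n by simp
  have "real a * g * real n \<le> real (Suc a) * g * real n" using g by (intro mult_right_mono) auto
  then have lu: "?l \<le> ?u" by (intro nat_mono floor_mono)
  have slot: "in_slot g n a i = of_bool (?l \<le> i \<and> i < ?u)" for i
  proof -
    have "real a * g < real (Suc i) / real n \<longleftrightarrow> real a * g * real n < real (Suc i)"
      using n0 by (simp add: pos_less_divide_eq del: of_nat_Suc)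
    also have "\<dots> \<longleftrightarrow> ?l \<le> i"
      using g by (simp add: nat_le_iff floor_le_iff add.commute)
    finally have 1: "real a * g < real (Suc i) / real n \<longleftrightarrow> ?l \<le> i" .
    have "real (Suc i) / real n \<le> real (Suc a) * g \<longleftrightarrow> real (Suc i) \<le> real (Suc a) * g * real n"
      using n0 by (simp add: pos_divide_le_eq del: of_nat_Suc)
    also have "\<dots> \<longleftrightarrow> i < ?u" using le_nat_floor[of "Suc i" "real (Suc a) * g * real n"] of_nat_floor[of "real (Suc a) * g * real n"] g
      by (smt (verit) Suc_leI le_eq_less_or_eq less_Suc_eq_le not_less_eq_eq of_nat_0_le_iff of_nat_le_iff zero_le_mult_iff)
    finally show ?thesis using 1 by (simp add: in_slot_def)
  qed
  have "(\<Sum>i<m. in_slot g n a i * f i) = (\<Sum>i\<in>{?l..<?u}. f i)"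
    using m unfolding slot by (intro sum.mono_neutral_cong_right) auto
  also have "\<dots> = (\<Sum>i<?u. f i) - (\<Sum>i<?l. f i)"
    using lu by (simp add: sum_diff_nat_ivl lessThan_atLeast0)
  finally show ?thesis .
qed

lemma floor_ratio_tendsto:
  assumes "0 \<le> t" shows "(\<lambda>n. real (nat \<lfloor>t * real n\<rfloor>) / real n) \<longlonglongrightarrow> t"
proof (rule tendsto_sandwich)
  have "(\<lambda>n. t - 1 / real n) \<longlonglongrightarrow> t - 0" by (intro tendsto_intros lim_1_over_n)
  then show "(\<lambda>n. t - 1 / real n) \<longlonglongrightarrow> t" by simp
  show "\<forall>\<^sub>F n in sequentially. t - 1 / real n \<le> real (nat \<lfloor>t * real n\<rfloor>) / real n"
    using eventually_ge_at_top[of 1]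
  proof eventually_elim
    case (elim n)
    have "t * real n - 1 \<le> real (nat \<lfloor>t * real n\<rfloor>)" by linarith
    then have "(t * real n - 1) / real n \<le> real (nat \<lfloor>t * real n\<rfloor>) / real n" by (intro divide_right_mono) auto
    then show ?case using elim by (simp add: diff_divide_distrib)
  qed
  show "\<forall>\<^sub>F n in sequentially. real (nat \<lfloor>t * real n\<rfloor>) / real n \<le> t"
    using eventually_ge_at_top[of 1]
  proof eventually_elim
    case (elim n)
    have "real (nat \<lfloor>t * real n\<rfloor>) \<le> t * real n" using assms by (intro of_nat_floor) simp
    then show ?case using elim by (simp add: pos_divide_le_eq)
  qed
qed auto

section \<open>Poisson limits for finite unions of grid cells\<close>

context random_expanding
begin

context
  fixes p :: "'q pmf" and z \<alpha> :: real and b :: "nat \<Rightarrow> real" and \<omega> :: "int \<Rightarrow> 'q"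
  assumes z: "z \<in> {0..1} - disc_set T A" and \<alpha>: "0 < \<alpha>" and b: "\<And>n. 1 \<le> n \<Longrightarrow> 0 < b n"
    and scale: "(\<lambda>n. real n * (\<integral>\<omega>. ball_mass z \<omega> (b n powr - \<alpha>) \<partial>bernoulli p)) \<longlonglongrightarrow> 1"
    and nr: "\<And>i l. 1 \<le> l \<Longrightarrow> rmap T l (shift (int i) \<omega>) z \<noteq> z"
    and \<omega>: "(\<lambda>n. (\<Sum>j<n. local_density z (shift (int j) \<omega>)) / real n) \<longlonglongrightarrow> (\<integral>\<omega>. local_density z \<omega> \<partial>bernoulli p)"
begin

lemma z_unit: "z \<in> {0..1}" using z by simp

lemma r_pos: "1 \<le> n \<Longrightarrow> 0 < b n powr - \<alpha>" using b[of n] by simp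

lemma r_bound': "\<forall>\<^sub>F n in sequentially. real n * b n powr - \<alpha> \<le> 2 / c0"
  by (rule r_bound[OF z_unit _ scale]) (rule r_pos)

lemma r_tendsto_0': "(\<lambda>n. b n powr - \<alpha>) \<longlonglongrightarrow> 0"
  by (rule r_tendsto_0[OF z_unit _ scale]) (rule r_pos)

context
  fixes g :: real and K :: nat and F :: "(nat \<times> nat) set" and B :: "(real \<times> real) set"
  assumes g: "0 < g" and fin: "finite F" and K: "\<And>a c. (a, c) \<in> F \<Longrightarrow> real (Suc a) * g \<le> real K"
  defines "B \<equiv> (\<Union>c\<in>F. grid_cell \<alpha> g c)"
begin

lemma B_borel: "B \<in> sets borel"
  unfolding B_def using fin grid_cell_borel by (intro sets.finite_UN) auto

lemma B_time: "B \<subseteq> {0<..} \<times> UNIV"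
  using grid_cell_time[OF g] unfolding B_def by blast

abbreviation (input) ring_indicator :: "nat \<Rightarrow> nat \<Rightarrow> real \<Rightarrow> real" where
  "ring_indicator n c x \<equiv> indicator {y. \<bar>y - z\<bar> < real (Suc c) * g * b n powr - \<alpha>} x
        - indicator {y. \<bar>y - z\<bar> < real c * g * b n powr - \<alpha>} x"

lemma level_B:
  assumes "1 \<le> n" "x \<noteq> z"
  shows "indicator (level (obs \<alpha> z) b B n i) x = (\<Sum>(a, c)\<in>F. in_slot g n a i * ring_indicator n c x)"
proof -
  have eq: "level (obs \<alpha> z) b B n i = (\<Union>c\<in>F. level (obs \<alpha> z) b (grid_cell \<alpha> g c) n i)"
    unfolding B_def level_def by auto
  have "indicator (level (obs \<alpha> z) b B n i) x = (\<Sum>c\<in>F. indicator (level (obs \<alpha> z) b (grid_cell \<alpha> g c) n i) x :: real)"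
    unfolding eq by (rule disjoint_indicator_sum[OF fin]) (auto simp: level_def dest: grid_cell_disjoint[OF g])
  also have "\<dots> = (\<Sum>(a, c)\<in>F. in_slot g n a i * ring_indicator n c x)"
    by (intro sum.cong refl) (use level_grid_cell[where b = b and n = n, OF \<alpha> g b[OF assms(1)] assms(2)] in auto)
  finally show ?thesis .
qed

text \<open>Each cell gives a ring, whose two balls cost 6 each. The constant depends on neither
  \<open>n\<close> nor \<open>i\<close>, as is required of \<open>\<Lambda>\<close>.\<close>

lemma BV_le_level:
  assumes f: "BV_le f c"
  shows "BV_le (\<lambda>x. indicator (level (obs \<alpha> z) b B n i) x * f x) (12 * real (card F) * c)"
proof (cases "n = 0")
  \<comment> \<open>For \<open>n = 0\<close> all times are 0 and the target is empty;
    \<open>b 0\<close> is arbitrary.\<close>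
  case True
  then have "(\<lambda>x. indicator (level (obs \<alpha> z) b B n i) x * f x) = (\<lambda>_. 0)"
    using level_time_0[OF B_time] by auto
  then show ?thesis using BV_le_mono[OF BV_le_const[of 0]] BV_le_nonneg[OF f] by simp
next
  case False
  then have n: "1 \<le> n" by simp
  have "BV_le (\<lambda>x. \<Sum>(a, d)\<in>F. in_slot g n a i * (ring_indicator n d x * f x)) (\<Sum>c'\<in>F. 12 * c)"
  proof (rule BV_le_sum[OF fin, of "\<lambda>(a, d) x. in_slot g n a i * (ring_indicator n d x * f x)" "\<lambda>_. 12 * c", unfolded case_prod_app])
    fix ad assume "ad \<in> F"
    obtain a d where ad: "ad = (a, d)" by force
    have "BV_le (\<lambda>x. indicator {y. \<bar>y - z\<bar> < real (Suc d) * g * b n powr - \<alpha>} x * f x - indicator {y. \<bar>y - z\<bar> < real d * g * b n powr - \<alpha>} x * f x) (6 * c + 6 * c)"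
      by (intro BV_le_diff BV_le_ball f)
    then have "BV_le (\<lambda>x. ring_indicator n d x * f x) (12 * c)" by (simp add: left_diff_distrib)
    from BV_le_cmult[OF this, of "in_slot g n a i"]
    have "BV_le (\<lambda>x. in_slot g n a i * (ring_indicator n d x * f x)) (12 * c)"
      by (rule BV_le_mono) (use BV_le_nonneg[OF f] in \<open>simp add: in_slot_def\<close>)
    then show "BV_le (\<lambda>x. case ad of (a, d) \<Rightarrow> in_slot g n a i * (ring_indicator n d x * f x)) (12 * c)"
      by (simp add: ad)
  qed
  then have "BV_le (\<lambda>x. \<Sum>(a, d)\<in>F. in_slot g n a i * (ring_indicator n d x * f x)) (12 * real (card F) * c)"
    by (simp add: mult_ac)
  then show ?thesis
  proof (rule BV_le_cong)
    show "AE x in unit_leb. (\<Sum>(a, d)\<in>F. in_slot g n a i * (ring_indicator n d x * f x)) = indicator (level (obs \<alpha> z) b B n i) x * f x"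
      using AE_unit_leb_neq[of z]
    proof eventually_elim
      case (elim x)
      show ?case unfolding level_B[OF n elim] by (simp add: sum_distrib_right case_prod_unfold mult.assoc)
    qed
  qed (rule integrable_indicator_mult[OF level_borel[OF B_borel] BV_le_integrable[OF f]])
qed

text \<open>The sum of the outer radii dominates each of them, and adding 1 keeps \<open>S\<close>
  positive even when there are no cells.\<close>

lemma level_subset_ball:
  obtains S where "0 < S" "\<And>n i x. \<lbrakk>1 \<le> n; x \<in> level (obs \<alpha> z) b B n i\<rbrakk> \<Longrightarrow> \<bar>x - z\<bar> < S * b n powr - \<alpha>"
proof -
  define S where "S = (\<Sum>(a, c)\<in>F. real (Suc c) * g) + 1"
  have S: "real (Suc c) * g \<le> S" if "(a, c) \<in> F" for a c
  proof -
    have "real (Suc c) * g \<le> (\<Sum>(a, c)\<in>F. real (Suc c) * g)"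
      using member_le_sum[OF that, of "\<lambda>(a, c). real (Suc c) * g"] fin g by auto
    then show ?thesis by (simp add: S_def)
  qed
  have S0: "0 < S" unfolding S_def using g by (intro add_nonneg_pos sum_nonneg) auto
  show ?thesis
  proof (rule that[OF S0])
    fix n i x assume n: "1 \<le> n" and x: "x \<in> level (obs \<alpha> z) b B n i"
    show "\<bar>x - z\<bar> < S * b n powr - \<alpha>"
    proof (cases "x = z")
      case True
      then show ?thesis using S0 r_pos[OF n] by simp
    next
      case False
      obtain a c where c: "(a, c) \<in> F" "x \<in> level (obs \<alpha> z) b (grid_cell \<alpha> g (a, c)) n i"
        using x unfolding level_def B_def by auto
      have "in_slot g n a i * ring_indicator n c x = 1"
        using level_grid_cell[where b = b and n = n, OF \<alpha> g b[OF n] False, of a c i] c(2) by simp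
      then have "\<bar>x - z\<bar> < real (Suc c) * g * b n powr - \<alpha>"
        by (auto simp: in_slot_def indicator_def of_bool_def split: if_splits)
      also have "\<dots> \<le> S * b n powr - \<alpha>" using S[OF c(1)] r_pos[OF n] by (intro mult_right_mono) auto
      finally show ?thesis .
    qed
  qed
qed

lemma hit_prob_level:
  assumes "1 \<le> n"
  shows "(\<integral>x. indicator (level (obs \<alpha> z) b B n i) x * h \<omega>' x \<partial>unit_leb) =
     (\<Sum>(a, c)\<in>F. in_slot g n a i * (ball_mass z \<omega>' (real (Suc c) * g * b n powr - \<alpha>) - ball_mass z \<omega>' (real c * g * b n powr - \<alpha>)))"
proof -
  note bi = integrable_indicator_mult[OF ball_borel h_integrable]
  have "(\<integral>x. indicator (level (obs \<alpha> z) b B n i) x * h \<omega>' x \<partial>unit_leb) =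
     (\<integral>x. (\<Sum>(a, c)\<in>F. in_slot g n a i * (indicator {y. \<bar>y - z\<bar> < real (Suc c) * g * b n powr - \<alpha>} x * h \<omega>' x
        - indicator {y. \<bar>y - z\<bar> < real c * g * b n powr - \<alpha>} x * h \<omega>' x)) \<partial>unit_leb)"
  proof (rule integral_cong_AE)
    show "AE x in unit_leb. indicator (level (obs \<alpha> z) b B n i) x * h \<omega>' x = (\<Sum>(a, c)\<in>F. in_slot g n a i * (indicator {y. \<bar>y - z\<bar> < real (Suc c) * g * b n powr - \<alpha>} x * h \<omega>' x
        - indicator {y. \<bar>y - z\<bar> < real c * g * b n powr - \<alpha>} x * h \<omega>' x))"
      using AE_unit_leb_neq[of z]
    proof eventually_elim
      case (elim x)
      show ?case unfolding level_B[OF assms elim]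
        by (simp add: sum_distrib_right case_prod_unfold mult.assoc left_diff_distrib)
    qed
    show "(\<lambda>x. indicator (level (obs \<alpha> z) b B n i) x * h \<omega>' x) \<in> borel_measurable unit_leb"
      using integrable_indicator_mult[OF level_borel[OF B_borel] h_integrable] by (rule borel_measurable_integrable)
  qed (use bi in \<open>auto simp: case_prod_unfold intro!: borel_measurable_sum borel_measurable_times borel_measurable_diff borel_measurable_integrable\<close>)
  also have "\<dots> = (\<Sum>(a, c)\<in>F. in_slot g n a i * (ball_mass z \<omega>' (real (Suc c) * g * b n powr - \<alpha>) - ball_mass z \<omega>' (real c * g * b n powr - \<alpha>)))"
    unfolding ball_mass_def case_prod_unfold using bi
    by (subst Bochner_Integration.integral_sum) auto
  finally show ?thesis .
qed

text \<open>\<open>ball_mass_sums\<close> is an area formula for rectangles with a corner at the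
  origin of the grid coordinates. Each cell is a combination of four of them, which gives
  \<open>g * g\<close> per cell.\<close>

lemma hit_prob_sum_tendsto:
  "(\<lambda>n. \<Sum>i<K * n. \<integral>x. indicator (level (obs \<alpha> z) b B n i) x * h (shift (int i) \<omega>) x \<partial>unit_leb)
     \<longlonglongrightarrow> real (card F) * g\<^sup>2"
proof -
  define X where "X = (\<lambda>n c i. ball_mass z (shift (int i) \<omega>) (real (Suc c) * g * b n powr - \<alpha>) - ball_mass z (shift (int i) \<omega>) (real c * g * b n powr - \<alpha>))"
  have X: "(\<lambda>n. \<Sum>i<nat \<lfloor>t * real n\<rfloor>. X n c i) \<longlonglongrightarrow> t * g" if t: "0 \<le> t" for t c
  proof -
    have "(\<lambda>n. (\<Sum>i<nat \<lfloor>t * real n\<rfloor>. ball_mass z (shift (int i) \<omega>) (real (Suc c) * g * b n powr - \<alpha>)) -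
       (\<Sum>i<nat \<lfloor>t * real n\<rfloor>. ball_mass z (shift (int i) \<omega>) (real c * g * b n powr - \<alpha>))) \<longlonglongrightarrow> t * (real (Suc c) * g) - t * (real c * g)"
      using g by (intro tendsto_diff ball_mass_sums[OF z_unit r_pos scale \<omega> floor_ratio_tendsto[OF t]]) auto
    then show ?thesis unfolding X_def by (simp add: sum_subtractf algebra_simps)
  qed
  have "(\<lambda>n. \<Sum>(a, c)\<in>F. (\<Sum>i<nat \<lfloor>real (Suc a) * g * real n\<rfloor>. X n c i) - (\<Sum>i<nat \<lfloor>real a * g * real n\<rfloor>. X n c i))
     \<longlonglongrightarrow> (\<Sum>(a, c)\<in>F. real (Suc a) * g * g - real a * g * g)"
    unfolding case_prod_unfold using g by (intro tendsto_sum tendsto_diff X) auto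
  also have "(\<Sum>(a, c)\<in>F. real (Suc a) * g * g - real a * g * g) = real (card F) * g\<^sup>2"
    by (simp add: case_prod_unfold algebra_simps power2_eq_square)
  finally have lim: "(\<lambda>n. \<Sum>(a, c)\<in>F. (\<Sum>i<nat \<lfloor>real (Suc a) * g * real n\<rfloor>. X n c i) - (\<Sum>i<nat \<lfloor>real a * g * real n\<rfloor>. X n c i))
     \<longlonglongrightarrow> real (card F) * g\<^sup>2" .
  show ?thesis
  proof (rule Lim_transform_eventually[OF lim])
    show "\<forall>\<^sub>F n in sequentially. (\<Sum>(a, c)\<in>F. (\<Sum>i<nat \<lfloor>real (Suc a) * g * real n\<rfloor>. X n c i) - (\<Sum>i<nat \<lfloor>real a * g * real n\<rfloor>. X n c i))
       = (\<Sum>i<K * n. \<integral>x. indicator (level (obs \<alpha> z) b B n i) x * h (shift (int i) \<omega>) x \<partial>unit_leb)"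
      using eventually_ge_at_top[of 1]
    proof eventually_elim
      case (elim n)
      have "(\<Sum>i<K * n. \<integral>x. indicator (level (obs \<alpha> z) b B n i) x * h (shift (int i) \<omega>) x \<partial>unit_leb)
          = (\<Sum>i<K * n. \<Sum>(a, c)\<in>F. in_slot g n a i * X n c i)"
        unfolding hit_prob_level[OF elim] X_def ..
      also have "\<dots> = (\<Sum>ac\<in>F. \<Sum>i<K * n. in_slot g n (fst ac) i * X n (snd ac) i)"
        unfolding case_prod_unfold by (rule sum.swap)
      also have "\<dots> = (\<Sum>ac\<in>F. (\<Sum>i<nat \<lfloor>real (Suc (fst ac)) * g * real n\<rfloor>. X n (snd ac) i) - (\<Sum>i<nat \<lfloor>real (fst ac) * g * real n\<rfloor>. X n (snd ac) i))"
      proof (rule sum.cong[OF refl])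
        fix ac assume "ac \<in> F"
        then have "real (Suc (fst ac)) * g \<le> real K" using K[of "fst ac" "snd ac"] by simp
        then have "real (Suc (fst ac)) * g * real n \<le> real K * real n" by (intro mult_right_mono) auto
        then have "nat \<lfloor>real (Suc (fst ac)) * g * real n\<rfloor> \<le> K * n" by (simp add: nat_le_iff floor_le_iff)
        then show "(\<Sum>i<K * n. in_slot g n (fst ac) i * X n (snd ac) i) =
           (\<Sum>i<nat \<lfloor>real (Suc (fst ac)) * g * real n\<rfloor>. X n (snd ac) i) - (\<Sum>i<nat \<lfloor>real (fst ac) * g * real n\<rfloor>. X n (snd ac) i)"
          using g elim by (intro in_slot_sum) auto
      qed
      finally show ?case by (simp add: case_prod_unfold)
    qed
  qed
qed

lemma grid_poisson_limit:
  "(\<lambda>n. measure (sample_measure T \<omega>) {x \<in> {0..1}. hits (level (obs \<alpha> z) b B n) \<omega> (K * n) x = k})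
     \<longlonglongrightarrow> (real (card F) * g\<^sup>2) ^ k / fact k * exp (- (real (card F) * g\<^sup>2))"
proof -
  obtain S where S: "0 < S" "\<And>n i x. \<lbrakk>1 \<le> n; x \<in> level (obs \<alpha> z) b B n i\<rbrakk> \<Longrightarrow> \<bar>x - z\<bar> < S * b n powr - \<alpha>"
    using level_subset_ball by blast
  \<comment> \<open>A ball of radius \<open>S * b n powr - \<alpha>\<close> has size at most
    \<open>2 * S\<close> times \<open>2 / (c0 * n)\<close>; this is the value of
    \<open>\<kappa>\<close>.\<close>
  show ?thesis
  proof (rule poisson_limit[where \<kappa> = "4 * S / c0" and R = "real K" and \<Lambda> = "12 * real (card F)"])
    show "level (obs \<alpha> z) b B n i \<in> sets borel" for n i by (rule level_borel[OF B_borel])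
    show "\<forall>\<^sub>F n in sequentially. \<forall>i<K * n. (\<integral>x. indicator (level (obs \<alpha> z) b B n i) x \<partial>unit_leb) \<le> 4 * S / c0 / real n"
      using r_bound' eventually_ge_at_top[of 1]
    proof eventually_elim
      case (elim n)
      show ?case
      proof (intro allI impI)
        fix i
        have li: "integrable unit_leb (\<lambda>x. indicator (level (obs \<alpha> z) b B n i) x :: real)"
          using integrable_indicator_mult[OF level_borel[OF B_borel], of "\<lambda>_. 1" \<alpha> z b n i] by simp
        have "(\<integral>x. indicator (level (obs \<alpha> z) b B n i) x \<partial>unit_leb) \<le> ball_size z (S * b n powr - \<alpha>)"
          unfolding ball_size_def
          by (rule integral_mono[OF li ball_integrable]) (use S(2)[OF elim(2), of _ i] in \<open>auto simp: indicator_def\<close>)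
        also have "\<dots> \<le> 2 * (S * b n powr - \<alpha>)" using S(1) by (intro ball_size_le) auto
        also have "\<dots> = 2 * S * (real n * b n powr - \<alpha>) / real n" using elim(2) by simp
        also have "\<dots> \<le> 2 * S * (2 / c0) / real n"
          using S(1) elim(1) by (intro divide_right_mono mult_left_mono) auto
        finally show "(\<integral>x. indicator (level (obs \<alpha> z) b B n i) x \<partial>unit_leb) \<le> 4 * S / c0 / real n" by simp
      qed
    qed
    show "BV_le (\<lambda>x. indicator (level (obs \<alpha> z) b B n i) x * f x) (12 * real (card F) * c)" if "BV_le f c" for n i f c
      by (rule BV_le_level[OF that])
    show "\<forall>\<^sub>F n in sequentially. \<forall>i j x. i < j \<longrightarrow> j < K * n \<longrightarrow> j - i < q \<longrightarrow> x \<in> {0..1} \<longrightarrow> x \<in> level (obs \<alpha> z) b B n i \<longrightarrow>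
        rmap T (j - i) (shift (int i) \<omega>) x \<notin> level (obs \<alpha> z) b B n j" for q
    proof -
      \<comment> \<open>The targets of all times lie in one ball around \<open>z\<close>. Once its
        radius is below \<open>\<epsilon>\<close>, no point of it returns within fewer than
        \<open>q\<close> steps.\<close>
      obtain \<epsilon> where \<epsilon>: "0 < \<epsilon>" "\<And>i l x. \<lbrakk>1 \<le> l; l < q; x \<in> {0..1}; \<bar>x - z\<bar> < \<epsilon>\<rbrakk> \<Longrightarrow> \<epsilon> \<le> \<bar>rmap T l (shift (int i) \<omega>) x - z\<bar>"
        using no_short_returns[OF expanding z nr, of q] by blast
      have "(\<lambda>n. S * b n powr - \<alpha>) \<longlonglongrightarrow> S * 0" by (intro tendsto_intros r_tendsto_0')
      then have "\<forall>\<^sub>F n in sequentially. S * b n powr - \<alpha> < \<epsilon>" using \<epsilon> by (intro order_tendstoD(2)) auto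
      then show ?thesis using eventually_ge_at_top[of 1]
      proof eventually_elim
        case (elim n)
        show ?case
        proof (intro allI impI notI)
          fix i j x assume ij: "i < j" "j - i < q" "x \<in> {0..1}" and x: "x \<in> level (obs \<alpha> z) b B n i"
            and y: "rmap T (j - i) (shift (int i) \<omega>) x \<in> level (obs \<alpha> z) b B n j"
          have "\<bar>x - z\<bar> < \<epsilon>" using S(2)[OF elim(2) x] elim(1) by linarith
          from \<epsilon>(2)[OF _ ij(2,3) this, of i] ij(1) have "\<epsilon> \<le> \<bar>rmap T (j - i) (shift (int i) \<omega>) x - z\<bar>" by simp
          then show False using S(2)[OF elim(2) y] elim(1) by linarith
        qed
      qed
    qed
  qed (use S(1) c0_pos hit_prob_sum_tendsto in auto)
qed

end

end

end

section \<open>The intensity measure\<close>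

lemma sets_stable_levy [simp, measurable_cong]: "sets (stable_levy \<alpha>) = sets borel"
  by (simp add: stable_levy_def)

lemma space_stable_levy [simp]: "space (stable_levy \<alpha>) = UNIV"
  by (simp add: stable_levy_def)

lemma stable_levy_density_measurable:
  "(\<lambda>x. ennreal (if 0 < x then \<alpha> * x powr (- \<alpha> - 1) else 0)) \<in> borel_measurable lborel"
  by measurable

lemma sigma_finite_stable_levy: "sigma_finite_measure (stable_levy \<alpha>)"
  unfolding stable_levy_def
  using sigma_finite_measure.sigma_finite_iff_density_finite[OF sigma_finite_lborel stable_levy_density_measurable[of \<alpha>]]
  by simp

text \<open>The density has the primitive \<open>- (x powr - \<alpha>)\<close>. Hence
  \<open>y powr - \<alpha>\<close> is the coordinate that carries the Levy measure to Lebesgue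
  measure on the half-line.\<close>

lemma stable_levy_ray:
  assumes \<alpha>: "0 < \<alpha>" and v: "0 \<le> v"
  shows "emeasure (stable_levy \<alpha>) {y. 0 < y \<and> y powr - \<alpha> < v} = ennreal v"
proof (cases "v = 0")
  case True
  then have "{y. 0 < y \<and> y powr - \<alpha> < v} = {}" by (auto simp: not_less)
  then show ?thesis using True by simp
next
  case False
  define a where "a = v powr (- 1 / \<alpha>)"
  have a: "0 < a" using False by (simp add: a_def)
  have av: "a powr - \<alpha> = v" using \<alpha> v False by (simp add: a_def powr_powr)
  have eq: "{y. 0 < y \<and> y powr - \<alpha> < v} = {a<..}"
  proof -
    have "y powr - \<alpha> < v \<longleftrightarrow> a < y" if "0 < y" for y
      using powr_less_mono2_neg[of "- \<alpha>" a y] powr_less_mono2_neg[of "- \<alpha>" y a] \<alpha> a that av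
      by (cases a y rule: linorder_cases) auto
    then show ?thesis using a by auto
  qed
  have "emeasure (stable_levy \<alpha>) {a<..} =
      (\<integral>\<^sup>+x. ennreal (if 0 < x then \<alpha> * x powr (- \<alpha> - 1) else 0) * indicator {a<..} x \<partial>lborel)"
    unfolding stable_levy_def by (subst emeasure_density) (auto intro: stable_levy_density_measurable)
  also have "\<dots> = (\<integral>\<^sup>+x. ennreal (\<alpha> * x powr (- \<alpha> - 1)) * indicator {a..} x \<partial>lborel)"
    using a by (intro nn_integral_cong_AE eventually_mono[OF AE_lborel_singleton[of a]]) (auto simp: indicator_def)
  also have "\<dots> = ennreal (0 - (- (a powr - \<alpha>)))"
  proof (rule nn_integral_FTC_atLeast[where F = "\<lambda>x. - (x powr - \<alpha>)"])
    show "DERIV (\<lambda>x. - (x powr - \<alpha>)) x :> \<alpha> * x powr (- \<alpha> - 1)" if "a \<le> x" for x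
      using that a by (auto intro!: derivative_eq_intros)
    have "((\<lambda>x. x powr - \<alpha>) \<longlongrightarrow> 0) at_top"
      using \<alpha> by (intro tendsto_neg_powr filterlim_ident) auto
    from tendsto_minus[OF this] show "((\<lambda>x. - (x powr - \<alpha>)) \<longlongrightarrow> 0) at_top" by simp
  qed (use \<alpha> in auto)
  finally show ?thesis by (simp add: eq av)
qed

lemma stable_levy_slot:
  assumes \<alpha>: "0 < \<alpha>" and u: "0 \<le> u" "u \<le> v"
  shows "emeasure (stable_levy \<alpha>) {y. 0 < y \<and> u \<le> y powr - \<alpha> \<and> y powr - \<alpha> < v} = ennreal (v - u)"
proof -
  let ?R = "\<lambda>v. {y::real. 0 < y \<and> y powr - \<alpha> < v}"
  have R: "?R v \<in> sets (stable_levy \<alpha>)" for v by measurable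
  have eq: "{y. 0 < y \<and> u \<le> y powr - \<alpha> \<and> y powr - \<alpha> < v} = ?R v - ?R u" by auto
  have "emeasure (stable_levy \<alpha>) (?R v - ?R u) = emeasure (stable_levy \<alpha>) (?R v) - emeasure (stable_levy \<alpha>) (?R u)"
    using u \<alpha> by (intro emeasure_Diff R) (auto simp: stable_levy_ray)
  also have "\<dots> = ennreal (v - u)" using \<alpha> u by (simp add: stable_levy_ray ennreal_minus)
  finally show ?thesis unfolding eq .
qed

lemma stable_levy_nonpos: "emeasure (stable_levy \<alpha>) {..0} = 0"
proof -
  have "emeasure (stable_levy \<alpha>) {..0} =
      (\<integral>\<^sup>+x. ennreal (if 0 < x then \<alpha> * x powr (- \<alpha> - 1) else 0) * indicator {..0} x \<partial>lborel)"
    unfolding stable_levy_def by (subst emeasure_density) (auto intro: stable_levy_density_measurable)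
  also have "\<dots> = (\<integral>\<^sup>+x. 0 \<partial>(lborel :: real measure))" by (intro nn_integral_cong) (auto simp: indicator_def)
  finally show ?thesis by simp
qed

lemma open_time_size_space: "open time_size_space"
  unfolding time_size_space_def by (intro open_Times) auto

lemma sets_pair_lborel_stable: "sets (lborel \<Otimes>\<^sub>M stable_levy \<alpha>) = sets borel"
proof -
  have "sets (lborel \<Otimes>\<^sub>M stable_levy \<alpha>) = sets (borel \<Otimes>\<^sub>M (borel :: real measure))"
    by (intro sets_pair_measure_cong) auto
  then show ?thesis unfolding borel_prod .
qed

lemma space_intensity [simp]: "space (intensity \<alpha>) = time_size_space"
  by (simp add: intensity_def space_restrict_space space_pair_measure)

lemma time_size_space_sets:
  "time_size_space \<inter> space (lborel \<Otimes>\<^sub>M stable_levy \<alpha>) \<in> sets (lborel \<Otimes>\<^sub>M stable_levy \<alpha>)"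
proof -
  have "time_size_space \<in> sets (lborel \<Otimes>\<^sub>M stable_levy \<alpha>)"
    unfolding sets_pair_lborel_stable using open_time_size_space by (rule borel_open)
  then show ?thesis by (rule sets.Int[OF _ sets.top])
qed

lemma sets_intensity_I: "B \<in> sets borel \<Longrightarrow> B \<subseteq> time_size_space \<Longrightarrow> B \<in> sets (intensity \<alpha>)"
  unfolding intensity_def sets_restrict_space_iff[OF time_size_space_sets] sets_pair_lborel_stable
  by simp

lemma emeasure_intensity:
  "B \<subseteq> time_size_space \<Longrightarrow> emeasure (intensity \<alpha>) B = emeasure (lborel \<Otimes>\<^sub>M stable_levy \<alpha>) B"
  unfolding intensity_def by (rule emeasure_restrict_space[OF time_size_space_sets])

lemma grid_cell_subset: "0 < g \<Longrightarrow> grid_cell \<alpha> g c \<subseteq> time_size_space"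
  using grid_cell_time[of g \<alpha> c] unfolding time_size_space_def grid_cell_def by (auto split: prod.splits)

lemma emeasure_grid_cell:
  assumes \<alpha>: "0 < \<alpha>" and g: "0 < g"
  shows "emeasure (intensity \<alpha>) (grid_cell \<alpha> g c) = ennreal (g\<^sup>2)"
proof -
  interpret S: sigma_finite_measure "stable_levy \<alpha>" by (rule sigma_finite_stable_levy)
  obtain a d where c: "c = (a, d)" by force
  have "emeasure (intensity \<alpha>) (grid_cell \<alpha> g c) = emeasure (lborel \<Otimes>\<^sub>M stable_levy \<alpha>) (grid_cell \<alpha> g c)"
    by (rule emeasure_intensity[OF grid_cell_subset[OF g]])
  also have "\<dots> = emeasure lborel {real a * g<..real (Suc a) * g} *
      emeasure (stable_levy \<alpha>) {y. 0 < y \<and> real d * g \<le> y powr - \<alpha> \<and> y powr - \<alpha> < real (Suc d) * g}"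
    unfolding grid_cell_def c prod.case by (rule S.emeasure_pair_measure_Times) (auto simp: size_slot_borel)
  also have "\<dots> = ennreal (real (Suc a) * g - real a * g) * ennreal (real (Suc d) * g - real d * g)"
    using \<alpha> g by (subst stable_levy_slot) (auto simp: mult_right_mono)
  also have "\<dots> = ennreal (g\<^sup>2)"
    using g by (simp add: distrib_right power2_eq_square ennreal_mult)
  finally show ?thesis .
qed

lemma emeasure_grid_cells:
  assumes \<alpha>: "0 < \<alpha>" and g: "0 < g" and F: "finite F"
  shows "emeasure (intensity \<alpha>) (\<Union>c\<in>F. grid_cell \<alpha> g c) = ennreal (real (card F) * g\<^sup>2)"
proof -
  have "emeasure (intensity \<alpha>) (\<Union>c\<in>F. grid_cell \<alpha> g c) = (\<Sum>c\<in>F. emeasure (intensity \<alpha>) (grid_cell \<alpha> g c))"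
  proof (rule sum_emeasure[symmetric])
    show "disjoint_family_on (grid_cell \<alpha> g) F"
      unfolding disjoint_family_on_def using grid_cell_disjoint[OF g] by blast
  qed (use F sets_intensity_I[OF grid_cell_borel grid_cell_subset[OF g]] in auto)
  also have "\<dots> = (\<Sum>c\<in>F. ennreal (g\<^sup>2))" by (simp add: emeasure_grid_cell[OF \<alpha> g])
  also have "\<dots> = ennreal (\<Sum>c\<in>F. g\<^sup>2)" by (rule sum_ennreal) auto
  finally show ?thesis by simp
qed

lemma measure_grid_cells:
  assumes "0 < \<alpha>" "0 < g" "finite F"
  shows "measure (intensity \<alpha>) (\<Union>c\<in>F. grid_cell \<alpha> g c) = real (card F) * g\<^sup>2"
  using emeasure_grid_cells[OF assms] by (simp add: measure_def)

lemma grid_cells_borel: "finite F \<Longrightarrow> (\<Union>c\<in>F. grid_cell \<alpha> g c) \<in> sets borel"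
  using grid_cell_borel by (intro sets.finite_UN) auto

lemma grid_cells_sets:
  assumes "0 < g" "finite F" shows "(\<Union>c\<in>F. grid_cell \<alpha> g c) \<in> sets (intensity \<alpha>)"
  using grid_cell_subset[OF assms(1)] by (intro sets_intensity_I grid_cells_borel[OF assms(2)] UN_least)

section \<open>Restriction to positive sizes\<close>

definition positive_part :: "(real \<times> real) set \<Rightarrow> (real \<times> real) set" where
  "positive_part B = B \<inter> (UNIV \<times> {0<..})"

lemma positive_part_borel: "B \<in> sets borel \<Longrightarrow> positive_part B \<in> sets borel"
proof -
  have "UNIV \<times> {0::real<..} \<in> sets (borel :: (real \<times> real) measure)"
    unfolding borel_prod[symmetric] by auto
  then show "B \<in> sets borel \<Longrightarrow> positive_part B \<in> sets borel" unfolding positive_part_def by auto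
qed

text \<open>The Levy measure vanishes on nonpositive sizes. The observable is nonnegative as well,
  so a test set and its positive part agree both for the counts and for the limit.\<close>

lemma positive_part_intensity:
  assumes B: "B \<in> sets borel" "B \<subseteq> time_size_space"
  shows "emeasure (intensity \<alpha>) (positive_part B) = emeasure (intensity \<alpha>) B"
proof (rule emeasure_eq_AE)
  interpret S: sigma_finite_measure "stable_levy \<alpha>" by (rule sigma_finite_stable_levy)
  show "positive_part B \<in> sets (intensity \<alpha>)"
    using B by (intro sets_intensity_I positive_part_borel) (auto simp: positive_part_def)
  show "B \<in> sets (intensity \<alpha>)" using B by (rule sets_intensity_I)
  let ?N = "(UNIV \<times> {..0}) \<inter> time_size_space :: (real \<times> real) set"
  have "UNIV \<times> {..0::real} \<in> sets (borel :: (real \<times> real) measure)"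
    unfolding borel_prod[symmetric] by auto
  then have N: "?N \<in> sets (intensity \<alpha>)"
    using open_time_size_space by (intro sets_intensity_I) auto
  have "(UNIV :: real set) \<times> {..0} \<in> sets (lborel \<Otimes>\<^sub>M stable_levy \<alpha>)"
    by (rule pair_measureI) auto
  then have "emeasure (lborel \<Otimes>\<^sub>M stable_levy \<alpha>) ?N \<le> emeasure (lborel \<Otimes>\<^sub>M stable_levy \<alpha>) ((UNIV :: real set) \<times> {..0})"
    by (intro emeasure_mono) auto
  then have "emeasure (intensity \<alpha>) ?N \<le> emeasure (lborel \<Otimes>\<^sub>M stable_levy \<alpha>) ((UNIV :: real set) \<times> {..0})"
    by (subst emeasure_intensity) auto
  also have "\<dots> = emeasure lborel (UNIV :: real set) * emeasure (stable_levy \<alpha>) {..0}"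
    by (rule S.emeasure_pair_measure_Times) auto
  also have "\<dots> = 0" by (simp add: stable_levy_nonpos)
  finally have "?N \<in> null_sets (intensity \<alpha>)" using N by (simp add: null_sets_def)
  from AE_not_in[OF this] show "AE x in intensity \<alpha>. x \<in> positive_part B \<longleftrightarrow> x \<in> B"
  proof eventually_elim
    case (elim x)
    then show ?case using B(2) unfolding positive_part_def by (cases x) auto
  qed
qed

section \<open>Approximation of test sets by grid cells\<close>

definition grid_index :: "nat \<Rightarrow> nat \<Rightarrow> nat \<Rightarrow> (nat \<times> nat) set" where
  "grid_index K S N = {..<K * N} \<times> {..<S * N}"

definition inner_cells :: "real \<Rightarrow> nat \<Rightarrow> nat \<Rightarrow> (real \<times> real) set \<Rightarrow> nat \<Rightarrow> (nat \<times> nat) set" where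
  "inner_cells \<alpha> K S B N = {c \<in> grid_index K S N. grid_cell \<alpha> (1 / real N) c \<subseteq> B}"

definition boundary_cells :: "real \<Rightarrow> nat \<Rightarrow> nat \<Rightarrow> (real \<times> real) set \<Rightarrow> nat \<Rightarrow> (nat \<times> nat) set" where
  "boundary_cells \<alpha> K S B N =
     {c \<in> grid_index K S N. \<not> grid_cell \<alpha> (1 / real N) c \<subseteq> B \<and> grid_cell \<alpha> (1 / real N) c \<inter> B \<noteq> {}}"

lemma finite_cells: "finite (inner_cells \<alpha> K S B N)" "finite (boundary_cells \<alpha> K S B N)" "finite (grid_index K S N)"
  unfolding inner_cells_def boundary_cells_def grid_index_def by auto

lemma grid_index_time:
  assumes "1 \<le> N" "(a, c) \<in> grid_index K S N" shows "real (Suc a) * (1 / real N) \<le> real K"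
proof -
  have "Suc a \<le> K * N" using assms unfolding grid_index_def by auto
  then have "real (Suc a) \<le> real K * real N" by (metis of_nat_le_iff of_nat_mult)
  then show ?thesis using assms by (simp add: field_simps)
qed

lemma grid_index_cover:
  assumes N: "1 \<le> N" and t: "0 < t" "t \<le> real K" and y: "0 < y" "y powr - \<alpha> < real S"
  shows "\<exists>c\<in>grid_index K S N. (t, y) \<in> grid_cell \<alpha> (1 / real N) c"
proof -
  \<comment> \<open>Time slots are open on the left, hence the ceiling minus 1; size slots are
    closed on the left, hence the floor.\<close>
  define a where "a = nat (\<lceil>t * real N\<rceil> - 1)"
  define c where "c = nat \<lfloor>y powr - \<alpha> * real N\<rfloor>"
  have N0: "0 < real N" using N by simp
  have tN: "0 < t * real N" using t N0 by simp
  then have "1 \<le> \<lceil>t * real N\<rceil>" by linarith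
  then have ra: "real a = real_of_int \<lceil>t * real N\<rceil> - 1" by (simp add: a_def)
  have a: "real a < t * real N" "t * real N \<le> real (Suc a)" using ra by (simp_all, linarith+)
  have rc: "real c = real_of_int \<lfloor>y powr - \<alpha> * real N\<rfloor>" using N0 by (simp add: c_def)
  have c: "real c \<le> y powr - \<alpha> * real N" "y powr - \<alpha> * real N < real (Suc c)" using rc by (simp_all, linarith+)
  have "t * real N \<le> real K * real N" using t N0 by (intro mult_right_mono) auto
  then have "real a < real (K * N)" using a by simp
  then have 1: "a < K * N" by (simp only: of_nat_less_iff)
  have "y powr - \<alpha> * real N < real S * real N" using y N0 by (intro mult_strict_right_mono) auto
  then have "real c < real (S * N)" using c by simp
  then have 2: "c < S * N" by (simp only: of_nat_less_iff)
  have "(t, y) \<in> grid_cell \<alpha> (1 / real N) (a, c)"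
    using a c y(1) N0 unfolding grid_cell_def by (auto simp: pos_divide_less_eq pos_le_divide_eq pos_divide_le_eq pos_less_divide_eq simp del: of_nat_Suc)
  then show ?thesis using 1 2 unfolding grid_index_def by auto
qed

text \<open>The cells are small squares only in the coordinates
  \<open>(time, size powr - \<alpha>)\<close>; in the original ones they may even be unbounded. The
  neighbourhood is therefore pulled back by the inverse coordinate map \<open>\<Phi>\<close>, which
  is continuous at points of positive size.\<close>

lemma grid_cell_small:
  assumes \<alpha>: "0 < \<alpha>" and W: "open W" "(t, y) \<in> W" and y: "0 < y"
  shows "\<forall>\<^sub>F N in sequentially. \<forall>c. (t, y) \<in> grid_cell \<alpha> (1 / real N) c \<longrightarrow> grid_cell \<alpha> (1 / real N) c \<subseteq> W"
proof -
  let ?w = "y powr - \<alpha>"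
  define \<Phi> where "\<Phi> = (\<lambda>q::real \<times> real. (fst q, snd q powr (- 1 / \<alpha>)))"
  have inv: "(x powr - \<alpha>) powr (- 1 / \<alpha>) = x" if "0 < x" for x :: real
    using that \<alpha> by (simp add: powr_powr)
  have "isCont \<Phi> (t, ?w)" unfolding \<Phi>_def using y by (intro continuous_intros) auto
  moreover have "\<Phi> (t, ?w) \<in> W" using W(2) inv[OF y] by (simp add: \<Phi>_def)
  ultimately have "\<forall>\<^sub>F q in nhds (t, ?w). \<Phi> q \<in> W"
    using W(1) unfolding isCont_def by (intro topological_tendstoD[of \<Phi> "\<Phi> (t, ?w)"]) (auto simp: tendsto_at_iff_tendsto_nhds)
  then obtain d where d: "0 < d" "\<And>q. dist q (t, ?w) < d \<Longrightarrow> \<Phi> q \<in> W"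
    unfolding eventually_nhds_metric by auto
  have "\<forall>\<^sub>F N in sequentially. 1 / real N < d / 2"
    using d by (intro order_tendstoD(2)[OF lim_1_over_n]) auto
  then show ?thesis
  proof eventually_elim
    case (elim N)
    show ?case
    proof (intro allI impI subsetI)
      fix c q assume c: "(t, y) \<in> grid_cell \<alpha> (1 / real N) c" and q: "q \<in> grid_cell \<alpha> (1 / real N) c"
      obtain t' y' where q': "q = (t', y')" by force
      have y': "0 < y'" using q q' unfolding grid_cell_def by (auto split: prod.splits)
      have "\<bar>t' - t\<bar> \<le> 1 / real N" "\<bar>y' powr - \<alpha> - ?w\<bar> \<le> 1 / real N"
        using c q q' unfolding grid_cell_def by (auto split: prod.splits simp: abs_le_iff add_divide_distrib)
      then have "dist (t', y' powr - \<alpha>) (t, ?w) < d"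
        using elim sqrt_sum_squares_le_sum_abs[of "t' - t" "y' powr - \<alpha> - ?w"]
        unfolding dist_Pair_Pair dist_real_def by (simp add: power2_abs)
      from d(2)[OF this] show "q \<in> W" using inv[OF y'] by (simp add: \<Phi>_def q')
    qed
  qed
qed

text \<open>A point off the frontier has a neighbourhood inside \<open>B\<close> or disjoint from
  it, and for large \<open>N\<close> the cell containing the point lies in that
  neighbourhood.\<close>

lemma boundary_cells_vanish:
  assumes \<alpha>: "0 < \<alpha>" and z: "z \<in> time_size_space" "z \<notin> top_of_set time_size_space frontier_of B"
    and B: "B \<subseteq> time_size_space"
  shows "\<forall>\<^sub>F N in sequentially. z \<notin> (\<Union>c\<in>boundary_cells \<alpha> K S B N. grid_cell \<alpha> (1 / real N) c)"
proof -
  let ?X = "top_of_set time_size_space"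
  obtain t y where ty: "z = (t, y)" by force
  obtain W where W: "open W" "z \<in> W" "W \<subseteq> B \<or> W \<inter> B = {}"
  proof (cases "z \<in> ?X closure_of B")
    case True
    then have "z \<in> ?X interior_of B" using z(2) by (simp add: frontier_of_def)
    moreover have "open (?X interior_of B)"
      using openin_interior_of[of ?X B] open_time_size_space openin_open_eq by blast
    ultimately show ?thesis using that interior_of_subset[of ?X B] by blast
  next
    case False
    have "openin ?X (topspace ?X - ?X closure_of B)" using closedin_closure_of by (rule openin_diff[OF openin_topspace])
    then have "open (time_size_space - ?X closure_of B)"
      using open_time_size_space openin_open_eq by auto
    moreover have "B \<subseteq> ?X closure_of B" using B by (intro closure_of_subset) auto
    ultimately show ?thesis using that[of "time_size_space - ?X closure_of B"] False z(1) by blast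
  qed
  show ?thesis
  proof (cases "0 < y")
    case True
    have "\<forall>\<^sub>F N in sequentially. \<forall>c. (t, y) \<in> grid_cell \<alpha> (1 / real N) c \<longrightarrow> grid_cell \<alpha> (1 / real N) c \<subseteq> W"
      using W(2) by (intro grid_cell_small[OF \<alpha> W(1) _ True]) (simp add: ty)
    then show ?thesis
    proof eventually_elim
      case (elim N)
      then show ?case using W(3) unfolding ty boundary_cells_def by blast
    qed
  next
    case False
    then have "z \<notin> grid_cell \<alpha> g c" for g c unfolding ty grid_cell_def by (auto split: prod.splits)
    then show ?thesis by simp
  qed
qed

text \<open>Dominated convergence: the indicators tend to 0 off the frontier, which is a null set,
  and all cells lie in the rectangle formed by the cells of side 1, whose intensity is
  finite.\<close>

lemma boundary_cells_measure_tendsto: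
  assumes \<alpha>: "0 < \<alpha>" and B: "B \<subseteq> time_size_space"
    and fr: "emeasure (intensity \<alpha>) (top_of_set time_size_space frontier_of B) = 0"
  shows "(\<lambda>N. measure (intensity \<alpha>) (\<Union>c\<in>boundary_cells \<alpha> K S B N. grid_cell \<alpha> (1 / real N) c)) \<longlonglongrightarrow> 0"
proof -
  let ?V = "\<lambda>N. \<Union>c\<in>boundary_cells \<alpha> K S B N. grid_cell \<alpha> (1 / real N) c"
  let ?Z = "\<Union>c\<in>grid_index K S 1. grid_cell \<alpha> 1 c"
  let ?Fr = "top_of_set time_size_space frontier_of B"
  have Zs: "?Z \<in> sets (intensity \<alpha>)" by (intro grid_cells_sets finite_cells) simp
  have Zfin: "emeasure (intensity \<alpha>) ?Z < \<infinity>"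
    by (subst emeasure_grid_cells[OF \<alpha>]) (auto intro: finite_cells)
  have Vs: "?V N \<in> sets (intensity \<alpha>)" if "1 \<le> N" for N
    using that by (intro grid_cells_sets finite_cells) simp
  have VZ: "?V N \<subseteq> ?Z" if N: "1 \<le> N" for N
  proof
    fix q assume "q \<in> ?V N"
    then obtain a c where ac: "a < K * N" "c < S * N" "q \<in> grid_cell \<alpha> (1 / real N) (a, c)"
      unfolding boundary_cells_def grid_index_def by auto
    obtain t y where q: "q = (t, y)" by force
    have N0: "0 < real N" using N by simp
    have 1: "0 < t" using ac(3) N0 q unfolding grid_cell_def by (auto intro: le_less_trans[rotated])
    have "(a, c) \<in> grid_index K S N" using ac by (simp add: grid_index_def)
    then have "t \<le> real K"
      using ac(3) q grid_index_time[OF N, of a c K S] unfolding grid_cell_def by auto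
    moreover have "y powr - \<alpha> < real S"
    proof -
      have "real (Suc c) \<le> real (S * N)" using ac(2) by (simp only: of_nat_le_iff Suc_leI)
      then have "real (Suc c) * (1 / real N) \<le> real S" using N0 by (simp add: field_simps)
      then show ?thesis using ac(3) q unfolding grid_cell_def by auto
    qed
    moreover have "0 < y" using ac(3) q unfolding grid_cell_def by auto
    ultimately show "q \<in> ?Z" using grid_index_cover[of 1 t K y \<alpha> S] 1 by (simp add: q)
  qed
  have frs: "?Fr \<in> sets (intensity \<alpha>)"
  proof -
    obtain C where "closed C" "?Fr = time_size_space \<inter> C"
      using closedin_frontier_of[of "top_of_set time_size_space" B] unfolding closedin_closed by blast
    then show ?thesis using open_time_size_space by (intro sets_intensity_I) auto
  qed
  have AEfr: "AE x in intensity \<alpha>. x \<notin> ?Fr"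
    using fr frs by (intro AE_not_in) (simp add: null_sets_def)
  \<comment> \<open>The facts above hold for \<open>N \<ge> 1\<close>; replacing the term
    \<open>N = 0\<close> does not affect the limit.\<close>
  let ?V' = "\<lambda>N. if 1 \<le> N then ?V N else {}"
  have Vs': "?V' N \<in> sets (intensity \<alpha>)" for N using Vs[of N] by auto
  have "(\<lambda>N. \<integral>x. indicator (?V' N) x \<partial>intensity \<alpha>) \<longlonglongrightarrow> (\<integral>x. (0::real) \<partial>intensity \<alpha>)"
  proof (rule integral_dominated_convergence[where w = "indicator ?Z"])
    show "(\<lambda>x. indicator (?V' N) x :: real) \<in> borel_measurable (intensity \<alpha>)" for N
      using Vs' by (rule borel_measurable_indicator)
    show "integrable (intensity \<alpha>) (indicator ?Z :: _ \<Rightarrow> real)" using Zs Zfin by (intro integrable_real_indicator)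
    show "AE x in intensity \<alpha>. (\<lambda>N. indicator (?V' N) x :: real) \<longlonglongrightarrow> 0"
      using AEfr AE_space
    proof eventually_elim
      case (elim x)
      then have "\<forall>\<^sub>F N in sequentially. x \<notin> ?V N" by (intro boundary_cells_vanish[OF \<alpha> _ _ B]) auto
      then have "\<forall>\<^sub>F N in sequentially. indicator (?V' N) x = (0::real)" by eventually_elim auto
      then show ?case by (rule tendsto_eventually)
    qed
    show "AE x in intensity \<alpha>. norm (indicator (?V' N) x :: real) \<le> indicator ?Z x" for N
      using VZ[of N] by (intro AE_I2) (auto simp: indicator_def)
  qed auto
  moreover have "(\<integral>x. indicator (?V' N) x \<partial>intensity \<alpha>) = measure (intensity \<alpha>) (?V' N)" for N
    using sets.sets_into_space[OF Vs'[of N]] by (simp add: Int_absorb2)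
  ultimately have "(\<lambda>N. measure (intensity \<alpha>) (?V' N)) \<longlonglongrightarrow> 0" by simp
  then show ?thesis
  proof (rule Lim_transform_eventually)
    show "\<forall>\<^sub>F N in sequentially. measure (intensity \<alpha>) (?V' N) = measure (intensity \<alpha>) (?V N)"
      using eventually_ge_at_top[of 1] by eventually_elim simp
  qed
qed

section \<open>Convergence of the point processes\<close>

text \<open>For variables with values in the natural numbers the distribution function at
  \<open>y\<close> is a finite sum of point masses, so it converges at every
  \<open>y\<close>.\<close>

lemma weak_conv_m_nat:
  fixes X :: "nat \<Rightarrow> 'a \<Rightarrow> nat" and Y :: "'w \<Rightarrow> real"
  assumes S: "prob_space S" and Q: "prob_space Q"
    and X: "\<And>n. X n \<in> measurable S (count_space UNIV)" and Y: "Y \<in> borel_measurable Q"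
    and nat: "AE w in Q. Y w \<in> range real"
    and lim: "\<And>k. (\<lambda>n. measure S {x \<in> space S. X n x = k}) \<longlonglongrightarrow> measure Q {w \<in> space Q. Y w = real k}"
  shows "weak_conv_m (\<lambda>n. distr S borel (\<lambda>x. real (X n x))) (distr Q borel Y)"
  unfolding weak_conv_m_def weak_conv_def
proof (intro allI impI)
  fix y
  interpret S: prob_space S by (rule S)
  interpret Q: prob_space Q by (rule Q)
  let ?I = "{k. real k \<le> y}"
  have fin: "finite ?I"
  proof (rule finite_subset)
    show "?I \<subseteq> {..nat \<lfloor>y\<rfloor>}" by (auto simp: le_nat_floor)
  qed auto
  have Xr: "(\<lambda>x. real (X n x)) \<in> borel_measurable S" for n
    using measurable_compose[OF X, of real borel] by simp
  have Xs: "{x \<in> space S. X n x = k} \<in> sets S" for n k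
    using measurable_sets[OF X, of "{k}" n] by (simp add: vimage_def Int_def conj_commute)
  have Ys: "{w \<in> space Q. Y w = c} \<in> sets Q" for c
    using measurable_sets[OF Y, of "{c}"] by (simp add: vimage_def Int_def conj_commute)
  have "cdf (distr S borel (\<lambda>x. real (X n x))) y = (\<Sum>k\<in>?I. measure S {x \<in> space S. X n x = k})" for n
  proof -
    have "cdf (distr S borel (\<lambda>x. real (X n x))) y = measure S (\<Union>k\<in>?I. {x \<in> space S. X n x = k})"
      unfolding cdf_def using Xr
      by (subst measure_distr) (auto intro!: arg_cong[where f = "measure S"])
    also have "\<dots> = (\<Sum>k\<in>?I. measure S {x \<in> space S. X n x = k})"
      using fin Xs by (intro S.finite_measure_finite_Union) (auto simp: disjoint_family_on_def)
    finally show ?thesis .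
  qed
  moreover have "cdf (distr Q borel Y) y = (\<Sum>k\<in>?I. measure Q {w \<in> space Q. Y w = real k})"
  proof -
    have "cdf (distr Q borel Y) y = measure Q (Y -` {..y} \<inter> space Q)"
      unfolding cdf_def using Y by (subst measure_distr) auto
    also have "\<dots> = measure Q (\<Union>k\<in>?I. {w \<in> space Q. Y w = real k})"
    proof (rule measure_eq_AE)
      show "AE w in Q. w \<in> Y -` {..y} \<inter> space Q \<longleftrightarrow> w \<in> (\<Union>k\<in>?I. {w \<in> space Q. Y w = real k})"
        using nat by eventually_elim auto
    qed (use Y Ys fin in auto)
    also have "\<dots> = (\<Sum>k\<in>?I. measure Q {w \<in> space Q. Y w = real k})"
      using fin Ys by (intro Q.finite_measure_finite_Union) (auto simp: disjoint_family_on_def)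
    finally show ?thesis .
  qed
  ultimately show "(\<lambda>n. cdf (distr S borel (\<lambda>x. real (X n x))) y) \<longlonglongrightarrow> cdf (distr Q borel Y) y"
    by (simp add: tendsto_sum lim)
qed

text \<open>\<open>measure\<close> is 0 on sets of infinite count, which could be confused with an
  empty count. Because the Poisson weights sum up to 1, the count is almost surely finite, and there
  \<open>measure\<close> and \<open>emeasure\<close> agree.\<close>

lemma poisson_point_process_count:
  assumes N: "poisson_point_process Q N \<mu>" and B: "B \<in> sets \<mu>" "emeasure \<mu> B < \<infinity>"
  shows "(\<lambda>w. measure (N w) B) \<in> borel_measurable Q"
    "AE w in Q. measure (N w) B \<in> range real"
    "measure Q {w \<in> space Q. measure (N w) B = real k} = measure \<mu> B ^ k / fact k * exp (- measure \<mu> B)"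
proof -
  let ?l = "measure \<mu> B"
  interpret Q: prob_space Q using N unfolding poisson_point_process_def by simp
  have m: "(\<lambda>w. emeasure (N w) B) \<in> borel_measurable Q"
    using N B unfolding poisson_point_process_def by blast
  have P: "measure Q {w \<in> space Q. emeasure (N w) B = of_nat k} = ?l ^ k / fact k * exp (- ?l)" for k
    using N B unfolding poisson_point_process_def by blast
  have ms: "{w \<in> space Q. emeasure (N w) B = of_nat k} \<in> sets Q" for k
    using measurable_sets[OF m, of "{of_nat k}"] by (simp add: vimage_def Int_def conj_commute)
  show Ym: "(\<lambda>w. measure (N w) B) \<in> borel_measurable Q"
    using m unfolding measure_def by (rule measurable_compose) simp
  have "(\<lambda>k. ?l ^ k / fact k * exp (- ?l)) sums (exp ?l * exp (- ?l))"
    using sums_mult2[OF exp_converges[of ?l], of "exp (- ?l)"] by (simp add: field_simps)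
  then have one: "(\<lambda>k. ?l ^ k / fact k * exp (- ?l)) sums 1" by (simp add: exp_minus)
  have "(\<lambda>k. measure Q {w \<in> space Q. emeasure (N w) B = of_nat k}) sums measure Q (\<Union>k. {w \<in> space Q. emeasure (N w) B = of_nat k})"
    using ms by (intro Q.finite_measure_UNION) (auto simp: disjoint_family_on_def)
  with one have "measure Q (\<Union>k. {w \<in> space Q. emeasure (N w) B = of_nat k}) = 1"
    unfolding P using sums_unique2 by blast
  then have "AE w in Q. w \<in> (\<Union>k. {w \<in> space Q. emeasure (N w) B = of_nat k})"
    using ms by (subst (asm) Q.prob_eq_1) auto
  then have AE: "AE w in Q. \<exists>k::nat. emeasure (N w) B = of_nat k" by eventually_elim auto
  have val: "measure (N w) B = real k" if "emeasure (N w) B = of_nat k" for w k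
    using that by (simp add: measure_def flip: ennreal_of_nat_eq_real_of_nat)
  show "AE w in Q. measure (N w) B \<in> range real"
    using AE by eventually_elim (auto dest!: val)
  have "measure Q {w \<in> space Q. measure (N w) B = real k} = measure Q {w \<in> space Q. emeasure (N w) B = of_nat k}"
  proof (rule measure_eq_AE)
    show "AE w in Q. w \<in> {w \<in> space Q. measure (N w) B = real k} \<longleftrightarrow> w \<in> {w \<in> space Q. emeasure (N w) B = of_nat k}"
      using AE
    proof eventually_elim
      case (elim w)
      then obtain l where l: "emeasure (N w) B = of_nat l" by blast
      have "(of_nat l :: ennreal) = of_nat k \<longleftrightarrow> l = k" by (rule of_nat_eq_iff)
      then show ?case using l val[OF l] by simp
    qed
    show "{w \<in> space Q. measure (N w) B = real k} \<in> sets Q"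
      using measurable_sets[OF Ym, of "{real k}"] by (simp add: vimage_def Int_def conj_commute)
  qed (rule ms)
  then show "measure Q {w \<in> space Q. measure (N w) B = real k} = ?l ^ k / fact k * exp (- ?l)"
    by (simp add: P)
qed

text \<open>Bounded times and sizes at least \<open>\<delta>\<close> become a bounded rectangle in
  grid coordinates, since \<open>y powr - \<alpha>\<close> decreases in \<open>y\<close>. Thus
  finitely many cells of each side length cover the set.\<close>

lemma test_set_bounds:
  assumes \<alpha>: "0 < \<alpha>" and B: "B \<in> test_sets \<alpha>"
  obtains K S :: nat where "\<And>t y. (t, y) \<in> positive_part B \<Longrightarrow> 0 < t \<and> t \<le> real K \<and> 0 < y \<and> y powr - \<alpha> < real S"
proof -
  obtain k \<delta> where \<delta>: "0 < \<delta>" "B \<subseteq> {..k} \<times> {y. \<delta> \<le> \<bar>y\<bar>}" and tss: "B \<subseteq> time_size_space"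
    using B unfolding test_sets_def by blast
  obtain K :: nat where K: "k \<le> real K" using real_arch_simple by blast
  obtain S :: nat where S: "\<delta> powr - \<alpha> < real S" using reals_Archimedean2 by blast
  show ?thesis
  proof (rule that[of K S])
    fix t y assume ty: "(t, y) \<in> positive_part B"
    then have y: "0 < y" "\<delta> \<le> y" "t \<le> k" "0 < t"
      using \<delta>(2) tss unfolding positive_part_def time_size_space_def by auto
    have "y powr - \<alpha> \<le> \<delta> powr - \<alpha>" using \<alpha> y \<delta>(1) by (intro powr_mono2') auto
    then show "0 < t \<and> t \<le> real K \<and> 0 < y \<and> y powr - \<alpha> < real S" using y K S by auto
  qed
qed

section \<open>Counts of a test set in a fixed environment\<close>

context random_expanding
begin

lemma count_process_hits:
  assumes "B \<subseteq> {0<..real m} \<times> UNIV"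
  shows "count_process T \<phi> b n \<omega> B x = hits (level \<phi> b B n) \<omega> (m * n) x"
  unfolding count_process_eq_card[OF assms] hits_def ..

lemma count_process_positive_part:
  assumes b: "\<And>n. 1 \<le> n \<Longrightarrow> 0 < b n" and B: "B \<subseteq> time_size_space"
  shows "count_process T (obs \<alpha> z) b n \<omega> B x = count_process T (obs \<alpha> z) b n \<omega> (positive_part B) x"
proof -
  have "(real j / real n, obs \<alpha> z y / b n) \<in> B \<longleftrightarrow> (real j / real n, obs \<alpha> z y / b n) \<in> positive_part B" for j y
  proof (cases "n = 0")
    case False
    then have "0 \<le> obs \<alpha> z y / b n" using b[of n] by (simp add: obs_def)
    then show ?thesis using B unfolding positive_part_def time_size_space_def by auto
  qed (use B in \<open>auto simp: positive_part_def time_size_space_def\<close>)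
  then show ?thesis unfolding count_process_def by simp
qed

lemma hits_level_sandwich:
  assumes "U \<subseteq> B" "B \<subseteq> U \<union> V" "hits (level \<phi> b V n) \<omega> m x = 0"
  shows "hits (level \<phi> b B n) \<omega> m x = hits (level \<phi> b U n) \<omega> m x"
proof -
  have "finite {i. i < m \<and> rmap T i \<omega> x \<in> level \<phi> b V n i}" by simp
  then have "\<And>i. i < m \<Longrightarrow> rmap T i \<omega> x \<notin> level \<phi> b V n i"
    using assms(3) unfolding hits_def by auto
  then have "{i. i < m \<and> rmap T i \<omega> x \<in> level \<phi> b B n i} = {i. i < m \<and> rmap T i \<omega> x \<in> level \<phi> b U n i}"
    using assms(1,2) unfolding level_def by blast
  then show ?thesis by (simp add: hits_def)
qed

context
  fixes p :: "'q pmf" and z \<alpha> :: real and b :: "nat \<Rightarrow> real" and \<omega> :: "int \<Rightarrow> 'q"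
  assumes z: "z \<in> {0..1} - disc_set T A" and \<alpha>: "0 < \<alpha>" and b: "\<And>n. 1 \<le> n \<Longrightarrow> 0 < b n"
    and scale: "(\<lambda>n. real n * (\<integral>\<omega>. ball_mass z \<omega> (b n powr - \<alpha>) \<partial>bernoulli p)) \<longlonglongrightarrow> 1"
    and nr: "\<And>i l. 1 \<le> l \<Longrightarrow> rmap T l (shift (int i) \<omega>) z \<noteq> z"
    and \<omega>: "(\<lambda>n. (\<Sum>j<n. local_density z (shift (int j) \<omega>)) / real n) \<longlonglongrightarrow> (\<integral>\<omega>. local_density z \<omega> \<partial>bernoulli p)"
begin

lemma count_process_positive_part': "B \<subseteq> time_size_space \<Longrightarrow>
  count_process T (obs \<alpha> z) b n \<omega> B x = count_process T (obs \<alpha> z) b n \<omega> (positive_part B) x"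
  by (rule count_process_positive_part) (rule b)

lemma grid_cells_limit:
  assumes N: "1 \<le> N" and F: "F \<subseteq> grid_index m s N"
  defines "U \<equiv> \<Union>c\<in>F. grid_cell \<alpha> (1 / real N) c"
  shows "(\<lambda>n. measure (sample_measure T \<omega>) {x \<in> {0..1}. hits (level (obs \<alpha> z) b U n) \<omega> (m * n) x = k})
     \<longlonglongrightarrow> measure (intensity \<alpha>) U ^ k / fact k * exp (- measure (intensity \<alpha>) U)"
proof -
  have fin: "finite F" using F finite_cells(3) by (rule finite_subset)
  have g: "0 < 1 / real N" using N by simp
  have t: "real (Suc a) * (1 / real N) \<le> real m" if "(a, c) \<in> F" for a c
    using grid_index_time[OF N] F that by blast
  show ?thesis
    unfolding U_def measure_grid_cells[OF \<alpha> g fin]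
    by (rule grid_poisson_limit[OF z \<alpha> _ scale _ \<omega> g fin]) (erule b, erule nr, erule t)
qed

text \<open>The counts of \<open>B\<close> and of its inner cells differ only if a boundary cell is hit, which has
  asymptotic probability \<open>1 - exp (- v)\<close> with \<open>v\<close> the intensity of the boundary cells.\<close>

lemma count_poisson_limit:
  assumes B: "B \<in> test_sets \<alpha>"
  shows "(\<lambda>n. measure (sample_measure T \<omega>) {x \<in> {0..1}. count_process T (obs \<alpha> z) b n \<omega> B x = k})
     \<longlonglongrightarrow> measure (intensity \<alpha>) B ^ k / fact k * exp (- measure (intensity \<alpha>) B)"
proof -
  interpret P: prob_space "sample_measure T \<omega>" by (rule prob_space_sample_measure)
  have Bb: "B \<in> sets borel" "B \<subseteq> time_size_space" "emeasure (intensity \<alpha>) B < \<infinity>"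
    "emeasure (intensity \<alpha>) (top_of_set time_size_space frontier_of B) = 0"
    using B unfolding test_sets_def by auto
  let ?B = "positive_part B" and ?\<mu> = "measure (intensity \<alpha>)"
  define l where "l = ?\<mu> B"
  obtain K S :: nat where KS: "\<And>t y. (t, y) \<in> ?B \<Longrightarrow> 0 < t \<and> t \<le> real K \<and> 0 < y \<and> y powr - \<alpha> < real S"
    using test_set_bounds[OF \<alpha> B] by blast
  let ?g = "\<lambda>N. 1 / real N"
  let ?U = "\<lambda>N. \<Union>c\<in>inner_cells \<alpha> K S B N. grid_cell \<alpha> (?g N) c"
  let ?V = "\<lambda>N. \<Union>c\<in>boundary_cells \<alpha> K S B N. grid_cell \<alpha> (?g N) c"
  have cellpos: "grid_cell \<alpha> g c \<subseteq> UNIV \<times> {0<..}" for g c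
    unfolding grid_cell_def by (auto split: prod.splits)
  have UB: "?U N \<subseteq> ?B" for N
    using cellpos unfolding inner_cells_def positive_part_def by blast
  have BUV: "?B \<subseteq> ?U N \<union> ?V N" if N: "1 \<le> N" for N
  proof
    fix q assume q: "q \<in> ?B"
    obtain t y where ty: "q = (t, y)" by force
    obtain c where c: "c \<in> grid_index K S N" "q \<in> grid_cell \<alpha> (?g N) c"
      using grid_index_cover[OF N, of t K y \<alpha> S] KS[of t y] q unfolding ty by auto
    then show "q \<in> ?U N \<union> ?V N"
      using q unfolding inner_cells_def boundary_cells_def positive_part_def by blast
  qed
  have Bs: "?B \<in> sets (intensity \<alpha>)"
    using Bb by (intro sets_intensity_I positive_part_borel) (auto simp: positive_part_def)
  have Bl: "emeasure (intensity \<alpha>) ?B = emeasure (intensity \<alpha>) B"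
    by (rule positive_part_intensity[OF Bb(1,2)])
  then have Bm: "?\<mu> ?B = l" unfolding l_def measure_def by simp
  have Bfin: "?B \<in> fmeasurable (intensity \<alpha>)" using Bs Bb(3) Bl by (intro fmeasurableI) auto
  have cfin: "(\<Union>c\<in>F. grid_cell \<alpha> (?g N) c) \<in> fmeasurable (intensity \<alpha>)" if "1 \<le> N" "finite F" for N F
    using that emeasure_grid_cells[OF \<alpha>, of "?g N" F] by (intro fmeasurableI grid_cells_sets) auto
  have V0: "(\<lambda>N. ?\<mu> (?V N)) \<longlonglongrightarrow> 0"
    by (rule boundary_cells_measure_tendsto[OF \<alpha> Bb(2,4)])
  have Ul: "(\<lambda>N. ?\<mu> (?U N)) \<longlonglongrightarrow> l"
  proof (rule tendsto_sandwich)
    have "(\<lambda>N. l - ?\<mu> (?V N)) \<longlonglongrightarrow> l - 0" by (intro tendsto_intros V0)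
    then show "(\<lambda>N. l - ?\<mu> (?V N)) \<longlonglongrightarrow> l" by simp
    show "\<forall>\<^sub>F N in sequentially. l - ?\<mu> (?V N) \<le> ?\<mu> (?U N)"
      using eventually_ge_at_top[of 1]
    proof eventually_elim
      case (elim N)
      note f = cfin[OF elim finite_cells(1)] cfin[OF elim finite_cells(2)]
      have "l \<le> ?\<mu> (?U N \<union> ?V N)"
        unfolding Bm[symmetric] using f Bs by (intro measure_mono_fmeasurable BUV[OF elim]) auto
      also have "\<dots> \<le> ?\<mu> (?U N) + ?\<mu> (?V N)" using f by (intro measure_Un_le) (auto simp: fmeasurableD)
      finally show ?case by simp
    qed
    show "\<forall>\<^sub>F N in sequentially. ?\<mu> (?U N) \<le> l"
      using eventually_ge_at_top[of 1]
    proof eventually_elim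
      case (elim N)
      show ?case unfolding Bm[symmetric]
        using cfin[OF elim finite_cells(1)] Bfin by (intro measure_mono_fmeasurable UB) (auto simp: fmeasurableD)
    qed
  qed auto
  define N\<^sub>B where "N\<^sub>B = (\<lambda>n. hits (level (obs \<alpha> z) b ?B n) \<omega> (K * n))"
  define N\<^sub>U where "N\<^sub>U = (\<lambda>N n. hits (level (obs \<alpha> z) b (?U N) n) \<omega> (K * n))"
  define N\<^sub>V where "N\<^sub>V = (\<lambda>N n. hits (level (obs \<alpha> z) b (?V N) n) \<omega> (K * n))"
  have BK: "?B \<subseteq> {0<..real K} \<times> UNIV" using KS by auto
  have count: "count_process T (obs \<alpha> z) b n \<omega> B x = N\<^sub>B n x" for n x
    unfolding N\<^sub>B_def count_process_positive_part'[OF Bb(2)] by (rule count_process_hits[OF BK])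
  have BbB: "?B \<in> sets borel" by (rule positive_part_borel[OF Bb(1)])
  have hm: "{x \<in> {0..1}. hits (level (obs \<alpha> z) b E n) \<omega> m x = j} \<in> P.events" if "E \<in> sets borel" for E n m j
  proof -
    have "hits (level (obs \<alpha> z) b E n) \<omega> m \<in> measurable unit_leb (count_space UNIV)"
      by (rule hits_measurable[OF level_borel[OF that]])
    from measurable_sets[OF this, of "{j}"] show ?thesis by (simp add: vimage_def Int_def conj_commute)
  qed
  let ?pois = "\<lambda>v. v ^ k / fact k * exp (- v) :: real"
  have limU: "(\<lambda>n. P.prob {x \<in> {0..1}. N\<^sub>U N n x = k}) \<longlonglongrightarrow> ?pois (?\<mu> (?U N))" if N: "1 \<le> N" for N
    unfolding N\<^sub>U_def by (rule grid_cells_limit[OF N]) (auto simp: inner_cells_def)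
  have limV: "(\<lambda>n. P.prob {x \<in> {0..1}. N\<^sub>V N n x = 0}) \<longlonglongrightarrow> exp (- ?\<mu> (?V N))" if N: "1 \<le> N" for N
  proof -
    have "boundary_cells \<alpha> K S B N \<subseteq> grid_index K S N" by (auto simp: boundary_cells_def)
    from grid_cells_limit[OF N this, of 0] show ?thesis unfolding N\<^sub>V_def by simp
  qed
  have diff: "\<bar>P.prob {x \<in> {0..1}. N\<^sub>B n x = k} - P.prob {x \<in> {0..1}. N\<^sub>U N n x = k}\<bar> \<le> 1 - P.prob {x \<in> {0..1}. N\<^sub>V N n x = 0}"
    if N: "1 \<le> N" for N n
  proof -
    let ?XB = "{x \<in> {0..1}. N\<^sub>B n x = k}" and ?XU = "{x \<in> {0..1}. N\<^sub>U N n x = k}" and ?XV = "{x \<in> {0..1}. N\<^sub>V N n x = 0}"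
    have ev: "?XB \<in> P.events" "?XU \<in> P.events" "?XV \<in> P.events"
      unfolding N\<^sub>B_def N\<^sub>U_def N\<^sub>V_def by (intro hm BbB grid_cells_borel finite_cells)+
    have eq: "N\<^sub>B n x = N\<^sub>U N n x" if "N\<^sub>V N n x = 0" for x
      using that unfolding N\<^sub>B_def N\<^sub>U_def N\<^sub>V_def by (rule hits_level_sandwich[OF UB BUV[OF N]])
    have cev: "space (sample_measure T \<omega>) - ?XV \<in> P.events" by (rule sets.compl_sets[OF ev(3)])
    have comp: "P.prob (space (sample_measure T \<omega>) - ?XV) = 1 - P.prob ?XV" by (rule P.prob_compl[OF ev(3)])
    have "P.prob ?XB \<le> P.prob (?XU \<union> (space (sample_measure T \<omega>) - ?XV))"
      by (rule P.finite_measure_mono[OF _ sets.Un[OF ev(2) cev]]) (use eq in auto)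
    also have "\<dots> \<le> P.prob ?XU + P.prob (space (sample_measure T \<omega>) - ?XV)"
      by (intro measure_Un_le ev cev)
    finally have 1: "P.prob ?XB \<le> P.prob ?XU + (1 - P.prob ?XV)" unfolding comp .
    have "P.prob ?XU \<le> P.prob (?XB \<union> (space (sample_measure T \<omega>) - ?XV))"
      by (rule P.finite_measure_mono[OF _ sets.Un[OF ev(1) cev]]) (use eq in auto)
    also have "\<dots> \<le> P.prob ?XB + P.prob (space (sample_measure T \<omega>) - ?XV)"
      by (intro measure_Un_le ev cev)
    finally have 2: "P.prob ?XU \<le> P.prob ?XB + (1 - P.prob ?XV)" unfolding comp .
    show ?thesis using 1 2 by linarith
  qed
  have "(\<lambda>n. P.prob {x \<in> {0..1}. N\<^sub>B n x = k}) \<longlonglongrightarrow> ?pois l"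
  proof (rule LIMSEQ_I)
    fix e :: real assume e: "0 < e"
    \<comment> \<open>\<open>N\<close> is fixed before \<open>n\<close>. The four shares of
      \<open>e / 4\<close> are the limiting probability of a boundary hit, the change of the Poisson
      weight from \<open>l\<close> to the inner cells, and the two convergences in
      \<open>n\<close>.\<close>
    have "(\<lambda>N. 1 - exp (- ?\<mu> (?V N))) \<longlonglongrightarrow> 1 - exp (- 0)" by (intro tendsto_intros V0)
    then have "\<forall>\<^sub>F N in sequentially. 1 - exp (- ?\<mu> (?V N)) < e / 4"
      using e by (intro order_tendstoD(2)) auto
    moreover have "(\<lambda>N. ?pois (?\<mu> (?U N))) \<longlonglongrightarrow> ?pois l" by (intro tendsto_intros Ul) auto
    then have "\<forall>\<^sub>F N in sequentially. dist (?pois (?\<mu> (?U N))) (?pois l) < e / 4"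
      using e by (intro tendstoD) auto
    ultimately have "\<forall>\<^sub>F N in sequentially. 1 \<le> N \<and> 1 - exp (- ?\<mu> (?V N)) < e / 4 \<and> dist (?pois (?\<mu> (?U N))) (?pois l) < e / 4"
      using eventually_ge_at_top[of 1] by eventually_elim auto
    then obtain N where N: "1 \<le> N" "1 - exp (- ?\<mu> (?V N)) < e / 4" "dist (?pois (?\<mu> (?U N))) (?pois l) < e / 4"
      using eventually_happens'[OF sequentially_bot] by blast
    have "\<forall>\<^sub>F n in sequentially. dist (P.prob {x \<in> {0..1}. N\<^sub>U N n x = k}) (?pois (?\<mu> (?U N))) < e / 4"
      using e by (intro tendstoD limU N) auto
    moreover have "\<forall>\<^sub>F n in sequentially. dist (P.prob {x \<in> {0..1}. N\<^sub>V N n x = 0}) (exp (- ?\<mu> (?V N))) < e / 4"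
      using e by (intro tendstoD limV N) auto
    ultimately have "\<forall>\<^sub>F n in sequentially. norm (P.prob {x \<in> {0..1}. N\<^sub>B n x = k} - ?pois l) < e"
    proof eventually_elim
      case (elim n)
      then show ?case using N(2,3) diff[OF N(1), of n] unfolding dist_real_def real_norm_def by linarith
    qed
    then show "\<exists>no. \<forall>n\<ge>no. norm (P.prob {x \<in> {0..1}. N\<^sub>B n x = k} - ?pois l) < e"
      by (simp add: eventually_sequentially)
  qed
  then show ?thesis by (simp add: count l_def)
qed

lemma count_process_measurable:
  assumes B: "B \<in> test_sets \<alpha>"
  shows "count_process T (obs \<alpha> z) b n \<omega> B \<in> measurable (sample_measure T \<omega>) (count_space UNIV)"
proof -
  have Bb: "B \<in> sets borel" "B \<subseteq> time_size_space" using B unfolding test_sets_def by auto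
  obtain K S :: nat where KS: "\<And>t y. (t, y) \<in> positive_part B \<Longrightarrow> 0 < t \<and> t \<le> real K \<and> 0 < y \<and> y powr - \<alpha> < real S"
    using test_set_bounds[OF \<alpha> B] by blast
  have m: "positive_part B \<in> sets borel" by (rule positive_part_borel[OF Bb(1)])
  have "positive_part B \<subseteq> {0<..real K} \<times> UNIV" using KS by auto
  then have "count_process T (obs \<alpha> z) b n \<omega> B = hits (level (obs \<alpha> z) b (positive_part B) n) \<omega> (K * n)"
    unfolding fun_eq_iff count_process_positive_part'[OF Bb(2)] by (simp add: count_process_hits)
  then show ?thesis
    using hits_measurable[OF level_borel[OF m]] by (simp add: sample_measure_def)
qed

lemma count_process_weak_conv:
  assumes N: "poisson_point_process Q N (intensity \<alpha>)" and B: "B \<in> test_sets \<alpha>"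
  shows "weak_conv_m
     (\<lambda>n. distr (sample_measure T \<omega>) borel (\<lambda>x. real (count_process T (obs \<alpha> z) b n \<omega> B x)))
     (distr Q borel (\<lambda>w. measure (N w) B))"
proof -
  have Bb: "B \<in> sets (intensity \<alpha>)" "emeasure (intensity \<alpha>) B < \<infinity>"
    using B sets_intensity_I[of B \<alpha>] unfolding test_sets_def by auto
  show ?thesis
  proof (rule weak_conv_m_nat)
    show "prob_space Q" using N unfolding poisson_point_process_def by simp
    show "(\<lambda>n. measure (sample_measure T \<omega>) {x \<in> space (sample_measure T \<omega>). count_process T (obs \<alpha> z) b n \<omega> B x = k})
       \<longlonglongrightarrow> measure Q {w \<in> space Q. measure (N w) B = real k}" for k
      using count_poisson_limit[OF B, of k] by (simp add: poisson_point_process_count(3)[OF N Bb])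
  qed (use prob_space_sample_measure count_process_measurable[OF B] poisson_point_process_count[OF N Bb] in auto)
qed

end

section \<open>The normalisation and the conditions of the theorem\<close>

lemma stationary_ball_mass:
  assumes "0 < \<alpha>" "0 < b"
  shows "stationary p T {x \<in> {0..1}. b < obs \<alpha> z x} = (\<integral>\<omega>. ball_mass z \<omega> (b powr - \<alpha>) \<partial>bernoulli p)"
proof -
  let ?E = "{x \<in> {0..1}. b < obs \<alpha> z x}"
  have E: "?E \<in> sets unit_leb"
  proof -
    note [measurable] = obs_measurable
    have "{x. b < obs \<alpha> z x} \<in> sets borel" by measurable
    from sets_unit_leb_I[OF this] show ?thesis by (simp add: Int_def conj_commute)
  qed
  \<comment> \<open>The superlevel set is the ball of radius \<open>b powr - \<alpha>\<close>
    without its centre, where \<open>obs\<close> is 0. The normalisation of \<open>b n\<close> thus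
    becomes one of these radii.\<close>
  have iff: "b < obs \<alpha> z x \<longleftrightarrow> \<bar>x - z\<bar> < b powr - \<alpha>" if x: "x \<noteq> z" for x
  proof -
    define u where "u = \<bar>x - z\<bar>"
    have u: "0 < u" using x by (simp add: u_def)
    have bb: "(b powr - \<alpha>) powr (- 1 / \<alpha>) = b" using assms by (simp add: powr_powr)
    have "b < u powr (- 1 / \<alpha>) \<longleftrightarrow> u < b powr - \<alpha>"
      using powr_less_mono2_neg[of "- 1 / \<alpha>" u "b powr - \<alpha>"] powr_less_mono2_neg[of "- 1 / \<alpha>" "b powr - \<alpha>" u] u assms bb
      by (cases u "b powr - \<alpha>" rule: linorder_cases) auto
    then show ?thesis by (simp add: obs_def u_def)
  qed
  have "measure (sample_measure T \<omega>) ?E = ball_mass z \<omega> (b powr - \<alpha>)" for \<omega>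
    unfolding measure_sample_measure[OF E] ball_mass_def
  proof (rule integral_cong_AE)
    show "AE x in unit_leb. indicator ?E x * h \<omega> x = indicator {y. \<bar>y - z\<bar> < b powr - \<alpha>} x * h \<omega> x"
      using AE_unit_leb_neq[of z] AE_space by eventually_elim (auto simp: indicator_def iff)
    show "(\<lambda>x. indicator {y. \<bar>y - z\<bar> < b powr - \<alpha>} x * h \<omega> x) \<in> borel_measurable unit_leb"
      using integrable_indicator_mult[OF ball_borel h_integrable] by (rule borel_measurable_integrable)
    show "(\<lambda>x. indicator ?E x * h \<omega> x) \<in> borel_measurable unit_leb"
      using E h_integrable[of \<omega>] by (intro borel_measurable_times borel_measurable_indicator) auto
  qed
  then show ?thesis by (simp add: stationary_def)
qed

end

text \<open>Enlarging \<open>C\<close> to \<open>max 1 C\<close> extends the decay bound to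
  \<open>n = 0\<close>, where the operator is the identity.\<close>

lemma random_expandingI:
  fixes T :: "'q::finite \<Rightarrow> real \<Rightarrow> real"
  assumes T: "\<And>i. piecewise_expanding (T i) (A i)"
    and "cond_LY T" and "cond_Min T" and "cond_Dec T"
  obtains M C \<theta> c where "random_expanding T A M C \<theta> c"
proof -
  interpret expanding_maps T A by unfold_locales (rule T)
  obtain M where M: "0 < M" "\<And>\<omega> f. f \<in> BV \<Longrightarrow> BV_norm (rtransfer T 1 \<omega> f) \<le> ennreal M * BV_norm f"
    using assms(2) unfolding cond_LY_def by blast
  obtain c where c: "0 < c" "\<And>n \<omega>. 1 \<le> n \<Longrightarrow> AE x in unit_leb. c \<le> rtransfer T n \<omega> (\<lambda>_. 1) x"
    using assms(3) unfolding cond_Min_def by blast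
  obtain C \<theta> where C: "0 < C" "0 < \<theta>" "\<theta> < 1" "\<And>n \<omega> f. \<lbrakk>1 \<le> n; f \<in> BV; (\<integral>x. f x \<partial>unit_leb) = 0\<rbrakk> \<Longrightarrow>
      BV_norm (rtransfer T n \<omega> f) \<le> ennreal (C * \<theta> ^ n) * BV_norm f"
    using assms(4) unfolding cond_Dec_def by blast
  have le: "BV_le (rtransfer T n \<omega> f) (a * d)"
    if "BV_le f d" "BV_norm (rtransfer T n \<omega> f) \<le> ennreal a * BV_norm f" "0 \<le> a" for n \<omega> f a d
  proof -
    have "ennreal a * BV_norm f \<le> ennreal a * ennreal d"
      using that(1) unfolding BV_le_def by (intro mult_left_mono) auto
    then have "BV_norm (rtransfer T n \<omega> f) \<le> ennreal (a * d)"
      using that BV_le_nonneg[OF that(1)] by (simp add: ennreal_mult)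
    then show ?thesis
      using that(3) BV_le_nonneg[OF that(1)] rtransfer_integrable[OF BV_le_integrable[OF that(1)]]
      unfolding BV_le_def by simp
  qed
  have "random_expanding T A M (max 1 C) \<theta> c"
  proof unfold_locales
    show "BV_le (rtransfer T 1 \<omega> f) (M * d)" if "BV_le f d" for \<omega> f d
      using le[OF that M(2)[OF BV_le_imp_BV[OF that]]] M(1) by simp
    show "BV_le (rtransfer T n \<omega> f) (max 1 C * \<theta> ^ n * d)"
      if f: "BV_le f d" "(\<integral>x. f x \<partial>unit_leb) = 0" for n \<omega> f d
    proof (cases "n = 0")
      case True
      then show ?thesis using BV_le_mono[OF f(1), of "max 1 C * d"] BV_le_nonneg[OF f(1)]
        by (simp add: mult_le_cancel_right1)
    next
      case False
      then have "BV_le (rtransfer T n \<omega> f) (C * \<theta> ^ n * d)"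
        using C by (intro le[OF f(1) C(4)[OF _ BV_le_imp_BV[OF f(1)] f(2)]]) auto
      then show ?thesis
        by (rule BV_le_mono) (use BV_le_nonneg[OF f(1)] C in \<open>auto intro!: mult_right_mono\<close>)
    qed
  qed (use M C c in auto)
  then show ?thesis by (rule that)
qed

theorem theorem6p3:
  fixes T :: "'q::finite \<Rightarrow> real \<Rightarrow> real"
    and A :: "'q \<Rightarrow> real set set"
    and p :: "'q pmf"
    and \<alpha> x0 :: real
    and b :: "nat \<Rightarrow> real"
    and Q :: "'w measure"
    and N :: "'w \<Rightarrow> (real \<times> real) measure"
  assumes "\<And>i. piecewise_expanding (T i) (A i)"
    and "cond_LY T" and "cond_Min T" and "cond_Dec T"
    and "0 < \<alpha>" and "\<alpha> < 2"
    and "x0 \<in> {0..1} - disc_set T A"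
    and "nonrecurrent p T x0"
    and "\<And>n. 1 \<le> n \<Longrightarrow> 0 < b n"
    and "(\<lambda>n. real n * stationary p T {x \<in> {0..1}. b n < obs \<alpha> x0 x}) \<longlonglongrightarrow> 1"
    and "poisson_point_process Q N (intensity \<alpha>)"
  shows "AE \<omega> in bernoulli p. \<forall>B \<in> test_sets \<alpha>.
           weak_conv_m
             (\<lambda>n. distr (sample_measure T \<omega>) borel
                    (\<lambda>x. real (count_process T (obs \<alpha> x0) b n \<omega> B x)))
             (distr Q borel (\<lambda>w. measure (N w) B))"
proof -
  obtain M C \<theta> c where "random_expanding T A M C \<theta> c"
    using random_expandingI[OF assms(1-4)] by blast
  then interpret random_expanding T A M C \<theta> c .
  have eq: "real n * stationary p T {x \<in> {0..1}. b n < obs \<alpha> x0 x} =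
      real n * (\<integral>\<omega>. ball_mass x0 \<omega> (b n powr - \<alpha>) \<partial>bernoulli p)" for n
  proof (cases "n = 0")
    case False
    then show ?thesis using stationary_ball_mass[OF assms(5) assms(9)[of n], of p x0] by simp
  qed simp
  have scale: "(\<lambda>n. real n * (\<integral>\<omega>. ball_mass x0 \<omega> (b n powr - \<alpha>) \<partial>bernoulli p)) \<longlonglongrightarrow> 1"
    using assms(10) unfolding eq .
  have x0: "x0 \<in> {0..1}" using assms(7) by simp
  have LLN: "AE \<omega> in bernoulli p. (\<lambda>n. (\<Sum>j<n. local_density x0 (shift (int j) \<omega>)) / real n)
      \<longlonglongrightarrow> (\<integral>\<omega>. local_density x0 \<omega> \<partial>bernoulli p)"
    by (rule LLN_uniform_cylinder(2)) (rule local_density_uniform_cylinder[OF x0])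
  from LLN AE_nonrecurrent[OF assms(8)] show ?thesis
  proof eventually_elim
    case (elim \<omega>)
    show ?case
    proof
      fix B assume "B \<in> test_sets \<alpha>"
      with assms(5,7,9,11) scale elim show "weak_conv_m
             (\<lambda>n. distr (sample_measure T \<omega>) borel
                    (\<lambda>x. real (count_process T (obs \<alpha> x0) b n \<omega> B x)))
             (distr Q borel (\<lambda>w. measure (N w) B))"
        by (intro count_process_weak_conv) auto
    qed
  qed
qed

end
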